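(* Let $(\mathbf U,\mathbf B)$, $(\mathbf U,\mathbf B')$ be quantum symmetric pairs for the same irreducible Satake diagram which contains a rank-one subdiagram $I[i]$ of type $\mathsf{AIV}$ (that is, of type $\mathsf{AIII}_{n,p}$ with $n>2p-1$, $\mathsf{AIV}_n$, $\mathsf{DIII}_{2p+1}$ or $\mathsf{EIII}$), and let $\mathbf C\subset\mathbf B$, $\mathbf C'\subset\mathbf B'$ be the subalgebras defined in the context. Then the zonal spherical functions for $(\mathbf U,\mathbf C,\mathbf C')$ are precisely the (linear combinations of) character spherical functions for $(\mathbf U,\mathbf B,\mathbf B')$; that is, $$\{f\in\mathcal A: f(c'xc)=\epsilon(c')f(x)\epsilon(c)\ \ \forall c'\in\mathbf C',x\in\mathbf U,c\in\mathbf C\}=\sum_{\chi',\chi}E^{\chi',\chi}_{\mathbf B',\mathbf B},$$ where $\chi'$ and $\chi$ run over the characters of $\mathbf B'$ and $\mathbf B$.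
   Context: **Quantum group.** $I=\{1,\dots,n\}$ indexes a finite type Cartan matrix $(a_{ij})$; $X,Y$ are lattices with a perfect pairing $\langle\cdot,\cdot\rangle:Y\times X\to\mathbb Z$ and linearly independent $\alpha_i\in X$, $h_i\in Y$ with $\langle h_i,\alpha_j\rangle=a_{ij}$; $\cdot$ is a symmetric bilinear form on $X$ with $\langle h_i,\alpha_j\rangle=2(\alpha_i\cdot\alpha_j)/(\alpha_i\cdot\alpha_i)$ and $|\alpha_i|^2:=\alpha_i\cdot\alpha_i\in2\mathbb Z_{>0}$. For $\lambda\in X$, $h_\lambda\in Y\otimes\mathbb Q$ satisfies $\langle h_\lambda,\mu\rangle=\lambda\cdot\mu$ for all $\mu\in X$; $K_\lambda:=K_{h_\lambda}$. $\omega_i$ denotes the fundamental weights, $W$ the Weyl group. $k=\overline{\mathbb C(q)}$ with a bar automorphism with $\overline q=q^{-1}$; $q_i=q^{|\alpha_i|^2/2}$. $\mathbf U$ is the $k$-algebra generated by $E_i,F_i$ ($i\in I$), $K_h$ ($h\in Y$) with $K_0=1$, $K_hK_{h'}=K_{h+h'}$, $K_hE_i=q^{\langle h,\alpha_i\rangle}E_iK_h$, $K_hF_i=q^{-\langle h,\alpha_i\rangle}F_iK_h$, $[E_i,F_j]=\delta_{ij}(K_{\alpha_i}-K_{-\alpha_i})/(q_i-q_i^{-1})$ and the quantum Serre relations; Hopf algebra with counit $\epsilon$ ($\epsilon(E_i)=\epsilon(F_i)=0$, $\epsilon(K_h)=1$). $T_w$ is Lusztig's braid automorphism $T''_{w,1}$.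 **Quantum symmetric pair.** A compatible admissible pair (Satake diagram) is $(I_\bullet,\tau)$ with $I_\bullet\subset I$, $\tau$ an involutive diagram automorphism (also acting as an involution on $X$ and $Y$, preserving the pairing, with $\tau\alpha_i=\alpha_{\tau(i)}$) such that $w_\bullet\alpha_j=-\alpha_{\tau(j)}$ for $j\in I_\bullet$ ($w_\bullet$ the longest element of the parabolic subgroup of $I_\bullet$) and $\langle\rho_\bullet^\vee,\alpha_i\rangle\in\mathbb Z$ whenever $i\in I_\circ:=I\setminus I_\bullet$, $\tau(i)=i$ ($\rho_\bullet^\vee$, $\rho_\bullet$: half-sums of positive coroots, roots of $I_\bullet$). $\Theta=-w_\bullet\tau$ on $X,Y$. In the cases of the claim the parameters of a coideal subalgebra are $\mathbf c\in(k^\times)^{I_\circ}$ with: $\mathbf c_i=\mathbf c_{\tau(i)}$ if $\alpha_i\cdot\Theta(\alpha_i)=0$; $\overline{\mathbf c_i}=\mathbf c_i^{-1}$; $\mathbf c_i\mathbf c_{\tau(i)}=(-1)^{\langle2\rho_\bullet^\vee,\alpha_i\rangle}q^{\alpha_i\cdot(\Theta(\alpha_i)-2\rho_\bullet)}$ (no non-standard parameters $\mathbf s$ occur). $\mathbf B$ is the subalgebra of $\mathbf U$ generated by $\mathbf U_\bullet:=\langle E_j,F_j,K_{\alpha_j}^{\pm1}:j\in I_\bullet\rangle$, $K_h$ ($h\in Y^\Theta$) and $B_j=F_j+\mathbf c_jT_{w_\bullet}(E_{\tau(j)})K_{-\alpha_j}$ ($j\in I_\circ$); $\mathbf B'$ is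 defined in the same way with parameters $\mathbf d$ satisfying the same conditions. **Subdiagram and $\mathbf C$.** For $i\in I_\circ$, $I[i]$ is the union of the connected components of $I_\bullet\cup\{i,\tau(i)\}$ containing $i$ and $\tau(i)$; it is of type $\mathsf{AIV}_m$ ($m\ge2$) if it has Dynkin type $A_m$, its end nodes $i,\tau(i)$ are white and interchanged by $\tau$, and its interior nodes are black. Fix $i$ with $I[i]$ of type $\mathsf{AIV}_m$ and let $Y'=\{h\in Y^\Theta:\langle h,\omega_i\rangle=0\}$. $\mathbf C\subset\mathbf B$ (resp. $\mathbf C'\subset\mathbf B'$) is the subalgebra generated by $\mathbf U_\bullet$, $K_h$ ($h\in Y'$), and the $B_j$ ($j\in I_\circ$) of $\mathbf B$ (resp. of $\mathbf B'$). **Spherical functions.** $\mathcal A$ is the space of matrix coefficients of finite-dimensional weight modules of $\mathbf U$ (weights in $X$). For characters $\chi'$ of $\mathbf B'$ and $\chi$ of $\mathbf B$, the space of character spherical functions is $E^{\chi',\chi}_{\mathbf B',\mathbf B}=\{f\in\mathcal A:f(b'xb)=\chi'(b')f(x)\chi(b)\ \forall b'\in\mathbf B',x\in\mathbf U,b\in\mathbf B\}$.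
   Formalization: The root datum is assumed semisimple (the coroots h_i span Y⊗Q), so that the fundamental weights ω_i are well defined; with a central torus fixed by Θ the stated equality can fail. *)

theory Defs
  imports
    "HOL-Algebra.Algebraic_Closure_Type"
    "HOL-Algebra.Generated_Rings"
    "HOL-Algebra.QuotRing"
    "HOL-Library.Poly_Mapping"
    "Jordan_Normal_Form.Matrix"
begin

section \<open>The ground field\<close>

type_synonym kk = "complex poly fract alg_closure"

definition qq :: kk where
  "qq = to_ac (Fract [:0, 1:] 1)"

definition bar_automorphism :: "(kk \<Rightarrow> kk) \<Rightarrow> bool" where
  "bar_automorphism bar \<longleftrightarrow>
     bij bar \<and> bar 1 = 1 \<and>
     (\<forall>x y. bar (x + y) = bar x + bar y) \<and> (\<forall>x y. bar (x * y) = bar x * bar y) \<and>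
     bar qq = inverse qq"


section \<open>Root data\<close>

definition zscale :: "int \<Rightarrow> 'a::ab_group_add \<Rightarrow> 'a" (infixr "*\<^sub>Z" 75) where
  "n *\<^sub>Z x = (if 0 \<le> n then ((+) x ^^ nat n) 0 else - ((+) x ^^ nat (- n)) 0)"

definition lattice_basis :: "'a::ab_group_add set \<Rightarrow> bool" where
  "lattice_basis S \<longleftrightarrow> finite S \<and>
     (\<forall>x. \<exists>!c. (\<forall>s. s \<notin> S \<longrightarrow> c s = 0) \<and> x = (\<Sum>s\<in>S. c s *\<^sub>Z s))"

text \<open>The lattices \<open>X\<close> and \<open>Y\<close> are the types \<^typ>\<open>'x\<close> and \<^typ>\<open>'y\<close>, and \<open>I\<close> is the type \<^typ>\<open>'i\<close>.\<close>

record ('i, 'x, 'y) satake_datum =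
  pairing :: "'y \<Rightarrow> 'x \<Rightarrow> int"
  alpha :: "'i \<Rightarrow> 'x"
  coroot :: "'i \<Rightarrow> 'y"
  form :: "'x \<Rightarrow> 'x \<Rightarrow> rat"
  black :: "'i set"
  tau :: "'i \<Rightarrow> 'i"
  tauX :: "'x \<Rightarrow> 'x"
  tauY :: "'y \<Rightarrow> 'y"

abbreviation white :: "('i, 'x, 'y) satake_datum \<Rightarrow> 'i set" where
  "white D \<equiv> - black D"

definition cartan :: "('i, 'x, 'y) satake_datum \<Rightarrow> 'i \<Rightarrow> 'i \<Rightarrow> int" where
  "cartan D i j = pairing D (coroot D i) (alpha D j)"

definition perfect_pairing :: "('y::ab_group_add \<Rightarrow> 'x::ab_group_add \<Rightarrow> int) \<Rightarrow> bool" where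
  "perfect_pairing p \<longleftrightarrow>
     (\<forall>y. additive (p y)) \<and> (\<forall>x. additive (\<lambda>y. p y x)) \<and>
     (\<forall>f. additive f \<longrightarrow> (\<exists>!y. f = p y)) \<and>
     (\<forall>g. additive g \<longrightarrow> (\<exists>!x. g = (\<lambda>y. p y x)))"

definition Z_independent :: "('i::finite \<Rightarrow> 'a::ab_group_add) \<Rightarrow> bool" where
  "Z_independent v \<longleftrightarrow> (\<forall>c. (\<Sum>i\<in>UNIV. c i *\<^sub>Z v i) = 0 \<longrightarrow> (\<forall>i. c i = 0))"

definition finite_type_cartan :: "('i::finite \<Rightarrow> 'i \<Rightarrow> int) \<Rightarrow> bool" where
  "finite_type_cartan a \<longleftrightarrow>
     (\<forall>i. a i i = 2) \<and>
     (\<forall>i j. i \<noteq> j \<longrightarrow> a i j \<le> 0) \<and>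
     (\<forall>i j. a i j = 0 \<longrightarrow> a j i = 0) \<and>
     (\<exists>d :: 'i \<Rightarrow> real. (\<forall>i. d i > 0) \<and>
        (\<forall>i j. d i * of_int (a i j) = d j * of_int (a j i)) \<and>
        (\<forall>x :: 'i \<Rightarrow> real. (\<exists>i. x i \<noteq> 0) \<longrightarrow>
           (\<Sum>i\<in>UNIV. \<Sum>j\<in>UNIV. x i * (d i * of_int (a i j)) * x j) > 0))"

text \<open>
  The last clause says that the coroots span \<open>Y \<otimes> \<rat>\<close> (hence the roots span \<open>X \<otimes> \<rat>\<close>), i.e. that the
  root datum is semisimple; this is what makes the fundamental weights well defined elements of
  \<open>X \<otimes> \<rat>\<close>. They need not lie in \<open>X\<close>.
\<close>

definition root_datum ::
  "('i::finite, 'x::ab_group_add, 'y::ab_group_add) satake_datum \<Rightarrow> bool" where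
  "root_datum D \<longleftrightarrow>
     (\<exists>S :: 'x set. lattice_basis S) \<and> (\<exists>S :: 'y set. lattice_basis S) \<and>
     perfect_pairing (pairing D) \<and>
     Z_independent (alpha D) \<and> Z_independent (coroot D) \<and>
     finite_type_cartan (cartan D) \<and>
     (\<forall>l m. form D l m = form D m l) \<and> (\<forall>l. additive (form D l)) \<and>
     (\<forall>i j. of_int (pairing D (coroot D i) (alpha D j)) =
            2 * form D (alpha D i) (alpha D j) / form D (alpha D i) (alpha D i)) \<and>
     (\<forall>i. \<exists>m::int. m > 0 \<and> form D (alpha D i) (alpha D i) = of_int (2 * m)) \<and>
     (\<forall>y. \<exists>m c. m \<noteq> 0 \<and> m *\<^sub>Z y = (\<Sum>i\<in>UNIV. c i *\<^sub>Z coroot D i))"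

text \<open>
  The element \<open>h\<^sub>\<lambda> \<in> Y \<otimes> \<rat>\<close> attached to \<open>\<lambda>\<close>, for those \<open>\<lambda>\<close> for which it lies in \<open>Y\<close>; this includes
  the root lattice (\<open>h\<^sub>\<lambda> = (|\<alpha>\<^sub>i|\<^sup>2/2) h\<^sub>i\<close> for \<open>\<lambda> = \<alpha>\<^sub>i\<close>), where alone it is used.
\<close>

definition h_of :: "('i, 'x, 'y) satake_datum \<Rightarrow> 'x \<Rightarrow> 'y" where
  "h_of D l = (THE y. \<forall>m. of_int (pairing D y m) = form D l m)"

text \<open>\<open>X \<otimes> \<rat>\<close> is identified with \<open>Hom(Y, \<rat>)\<close> through the pairing, so that \<open>\<langle>h, \<omega>\<^sub>i\<rangle>\<close> is
  \<open>fund_weight D i h\<close>.\<close>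

definition fund_weight ::
  "('i, 'x, 'y::ab_group_add) satake_datum \<Rightarrow> 'i \<Rightarrow> 'y \<Rightarrow> rat" where
  "fund_weight D i =
     (THE w. additive w \<and> (\<forall>j. w (coroot D j) = (if j = i then 1 else 0)))"

definition qi :: "('i, 'x, 'y) satake_datum \<Rightarrow> 'i \<Rightarrow> kk" where
  "qi D i = qq powi \<lfloor>form D (alpha D i) (alpha D i) / 2\<rfloor>"


section \<open>Weyl group\<close>

definition reflX ::
  "('i, 'x::ab_group_add, 'y) satake_datum \<Rightarrow> 'i \<Rightarrow> 'x \<Rightarrow> 'x" where
  "reflX D i m = m - pairing D (coroot D i) m *\<^sub>Z alpha D i"

definition reflY ::
  "('i, 'x, 'y::ab_group_add) satake_datum \<Rightarrow> 'i \<Rightarrow> 'y \<Rightarrow> 'y" where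
  "reflY D i h = h - pairing D h (alpha D i) *\<^sub>Z coroot D i"

text \<open>A word \<open>[i\<^sub>1, \<dots>, i\<^sub>l]\<close> stands for \<open>s\<^bsub>i\<^sub>1\<^esub> \<cdots> s\<^bsub>i\<^sub>l\<^esub>\<close>.\<close>

definition actX ::
  "('i, 'x::ab_group_add, 'y) satake_datum \<Rightarrow> 'i list \<Rightarrow> 'x \<Rightarrow> 'x" where
  "actX D ws = foldr (reflX D) ws"

definition actY ::
  "('i, 'x, 'y::ab_group_add) satake_datum \<Rightarrow> 'i list \<Rightarrow> 'y \<Rightarrow> 'y" where
  "actY D ws = foldr (reflY D) ws"

definition reduced_word ::
  "('i, 'x::ab_group_add, 'y) satake_datum \<Rightarrow> 'i list \<Rightarrow> bool" where
  "reduced_word D ws \<longleftrightarrow> (\<forall>vs. actX D vs = actX D ws \<longrightarrow> length ws \<le> length vs)"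

text \<open>A reduced word for the longest element of the parabolic subgroup of \<open>J\<close>. The choice of the
  word is immaterial: the longest element is unique, and the braid operators satisfy the braid
  relations.\<close>

definition longest_word ::
  "('i, 'x::ab_group_add, 'y) satake_datum \<Rightarrow> 'i set \<Rightarrow> 'i list" where
  "longest_word D J =
     (SOME ws. ws \<in> lists J \<and> reduced_word D ws \<and>
        (\<forall>vs \<in> lists J. reduced_word D vs \<longrightarrow> length vs \<le> length ws))"

abbreviation w_black :: "('i, 'x::ab_group_add, 'y) satake_datum \<Rightarrow> 'i list" where
  "w_black D \<equiv> longest_word D (black D)"

definition pos_roots ::
  "('i::finite, 'x::ab_group_add, 'y) satake_datum \<Rightarrow> 'i set \<Rightarrow> 'x set" where
  "pos_roots D J =
     {b. (\<exists>ws \<in> lists J. \<exists>j \<in> J. b = actX D ws (alpha D j)) \<and>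
         (\<exists>n :: 'i \<Rightarrow> nat. b = (\<Sum>j\<in>J. int (n j) *\<^sub>Z alpha D j))}"

definition pos_coroots ::
  "('i::finite, 'x, 'y::ab_group_add) satake_datum \<Rightarrow> 'i set \<Rightarrow> 'y set" where
  "pos_coroots D J =
     {b. (\<exists>ws \<in> lists J. \<exists>j \<in> J. b = actY D ws (coroot D j)) \<and>
         (\<exists>n :: 'i \<Rightarrow> nat. b = (\<Sum>j\<in>J. int (n j) *\<^sub>Z coroot D j))}"

definition two_rho :: "('i::finite, 'x::ab_group_add, 'y) satake_datum \<Rightarrow> 'x" where
  "two_rho D = \<Sum>(pos_roots D (black D))"

definition two_rho_check :: "('i::finite, 'x, 'y::ab_group_add) satake_datum \<Rightarrow> 'y" where
  "two_rho_check D = \<Sum>(pos_coroots D (black D))"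


section \<open>Satake diagrams\<close>

definition thetaX :: "('i, 'x::ab_group_add, 'y) satake_datum \<Rightarrow> 'x \<Rightarrow> 'x" where
  "thetaX D m = - actX D (w_black D) (tauX D m)"

definition thetaY ::
  "('i, 'x::ab_group_add, 'y::ab_group_add) satake_datum \<Rightarrow> 'y \<Rightarrow> 'y" where
  "thetaY D h = - actY D (w_black D) (tauY D h)"

definition satake_diagram ::
  "('i::finite, 'x::ab_group_add, 'y::ab_group_add) satake_datum \<Rightarrow> bool" where
  "satake_diagram D \<longleftrightarrow>
     (\<forall>i. tau D (tau D i) = i) \<and>
     (\<forall>i j. cartan D (tau D i) (tau D j) = cartan D i j) \<and>
     additive (tauX D) \<and> (\<forall>m. tauX D (tauX D m) = m) \<and>
     additive (tauY D) \<and> (\<forall>h. tauY D (tauY D h) = h) \<and>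
     (\<forall>h m. pairing D (tauY D h) (tauX D m) = pairing D h m) \<and>
     (\<forall>i. tauX D (alpha D i) = alpha D (tau D i)) \<and>
     (\<forall>j \<in> black D. actX D (w_black D) (alpha D j) = - alpha D (tau D j)) \<and>
     (\<forall>i \<in> white D. tau D i = i \<longrightarrow>
        of_int (pairing D (two_rho_check D) (alpha D i)) / 2 \<in> (\<int> :: rat set))"

text \<open>\<open>I\<close> is not the disjoint union of two nonempty \<open>\<tau>\<close>-stable subdiagrams.\<close>

definition irreducible_diagram :: "('i, 'x, 'y) satake_datum \<Rightarrow> bool" where
  "irreducible_diagram D \<longleftrightarrow>
     (\<forall>J. J \<noteq> {} \<and> tau D ` J \<subseteq> J \<and> (\<forall>a\<in>J. \<forall>b\<in>-J. cartan D a b = 0) \<longrightarrow> J = UNIV)"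

definition component :: "('i, 'x, 'y) satake_datum \<Rightarrow> 'i set \<Rightarrow> 'i \<Rightarrow> 'i set" where
  "component D J i =
     {j. (i, j) \<in> {(a, b). a \<in> J \<and> b \<in> J \<and> a \<noteq> b \<and> cartan D a b \<noteq> 0}\<^sup>*}"

definition rank_one_subdiagram :: "('i, 'x, 'y) satake_datum \<Rightarrow> 'i \<Rightarrow> 'i set" where
  "rank_one_subdiagram D i =
     component D (black D \<union> {i, tau D i}) i \<union> component D (black D \<union> {i, tau D i}) (tau D i)"

text \<open>The list \<open>p\<close> enumerates the subdiagram along the Dynkin diagram of type \<open>A\<^sub>m\<close>, \<open>m = length p\<close>,
  from the end node \<open>i\<close> to the end node \<open>\<tau>(i)\<close>.\<close>

definition type_AIV :: "('i, 'x, 'y) satake_datum \<Rightarrow> 'i \<Rightarrow> bool" where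
  "type_AIV D i \<longleftrightarrow>
     (\<exists>p. distinct p \<and> set p = rank_one_subdiagram D i \<and> length p \<ge> 2 \<and>
        (\<forall>a < length p. \<forall>b < length p.
           cartan D (p ! a) (p ! b) =
             (if a = b then 2 else if a = Suc b \<or> b = Suc a then -1 else 0)) \<and>
        hd p = i \<and> last p = tau D i \<and> i \<in> white D \<and> tau D i \<in> white D \<and>
        (\<forall>a. 0 < a \<and> a < length p - 1 \<longrightarrow> p ! a \<in> black D))"


section \<open>Free associative algebras\<close>

text \<open>The free \<open>k\<close>-algebra on \<^typ>\<open>'g\<close> is the monoid algebra of the free monoid of words. The library
  writes the monoid additively, with a not necessarily commutative \<open>+\<close>.\<close>

datatype 'g word = Word (letters: "'g list")

instantiation word :: (type) monoid_add
begin
definition zero_word :: "'a word" where "zero_word = Word []"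
definition plus_word :: "'a word \<Rightarrow> 'a word \<Rightarrow> 'a word" where
  "plus_word v w = Word (letters v @ letters w)"
instance
  by standard (auto simp: zero_word_def plus_word_def)
end

type_synonym 'g free_alg = "'g word \<Rightarrow>\<^sub>0 kk"

definition gen_elem :: "'g \<Rightarrow> 'g free_alg" where
  "gen_elem g = Poly_Mapping.single (Word [g]) 1"

definition scal :: "kk \<Rightarrow> 'g free_alg" where
  "scal a = Poly_Mapping.single 0 a"

text \<open>The homomorphism extending a map \<open>\<phi>\<close> on generators, where \<open>s\<close> is the structure map
  \<open>k \<rightarrow> A\<close> of the target algebra.\<close>

definition alg_extend :: "(kk \<Rightarrow> 'a::ring_1) \<Rightarrow> ('g \<Rightarrow> 'a) \<Rightarrow> 'g free_alg \<Rightarrow> 'a" where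
  "alg_extend s \<phi> p =
     (\<Sum>w\<in>Poly_Mapping.keys p. s (Poly_Mapping.lookup p w) * prod_list (map \<phi> (letters w)))"


section \<open>The quantum group\<close>

datatype ('i, 'y) gen = GE 'i | GF 'i | GK 'y

type_synonym ('i, 'y) free = "('i, 'y) gen free_alg"

definition EE :: "'i \<Rightarrow> ('i, 'y) free" where "EE i = gen_elem (GE i)"
definition FF :: "'i \<Rightarrow> ('i, 'y) free" where "FF i = gen_elem (GF i)"
definition KK :: "'y \<Rightarrow> ('i, 'y) free" where "KK h = gen_elem (GK h)"

definition Kw :: "('i, 'x, 'y) satake_datum \<Rightarrow> 'x \<Rightarrow> ('i, 'y) free" where
  "Kw D l = KK (h_of D l)"

definition q_int :: "kk \<Rightarrow> nat \<Rightarrow> kk" where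
  "q_int v n = (v powi int n - v powi (- int n)) / (v - inverse v)"

definition q_fact :: "kk \<Rightarrow> nat \<Rightarrow> kk" where
  "q_fact v n = (\<Prod>m\<in>{1..n}. q_int v m)"

definition dpow :: "kk \<Rightarrow> 'g free_alg \<Rightarrow> nat \<Rightarrow> 'g free_alg" where
  "dpow v x n = scal (inverse (q_fact v n)) * x ^ n"

definition serre ::
  "('i, 'x, 'y) satake_datum \<Rightarrow> ('i \<Rightarrow> ('i, 'y) free) \<Rightarrow> 'i \<Rightarrow> 'i \<Rightarrow> ('i, 'y) free" where
  "serre D x i j =
     (let m = nat (1 - cartan D i j) in
        \<Sum>r\<le>m. scal ((-1) ^ r) * dpow (qi D i) (x i) r * x j * dpow (qi D i) (x i) (m - r))"

definition relators ::
  "('i, 'x::ab_group_add, 'y::ab_group_add) satake_datum \<Rightarrow> ('i, 'y) free set" where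
  "relators D =
     {KK 0 - 1}
     \<union> {KK h * KK h' - KK (h + h') | h h'. True}
     \<union> {KK h * EE i - scal (qq powi pairing D h (alpha D i)) * EE i * KK h | h i. True}
     \<union> {KK h * FF i - scal (qq powi (- pairing D h (alpha D i))) * FF i * KK h | h i. True}
     \<union> {EE i * FF j - FF j * EE i -
          (if i = j then scal (inverse (qi D i - inverse (qi D i))) *
                         (Kw D (alpha D i) - Kw D (- alpha D i)) else 0) | i j. True}
     \<union> {serre D EE i j | i j. i \<noteq> j}
     \<union> {serre D FF i j | i j. i \<noteq> j}"

abbreviation free_ring :: "('i, 'y) free ring" where
  "free_ring \<equiv> ring_of_type_algebra"

definition rel_ideal ::
  "('i, 'x::ab_group_add, 'y::ab_group_add) satake_datum \<Rightarrow> ('i, 'y) free set" where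
  "rel_ideal D = genideal free_ring (relators D)"

definition UU ::
  "('i, 'x::ab_group_add, 'y::ab_group_add) satake_datum \<Rightarrow> ('i, 'y) free set ring" where
  "UU D = free_ring Quot (rel_ideal D)"

definition cls ::
  "('i, 'x::ab_group_add, 'y::ab_group_add) satake_datum \<Rightarrow> ('i, 'y) free \<Rightarrow> ('i, 'y) free set"
  where "cls D a = a_r_coset free_ring (rel_ideal D) a"

text \<open>The \<open>k\<close>-subalgebra generated by \<open>S\<close>.\<close>

definition subalg ::
  "('i, 'x::ab_group_add, 'y::ab_group_add) satake_datum \<Rightarrow>
   ('i, 'y) free set set \<Rightarrow> ('i, 'y) free set set" where
  "subalg D S = generate_ring (UU D) (range (\<lambda>a. cls D (scal a)) \<union> S)"

fun counit_gen :: "('i, 'y) gen \<Rightarrow> kk" where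
  "counit_gen (GE i) = 0"
| "counit_gen (GF i) = 0"
| "counit_gen (GK h) = 1"

definition counit_free :: "('i, 'y) free \<Rightarrow> kk" where
  "counit_free = alg_extend id counit_gen"

text \<open>\<^const>\<open>counit_free\<close> is constant on the cosets of \<^const>\<open>rel_ideal\<close>; see \<open>counit_cls\<close>
  below.\<close>

definition counit :: "('i, 'y) free set \<Rightarrow> kk" where
  "counit x = the_elem (counit_free ` x)"


subsection \<open>Braid operators\<close>

text \<open>Lusztig's \<open>T''\<^bsub>i,1\<^esub>\<close> on generators. We use the endomorphisms of the free algebra given by
  these formulas; they preserve \<^const>\<open>rel_ideal\<close> and induce Lusztig's automorphisms of \<open>U\<close>, so
  \<open>cls D (braid_word D ws a)\<close> is \<open>T\<^bsub>i\<^sub>1\<^esub> \<cdots> T\<^bsub>i\<^sub>l\<^esub>\<close> applied to \<open>cls D a\<close>.\<close>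

fun braid_gen ::
  "('i, 'x::ab_group_add, 'y::ab_group_add) satake_datum \<Rightarrow> 'i \<Rightarrow> ('i, 'y) gen \<Rightarrow> ('i, 'y) free"
  where
  "braid_gen D i (GE j) =
     (if j = i then - (FF i * Kw D (alpha D i))
      else let m = nat (- cartan D i j) in
        \<Sum>r\<le>m. scal ((-1) ^ r * qi D i powi (- int r)) *
              dpow (qi D i) (EE i) (m - r) * EE j * dpow (qi D i) (EE i) r)"
| "braid_gen D i (GF j) =
     (if j = i then - (Kw D (- alpha D i) * EE i)
      else let m = nat (- cartan D i j) in
        \<Sum>r\<le>m. scal ((-1) ^ r * qi D i powi int r) *
              dpow (qi D i) (FF i) r * FF j * dpow (qi D i) (FF i) (m - r))"
| "braid_gen D i (GK h) = KK (reflY D i h)"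

definition braid ::
  "('i, 'x::ab_group_add, 'y::ab_group_add) satake_datum \<Rightarrow> 'i \<Rightarrow> ('i, 'y) free \<Rightarrow> ('i, 'y) free"
  where "braid D i = alg_extend scal (braid_gen D i)"

definition braid_word ::
  "('i, 'x::ab_group_add, 'y::ab_group_add) satake_datum \<Rightarrow> 'i list \<Rightarrow>
   ('i, 'y) free \<Rightarrow> ('i, 'y) free"
  where "braid_word D ws = foldr (braid D) ws"


section \<open>Quantum symmetric pairs\<close>

text \<open>Only the values of the parameters on the white nodes matter. The exponent of \<open>q\<close> is an
  integer because the form is integral on the root lattice.\<close>

definition admissible_params ::
  "('i::finite, 'x::ab_group_add, 'y::ab_group_add) satake_datum \<Rightarrow> (kk \<Rightarrow> kk) \<Rightarrow>
   ('i \<Rightarrow> kk) \<Rightarrow> bool" where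
  "admissible_params D bar c \<longleftrightarrow>
     (\<forall>i \<in> white D.
        c i \<noteq> 0 \<and>
        (form D (alpha D i) (thetaX D (alpha D i)) = 0 \<longrightarrow> c i = c (tau D i)) \<and>
        bar (c i) = inverse (c i) \<and>
        c i * c (tau D i) =
          (-1) powi (pairing D (two_rho_check D) (alpha D i)) *
          qq powi \<lfloor>form D (alpha D i) (thetaX D (alpha D i) - two_rho D)\<rfloor>)"

definition U_black ::
  "('i, 'x::ab_group_add, 'y::ab_group_add) satake_datum \<Rightarrow> ('i, 'y) free set set" where
  "U_black D = subalg D
     (\<Union>j \<in> black D. {cls D (EE j), cls D (FF j), cls D (Kw D (alpha D j)), cls D (Kw D (- alpha D j))})"

definition B_gen ::
  "('i, 'x::ab_group_add, 'y::ab_group_add) satake_datum \<Rightarrow> ('i \<Rightarrow> kk) \<Rightarrow> 'i \<Rightarrow> ('i, 'y) free set"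
  where
  "B_gen D c j =
     cls D (FF j + scal (c j) * braid_word D (w_black D) (EE (tau D j)) * Kw D (- alpha D j))"

definition Y_theta :: "('i, 'x::ab_group_add, 'y::ab_group_add) satake_datum \<Rightarrow> 'y set" where
  "Y_theta D = {h. thetaY D h = h}"

definition QSP_B ::
  "('i, 'x::ab_group_add, 'y::ab_group_add) satake_datum \<Rightarrow> ('i \<Rightarrow> kk) \<Rightarrow> ('i, 'y) free set set"
  where
  "QSP_B D c = subalg D
     (U_black D \<union> (\<lambda>h. cls D (KK h)) ` Y_theta D \<union> B_gen D c ` white D)"

definition QSP_C ::
  "('i, 'x::ab_group_add, 'y::ab_group_add) satake_datum \<Rightarrow> ('i \<Rightarrow> kk) \<Rightarrow> 'i \<Rightarrow>
   ('i, 'y) free set set" where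
  "QSP_C D c i = subalg D
     (U_black D \<union> (\<lambda>h. cls D (KK h)) ` {h \<in> Y_theta D. fund_weight D i h = 0} \<union>
      B_gen D c ` white D)"


section \<open>Matrix coefficients and spherical functions\<close>

text \<open>A \<open>d\<close>-dimensional module is given by an algebra homomorphism \<open>\<rho>\<close> to \<open>d \<times> d\<close> matrices; it is a
  weight module if \<open>k\<^sup>d\<close> has a basis (the columns of \<open>P\<close>) of weight vectors.\<close>

definition weight_module ::
  "('i, 'x::ab_group_add, 'y::ab_group_add) satake_datum \<Rightarrow> nat \<Rightarrow>
   (('i, 'y) free set \<Rightarrow> kk mat) \<Rightarrow> bool" where
  "weight_module D d \<rho> \<longleftrightarrow>
     \<rho> \<in> Ring.ring_hom (UU D) (ring_mat TYPE(kk) d ()) \<and>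
     (\<forall>a. \<rho> (cls D (scal a)) = a \<cdot>\<^sub>m 1\<^sub>m d) \<and>
     (\<exists>P (wt :: nat \<Rightarrow> 'x). P \<in> carrier_mat d d \<and> invertible_mat P \<and>
        (\<forall>j < d. \<forall>h. \<rho> (cls D (KK h)) *\<^sub>v col P j = qq powi pairing D h (wt j) \<cdot>\<^sub>v col P j))"

text \<open>Functions on \<open>U\<close> are total functions on cosets that vanish outside the carrier.\<close>

definition matrix_coeffs ::
  "('i, 'x::ab_group_add, 'y::ab_group_add) satake_datum \<Rightarrow> (('i, 'y) free set \<Rightarrow> kk) set" where
  "matrix_coeffs D =
     {f. \<exists>d \<rho> v w. weight_module D d \<rho> \<and> v \<in> carrier_vec d \<and> w \<in> carrier_vec d \<and>
        f = (\<lambda>x. if x \<in> carrier (UU D) then w \<bullet> (\<rho> x *\<^sub>v v) else 0)}"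

definition characters ::
  "('i, 'x::ab_group_add, 'y::ab_group_add) satake_datum \<Rightarrow> ('i, 'y) free set set \<Rightarrow>
   (('i, 'y) free set \<Rightarrow> kk) set" where
  "characters D A =
     {\<chi>. \<chi> \<in> Ring.ring_hom (UU D \<lparr>carrier := A\<rparr>) ring_of_type_algebra \<and> (\<forall>a. \<chi> (cls D (scal a)) = a)}"

text \<open>The functions \<open>f \<in> \<A>\<close> with \<open>f(b'xb) = \<chi>'(b') f(x) \<chi>(b)\<close>.\<close>

definition spherical ::
  "('i, 'x::ab_group_add, 'y::ab_group_add) satake_datum \<Rightarrow>
   ('i, 'y) free set set \<Rightarrow> ('i, 'y) free set set \<Rightarrow>
   (('i, 'y) free set \<Rightarrow> kk) \<Rightarrow> (('i, 'y) free set \<Rightarrow> kk) \<Rightarrow> (('i, 'y) free set \<Rightarrow> kk) set" where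
  "spherical D B' B \<chi>' \<chi> =
     {f \<in> matrix_coeffs D. \<forall>b'\<in>B'. \<forall>x\<in>carrier (UU D). \<forall>b\<in>B.
        f (b' \<otimes>\<^bsub>UU D\<^esub> x \<otimes>\<^bsub>UU D\<^esub> b) = \<chi>' b' * f x * \<chi> b}"

text \<open>The sum, over all pairs of characters, of the spaces of character spherical functions.\<close>

definition character_spherical_sum ::
  "('i, 'x::ab_group_add, 'y::ab_group_add) satake_datum \<Rightarrow>
   ('i, 'y) free set set \<Rightarrow> ('i, 'y) free set set \<Rightarrow> (('i, 'y) free set \<Rightarrow> kk) set" where
  "character_spherical_sum D B' B =
     {(\<lambda>x. \<Sum>p\<in>P. g p x) | P g. finite P \<and> P \<subseteq> characters D B' \<times> characters D B \<and>
        (\<forall>p\<in>P. g p \<in> spherical D B' B (fst p) (snd p))}"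


section \<open>Well-definedness\<close>

lemma alg_extend_superset:
  assumes "finite A" "Poly_Mapping.keys p \<subseteq> A" "s 0 = 0"
  shows "alg_extend s \<phi> p =
    (\<Sum>w\<in>A. s (Poly_Mapping.lookup p w) * prod_list (map \<phi> (letters w)))"
  unfolding alg_extend_def
  by (rule sum.mono_neutral_left) (use assms in \<open>auto simp: in_keys_iff\<close>)

lemma alg_extend_single:
  assumes "s 0 = 0"
  shows "alg_extend s \<phi> (Poly_Mapping.single w a) = s a * prod_list (map \<phi> (letters w))"
  using alg_extend_superset[of "{w}" "Poly_Mapping.single w a" s \<phi>] assms by simp

lemma alg_extend_add:
  assumes "s 0 = 0" "\<And>a b. s (a + b) = s a + s b"
  shows "alg_extend s \<phi> (p + q) = alg_extend s \<phi> p + alg_extend s \<phi> q"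
proof -
  let ?A = "Poly_Mapping.keys p \<union> Poly_Mapping.keys q"
  have "finite ?A" "Poly_Mapping.keys (p + q) \<subseteq> ?A"
    by (simp_all add: Poly_Mapping.keys_add)
  then show ?thesis
    using assms
    by (simp add: alg_extend_superset[of ?A] lookup_add algebra_simps sum.distrib)
qed

lemma free_alg_induct:
  fixes p :: "'g free_alg"
  assumes "P 0" "\<And>w a. P (Poly_Mapping.single w a)" "\<And>p q. P p \<Longrightarrow> P q \<Longrightarrow> P (p + q)"
  shows "P p"
proof (induction p rule: update_induct)
  case const then show ?case by (rule assms(1))
next
  case (update f w a)
  have "Poly_Mapping.update w a f = Poly_Mapping.single w a + f"
    using update(1) by (intro poly_mapping_eqI)
      (auto simp: lookup_update lookup_add lookup_single in_keys_iff)
  then show ?case using assms(2,3) update by metis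
qed

lemma alg_extend_mult:
  assumes s: "s 0 = 0" "\<And>a b. s (a + b) = s a + s b" "\<And>a b. s (a * b) = s a * s b"
    and central: "\<And>a x. s a * x = x * s a"
  shows "alg_extend s \<phi> (p * q) = alg_extend s \<phi> p * alg_extend s \<phi> q"
proof -
  note add = alg_extend_add[of s, OF s(1,2)]
  have zero: "alg_extend s \<phi> 0 = 0" by (simp add: alg_extend_def)
  have single: "alg_extend s \<phi> (Poly_Mapping.single v a * Poly_Mapping.single w b)
     = alg_extend s \<phi> (Poly_Mapping.single v a) * alg_extend s \<phi> (Poly_Mapping.single w b)"
    for v w a b
    by (simp add: mult_single alg_extend_single s plus_word_def)
       (metis central mult.assoc)
  have "alg_extend s \<phi> (Poly_Mapping.single v a * q)
     = alg_extend s \<phi> (Poly_Mapping.single v a) * alg_extend s \<phi> q" for v a q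
    by (induction q rule: free_alg_induct) (simp_all add: zero single add distrib_left)
  then show ?thesis
    by (induction p rule: free_alg_induct) (simp_all add: zero add distrib_right)
qed

lemma ring_free_ring: "ring (free_ring :: ('i, 'y) free ring)"
  by (standard; auto simp: ring_of_type_algebra_def Units_def algebra_simps intro: exI[of _ "- _"])

lemma ideal_rel_ideal: "ideal (rel_ideal D) free_ring"
  unfolding rel_ideal_def
  by (rule ring.genideal_ideal[OF ring_free_ring]) (simp add: ring_of_type_algebra_def)

lemma ring_UU: "ring (UU D)"
  unfolding UU_def by (rule ideal.quotient_is_ring[OF ideal_rel_ideal])

lemma cls_hom: "cls D \<in> Ring.ring_hom free_ring (UU D)"
  unfolding UU_def cls_def[abs_def] by (rule ideal.rcos_ring_hom[OF ideal_rel_ideal])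

lemma counit_free_simps [simp]:
  "counit_free (p + q) = counit_free p + counit_free q"
  "counit_free (p * q) = counit_free p * counit_free q"
  "counit_free (scal a) = a"
  "counit_free (EE i) = 0" "counit_free (FF i) = 0" "counit_free (KK h) = 1" "counit_free (Kw D l) = 1"
  "counit_free 0 = 0" "counit_free 1 = 1"
  unfolding counit_free_def EE_def FF_def KK_def Kw_def scal_def gen_elem_def
  by (simp_all add: alg_extend_add alg_extend_mult alg_extend_single zero_word_def mult.commute
      flip: single_one)
    (simp add: alg_extend_def)

lemma counit_free_uminus [simp]: "counit_free (- p) = - counit_free p"
  by (metis add.right_inverse add_eq_0_iff counit_free_simps(1,8))

lemma counit_free_diff [simp]: "counit_free (p - q) = counit_free p - counit_free q"
  by (metis counit_free_simps(1) counit_free_uminus diff_conv_add_uminus)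

lemma counit_free_sum: "counit_free (sum f A) = (\<Sum>x\<in>A. counit_free (f x))"
  by (induction A rule: infinite_finite_induct) auto

lemma counit_free_relators: "r \<in> relators D \<Longrightarrow> counit_free r = 0"
  by (auto simp: relators_def serre_def Let_def counit_free_sum)

lemma counit_free_rel_ideal:
  fixes r :: "('i, 'y::ab_group_add) free"
  assumes "r \<in> rel_ideal D"
  shows "counit_free r = 0"
proof -
  let ?F = "free_ring :: ('i, 'y) free ring" and ?k = "ring_of_type_algebra :: kk ring"
  have "ring_hom_ring ?F ?k counit_free"
    by (rule ring_hom_ringI2[OF ring_free_ring ring_from_type_algebra], rule ring_hom_memI)
       (simp_all add: ring_of_type_algebra_def)
  then have "ideal (a_kernel ?F ?k counit_free) ?F"
    by (rule ring_hom_ring.kernel_is_ideal)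
  moreover have "a_kernel ?F ?k counit_free = {p. counit_free p = 0}"
    by (simp add: a_kernel_def' ring_of_type_algebra_def)
  ultimately have "ideal {p. counit_free p = 0} ?F" by simp
  then have "rel_ideal D \<subseteq> {p. counit_free p = 0}"
    using counit_free_relators[of _ D] unfolding rel_ideal_def genideal_def by blast
  then show ?thesis using assms by blast
qed

lemma counit_cls: "counit (cls D a) = counit_free a"
proof -
  have "0 \<in> rel_ideal D"
    using additive_subgroup.zero_closed[OF ideal.axioms(1)[OF ideal_rel_ideal]]
    by (auto simp: ring_of_type_algebra_def)
  moreover have "cls D a = (\<lambda>r. r + a) ` rel_ideal D"
    by (auto simp: cls_def a_r_coset_def' ring_of_type_algebra_def)
  ultimately have "counit_free ` cls D a = {counit_free a}"
    using counit_free_rel_ideal[of _ D] by (simp add: image_image) blast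
  then show ?thesis by (simp add: counit_def)
qed

end

theory Submission
  imports Defs
begin

text \<open>
  For \<open>h \<in> Y\<^sup>\<Theta>\<close> the element \<open>K\<^sub>h\<close> commutes up to powers of \<open>q\<close> with the generators of \<open>C\<close>, nontrivially
  only with those killed by \<open>\<epsilon>\<close>, and \<open>B\<close> is generated by \<open>C\<close> and these \<open>K\<^sub>h\<close>. So the weight
  components, for \<open>Y\<^sup>\<Theta>\<close> acting on both sides, of a zonal function of \<open>(C', C)\<close> are zonal again, and
  each nonzero one is an eigenfunction of \<open>B'\<close> and \<open>B\<close>; the eigenvalues form a pair of characters.

  Conversely, let \<open>\<chi>\<close> be a character of \<open>B\<close> occurring in a matrix coefficient, so that \<open>\<chi>(K\<^sub>h)\<close> is
  a power of \<open>q\<close>. Then \<open>\<chi>\<close> is trivial on \<open>U\<^sub>\<bullet>\<close>, since \<open>\<chi>(K\<^sub>\<alpha>)\<^sup>2 = 1\<close> for black roots. The test vectors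
  for affine diagrams and the conditions on \<open>w\<^sub>\<bullet>\<close> and \<open>\<rho>\<^sub>\<bullet>\<close> show that every white \<open>j \<noteq> i, \<tau>(i)\<close> either is
  fixed by \<open>\<tau>\<close> and has a black neighbour, or forms with \<open>\<tau>(j) \<noteq> j\<close> a diagram \<open>A\<^sub>1 \<times> A\<^sub>1\<close> away from the
  black nodes. Hence some \<open>K\<^sub>h\<close> does not commute with \<open>B\<^sub>j\<close>, which gives \<open>\<chi>(B\<^sub>j) = 0\<close> for all white \<open>j\<close>, and
  \<open>[B\<^sub>j, B\<^bsub>\<tau>(j)\<^esub>]\<close> gives \<open>\<chi>(K\<^sub>h) = 1\<close> for the multiples \<open>h\<close> of \<open>h\<^sub>j - h\<^bsub>\<tau>(j)\<^esub>\<close>. Together with the black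
  coroots these span \<open>Y' \<otimes> \<rat>\<close>, so \<open>\<chi> = \<epsilon>\<close> on \<open>C\<close>.
\<close>

section \<open>Root data\<close>

text \<open>Y may be larger than the coroot lattice, so relations are first obtained for a multiple
  of h. Since \<open>\<chi>(K_h)\<close> is a power of q, its exponent is additive with integer
  values and multiples can be divided out. The same fact excludes values such as -1, which a square
  equal to 1 would allow. The nodes i and \<tau>(i) lie outside the A_1 x A_1 argument; there the
  condition <h, \<omega>_i> = 0 removes the coordinate.

  The list of Satake diagrams is never consulted. Positivity of the Cartan form bounds the number of
  edges, so the diagram grows out of I[i] like a forest, and the marks of affine diagrams are
  vectors on which the form would not be positive.

  Braid operators enter only through weight and counit, read off from their formulas on the free
  algebra, and through nodes orthogonal to the black ones, where they fix E_j literally. Components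
  of a zonal function are separated by linear independence of characters of Y^Theta; the restricted
  weights can be recovered from the resulting characters, so different components give different
  pairs.\<close>

lemma zscale_zero [simp]: "0 *\<^sub>Z x = 0"
  by (simp add: zscale_def)

lemma zscale_succ: "(n + 1) *\<^sub>Z x = x + n *\<^sub>Z x"
proof (cases "0 \<le> n")
  case True
  then show ?thesis by (simp add: zscale_def nat_add_distrib)
next
  case False
  then have "nat (- n) = Suc (nat (- (n + 1)))" by simp
  with False show ?thesis by (cases "n = -1") (auto simp: zscale_def)
qed

lemma zscale_one [simp]: "1 *\<^sub>Z x = x"
  using zscale_succ[of 0 x] by simp

lemma zscale_add_left: "(m + n) *\<^sub>Z x = m *\<^sub>Z x + n *\<^sub>Z x"
proof (induction m rule: int_induct[where k = 0])
  case (step1 i)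
  then show ?case using zscale_succ[of "i + n" x] zscale_succ[of i x] by (simp add: algebra_simps)
next
  case (step2 i)
  then show ?case using zscale_succ[of "i - 1 + n" x] zscale_succ[of "i - 1" x] by (simp add: algebra_simps)
qed simp

lemma zscale_minus_left [simp]: "(- n) *\<^sub>Z x = - (n *\<^sub>Z x)"
  using zscale_add_left[of n "- n" x] by (simp add: eq_neg_iff_add_eq_0 add.commute)

lemma zscale_diff_left: "(m - n) *\<^sub>Z x = m *\<^sub>Z x - n *\<^sub>Z x"
  using zscale_add_left[of m "- n" x] by simp

lemma additive_zscale:
  assumes "additive f"
  shows "f (n *\<^sub>Z x) = n *\<^sub>Z f x"
proof (induction n rule: int_induct[where k = 0])
  case base
  then show ?case by (simp add: additive.zero[OF assms])
next
  case (step1 i)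
  then show ?case by (simp add: zscale_add_left additive.add[OF assms])
next
  case (step2 i)
  then show ?case by (simp add: zscale_diff_left additive.diff[OF assms])
qed

lemma additive_zscale_right: "additive ((*\<^sub>Z) n)"
proof
  show "n *\<^sub>Z (x + y) = n *\<^sub>Z x + n *\<^sub>Z y" for x y :: 'a
    by (induction n rule: int_induct[where k = 0]) (simp_all add: zscale_add_left zscale_diff_left)
qed

lemmas zscale_add_right = additive.add[OF additive_zscale_right]
  and zscale_diff_right = additive.diff[OF additive_zscale_right]
  and zscale_minus_right [simp] = additive.minus[OF additive_zscale_right]
  and zscale_zero_right [simp] = additive.zero[OF additive_zscale_right]
  and zscale_sum_right = additive.sum[OF additive_zscale_right]

lemma zscale_eq_of_int_mult: "n *\<^sub>Z (x :: 'a::ring_1) = of_int n * x"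
  by (induction n rule: int_induct[where k = 0])
     (simp_all add: zscale_add_left zscale_diff_left algebra_simps)

lemma zscale_zscale: "m *\<^sub>Z n *\<^sub>Z x = (m * n) *\<^sub>Z x"
  by (induction m rule: int_induct[where k = 0])
     (simp_all add: zscale_add_left zscale_diff_left distrib_right left_diff_distrib)

lemma zscale_sum_left: "sum f A *\<^sub>Z x = (\<Sum>a\<in>A. f a *\<^sub>Z x)"
  by (induction A rule: infinite_finite_induct) (simp_all add: zscale_add_left)

lemma additive_eq_on_span:
  assumes "additive f" "additive g" "\<And>j. j \<in> J \<Longrightarrow> f (v j) = g (v j)"
  shows "f (\<Sum>j\<in>J. c j *\<^sub>Z v j) = g (\<Sum>j\<in>J. c j *\<^sub>Z v j)"
  using assms by (simp add: additive.sum additive_zscale)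

locale semisimple_datum =
  fixes D :: "('i::finite, 'x::ab_group_add, 'y::ab_group_add) satake_datum"
  assumes root_datum: "root_datum D"
begin

abbreviation pair where "pair \<equiv> pairing D"
abbreviation \<alpha> where "\<alpha> \<equiv> alpha D"
abbreviation \<eta> where "\<eta> \<equiv> coroot D"
abbreviation a where "a \<equiv> cartan D"

lemma additive_pair_right: "additive (pair y)"
  and additive_pair_left: "additive (\<lambda>y. pair y x)"
  using root_datum unfolding root_datum_def perfect_pairing_def by blast+

lemmas pair_add_right = additive.add[OF additive_pair_right]
  and pair_diff_right = additive.diff[OF additive_pair_right]
  and pair_minus_right [simp] = additive.minus[OF additive_pair_right]
  and pair_zero_right [simp] = additive.zero[OF additive_pair_right]
  and pair_sum_right = additive.sum[OF additive_pair_right]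
  and pair_add_left = additive.add[OF additive_pair_left]
  and pair_diff_left = additive.diff[OF additive_pair_left]
  and pair_minus_left [simp] = additive.minus[OF additive_pair_left]
  and pair_zero_left [simp] = additive.zero[OF additive_pair_left]
  and pair_sum_left = additive.sum[OF additive_pair_left]

lemma pair_zscale_right [simp]: "pair y (n *\<^sub>Z x) = n * pair y x"
  using additive_zscale[OF additive_pair_right] by (simp add: zscale_eq_of_int_mult)

lemma pair_zscale_left [simp]: "pair (n *\<^sub>Z y) x = n * pair y x"
  using additive_zscale[OF additive_pair_left] by (simp add: zscale_eq_of_int_mult)

lemma pair_eqI_left: "(\<And>x. pair y x = pair z x) \<Longrightarrow> y = z"
  using root_datum additive_pair_right unfolding root_datum_def perfect_pairing_def
  by (metis ext)

lemma pair_eqI_right: "(\<And>y. pair y x = pair y z) \<Longrightarrow> x = z"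
  using root_datum additive_pair_left unfolding root_datum_def perfect_pairing_def
  by (metis (no_types, lifting) ext)

lemma Y_torsion_free: "n \<noteq> 0 \<Longrightarrow> n *\<^sub>Z (y::'y) = n *\<^sub>Z z \<longleftrightarrow> y = z"
  by (metis mult_cancel_left pair_eqI_left pair_zscale_left)

lemma X_torsion_free: "n \<noteq> 0 \<Longrightarrow> n *\<^sub>Z (x::'x) = n *\<^sub>Z z \<longleftrightarrow> x = z"
  by (metis mult_cancel_left pair_eqI_right pair_zscale_right)

lemma pair_coroot_alpha: "pair (\<eta> i) (\<alpha> j) = a i j"
  by (simp add: cartan_def)

lemma alpha_independent: "(\<Sum>i\<in>UNIV. c i *\<^sub>Z \<alpha> i) = 0 \<Longrightarrow> c i = 0"
  and coroot_independent: "(\<Sum>i\<in>UNIV. c i *\<^sub>Z \<eta> i) = 0 \<Longrightarrow> c i = 0"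
  using root_datum unfolding root_datum_def Z_independent_def by blast+

lemma coroot_span_eq_iff: "(\<Sum>i\<in>UNIV. c i *\<^sub>Z \<eta> i) = (\<Sum>i\<in>UNIV. d i *\<^sub>Z \<eta> i) \<longleftrightarrow> c = d"
  using coroot_independent[of "\<lambda>i. c i - d i"]
  by (auto simp: zscale_diff_left sum_subtractf)

lemma coroot_as_span: "\<eta> j = (\<Sum>k\<in>UNIV. (if k = j then 1 else 0) *\<^sub>Z \<eta> k)"
proof -
  have "\<eta> j = (\<Sum>k\<in>UNIV. if k = j then \<eta> k else 0)" by simp
  also have "\<dots> = (\<Sum>k\<in>UNIV. (if k = j then 1 else 0) *\<^sub>Z \<eta> k)" by (rule sum.cong) auto
  finally show ?thesis .
qed

lemma coroots_span: obtains m c where "m \<noteq> 0" "m *\<^sub>Z y = (\<Sum>i\<in>UNIV. c i *\<^sub>Z \<eta> i)"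
  using root_datum unfolding root_datum_def by blast

lemma finite_type: "finite_type_cartan a"
  using root_datum unfolding root_datum_def by blast

lemma cartan_diag [simp]: "a i i = 2"
  and cartan_nonpos: "i \<noteq> j \<Longrightarrow> a i j \<le> 0"
  and cartan_zero_sym: "a i j = 0 \<longleftrightarrow> a j i = 0"
  using finite_type unfolding finite_type_cartan_def by blast+

definition symm :: "'i \<Rightarrow> real" where
  "symm = (SOME d. (\<forall>i. d i > 0) \<and> (\<forall>i j. d i * of_int (a i j) = d j * of_int (a j i)) \<and>
        (\<forall>x :: 'i \<Rightarrow> real. (\<exists>i. x i \<noteq> 0) \<longrightarrow>
           (\<Sum>i\<in>UNIV. \<Sum>j\<in>UNIV. x i * (d i * of_int (a i j)) * x j) > 0))"

definition cartan_map :: "('i \<Rightarrow> real) \<Rightarrow> 'i \<Rightarrow> real" where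
  "cartan_map x i = (\<Sum>j\<in>UNIV. of_int (a i j) * x j)"

text \<open>The quadratic form of the symmetrized Cartan matrix. \<open>symm\<close> is the
  symmetrizer whose positive definiteness is assumed; \<open>half_norm\<close> below comes from the
  form on X and supplies the exponents of q.\<close>

definition cartan_form :: "('i \<Rightarrow> real) \<Rightarrow> real" where
  "cartan_form x = (\<Sum>i\<in>UNIV. symm i * x i * cartan_map x i)"

lemma symm_pos: "symm i > 0"
  and symm_sym: "symm i * of_int (a i j) = symm j * of_int (a j i)"
  and cartan_pos_def: "x i \<noteq> 0 \<Longrightarrow> cartan_form x > 0"
proof -
  have "\<exists>d :: 'i \<Rightarrow> real. (\<forall>i. d i > 0) \<and> (\<forall>i j. d i * of_int (a i j) = d j * of_int (a j i)) \<and>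
        (\<forall>x :: 'i \<Rightarrow> real. (\<exists>i. x i \<noteq> 0) \<longrightarrow>
           (\<Sum>i\<in>UNIV. \<Sum>j\<in>UNIV. x i * (d i * of_int (a i j)) * x j) > 0)"
    using finite_type unfolding finite_type_cartan_def by (elim conjE)
  note symm = someI_ex[OF this, folded symm_def]
  note pd = symm[THEN conjunct2, THEN conjunct2]
  show "symm i > 0" by (rule symm[THEN conjunct1, rule_format])
  show "symm i * of_int (a i j) = symm j * of_int (a j i)"
    by (rule symm[THEN conjunct2, THEN conjunct1, rule_format])
  assume "x i \<noteq> 0"
  then have "\<exists>i. x i \<noteq> 0" ..
  note pd[rule_format, OF this]
  also have "(\<Sum>i\<in>UNIV. \<Sum>j\<in>UNIV. x i * (symm i * of_int (a i j)) * x j) = cartan_form x"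
    by (simp add: cartan_form_def cartan_map_def sum_distrib_left ac_simps)
  finally show "cartan_form x > 0" .
qed

lemma form_sym: "form D l m = form D m l"
  and additive_form: "additive (form D l)"
  and form_alpha_alpha: "of_int (a i j) = 2 * form D (\<alpha> i) (\<alpha> j) / form D (\<alpha> i) (\<alpha> i)"
  using root_datum unfolding root_datum_def cartan_def by blast+

definition half_norm :: "'i \<Rightarrow> int" where "half_norm i = \<lfloor>form D (\<alpha> i) (\<alpha> i) / 2\<rfloor>"

lemma form_norm: "form D (\<alpha> i) (\<alpha> i) = of_int (2 * half_norm i)" and half_norm_pos: "half_norm i > 0"
proof -
  obtain m :: int where "m > 0" "form D (\<alpha> i) (\<alpha> i) = of_int (2 * m)"
    using root_datum unfolding root_datum_def by blast
  then show "form D (\<alpha> i) (\<alpha> i) = of_int (2 * half_norm i)" "half_norm i > 0" by (simp_all add: half_norm_def)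
qed

lemma form_alpha: "form D (\<alpha> i) (\<alpha> j) = of_int (half_norm i * a i j)"
proof -
  have "of_int (a i j) * form D (\<alpha> i) (\<alpha> i) = 2 * form D (\<alpha> i) (\<alpha> j)"
    using form_alpha_alpha[of i j] form_norm[of i] half_norm_pos[of i] by simp
  then show ?thesis by (simp add: form_norm mult.commute)
qed

lemma half_norm_sym: "half_norm i * a i j = half_norm j * a j i"
  using form_alpha[of i j] form_alpha[of j i] form_sym[of "\<alpha> i" "\<alpha> j"]
  by (metis of_int_eq_iff)

lemma cartan_map_eq_0D: "(\<And>i. cartan_map x i = 0) \<Longrightarrow> x j = 0"
proof (rule ccontr)
  assume cartan_map: "\<And>i. cartan_map x i = 0" and "x j \<noteq> 0"
  from cartan_pos_def[of x j, OF this(2)] show False by (simp add: cartan_form_def cartan_map)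
qed

lemma cartan_form_nonneg: "cartan_form x \<ge> 0"
proof (cases "\<exists>i. x i \<noteq> 0")
  case True
  then obtain i where "x i \<noteq> 0" ..
  then show ?thesis by (rule less_imp_le[OF cartan_pos_def[of x]])
next
  case False
  then show ?thesis by (simp add: cartan_form_def)
qed

text \<open>The value is quadratic in t: t = \<open>cartan_map x i\<close> is the simple reflection
  and leaves the form unchanged, t = \<open>cartan_map x i / 2\<close> minimizes it. Both values are
  used below.\<close>

lemma cartan_form_update: "cartan_form (x(i := x i - t)) = cartan_form x - 2 * t * symm i * cartan_map x i + 2 * t\<^sup>2 * symm i"
proof -
  let ?e = "\<lambda>j. if j = i then 1 else 0 :: real"
  have upd: "x(i := x i - t) = (\<lambda>j. x j - t * ?e j)" by auto
  have cartan_map: "cartan_map (\<lambda>j. x j - t * ?e j) k = cartan_map x k - t * of_int (a k i)" for k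
  proof -
    have "(\<Sum>j\<in>UNIV. of_int (a k j) * (x j - t * ?e j))
        = (\<Sum>j\<in>UNIV. of_int (a k j) * x j - (if j = i then t * of_int (a k i) else 0))"
      by (rule sum.cong) (auto simp: algebra_simps)
    then show ?thesis by (simp add: cartan_map_def sum_subtractf)
  qed
  have 1: "(\<Sum>k\<in>UNIV. symm k * x k * of_int (a k i)) = symm i * cartan_map x i"
  proof -
    have "symm k * x k * of_int (a k i) = symm i * (of_int (a i k) * x k)" for k
      using arg_cong[OF symm_sym[of k i], of "\<lambda>z. z * x k"] by (simp only: ac_simps)
    then show ?thesis unfolding cartan_map_def sum_distrib_left by (rule sum.cong[OF refl])
  qed
  have "cartan_form (\<lambda>j. x j - t * ?e j) = (\<Sum>k\<in>UNIV. symm k * (x k - t * ?e k) * (cartan_map x k - t * of_int (a k i)))"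
    by (simp add: cartan_form_def cartan_map)
  also have "\<dots> = (\<Sum>k\<in>UNIV. symm k * x k * cartan_map x k - t * (symm k * x k * of_int (a k i))
      - (if k = i then t * symm i * cartan_map x i else 0) + (if k = i then 2 * t\<^sup>2 * symm i else 0))"
  proof (rule sum.cong)
    fix k
    have e: "d * (z - t) * (A - t * 2) = d * z * A - t * (d * z * 2) - t * d * A + 2 * t\<^sup>2 * d"
      for d z A :: real
      by (simp add: algebra_simps power2_eq_square)
    show "symm k * (x k - t * ?e k) * (cartan_map x k - t * of_int (a k i)) = symm k * x k * cartan_map x k
        - t * (symm k * x k * of_int (a k i)) - (if k = i then t * symm i * cartan_map x i else 0)
        + (if k = i then 2 * t\<^sup>2 * symm i else 0)"
      using e[of "symm i" "x i" "cartan_map x i"] by (cases "k = i") (simp_all add: right_diff_distrib)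
  qed simp
  also have "\<dots> = cartan_form x - t * (symm i * cartan_map x i) - t * symm i * cartan_map x i + 2 * t\<^sup>2 * symm i"
    unfolding sum.distrib sum_subtractf sum_distrib_left[symmetric] 1 cartan_form_def by simp
  finally show ?thesis by (simp add: upd)
qed

text \<open>The minimum along the i-th coordinate is
  \<open>cartan_form x - symm i * (cartan_map x i)^2 / 2\<close>, and it is still
  nonnegative.\<close>

lemma cartan_map_bounded: "(cartan_map x i)\<^sup>2 \<le> 2 * cartan_form x / symm i"
proof -
  have e: "q - 2 * (A / 2) * d * A + 2 * (A / 2)\<^sup>2 * d = q - d * A\<^sup>2 / 2" for q A d :: real
    by (simp add: power2_eq_square)
  have "0 \<le> cartan_form x - symm i * (cartan_map x i)\<^sup>2 / 2"
    using cartan_form_nonneg[of "x(i := x i - cartan_map x i / 2)"] unfolding cartan_form_update e .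
  then show ?thesis using symm_pos[of i] by (simp add: pos_le_divide_eq mult.commute)
qed


subsection \<open>Reflections\<close>

lemma pair_reflY: "pair (reflY D i y) x = pair y (reflX D i x)"
  by (simp add: reflX_def reflY_def pair_diff_left pair_diff_right)

lemma additive_reflX: "additive (reflX D i)"
  by standard (simp add: reflX_def pair_add_right zscale_add_left)

lemma additive_reflY: "additive (reflY D i)"
  by standard (simp add: reflY_def pair_add_left zscale_add_left)

lemma reflX_reflX [simp]: "reflX D i (reflX D i x) = x"
  by (rule pair_eqI_right) (simp add: reflX_def pair_diff_right pair_coroot_alpha algebra_simps)

lemma reflY_reflY [simp]: "reflY D i (reflY D i x) = x"
  by (rule pair_eqI_left) (simp add: pair_reflY)

lemma actX_simps [simp]: "actX D [] x = x" "actX D (i # ws) x = reflX D i (actX D ws x)"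
  "actX D (vs @ ws) x = actX D vs (actX D ws x)"
  by (simp_all add: actX_def)

lemma actY_simps [simp]: "actY D [] y = y" "actY D (i # ws) y = reflY D i (actY D ws y)"
  "actY D (vs @ ws) y = actY D vs (actY D ws y)"
  by (simp_all add: actY_def)

lemma additive_actX: "additive (actX D ws)"
  by (induction ws) (simp_all add: additive_def additive.add[OF additive_reflX])

lemma additive_actY: "additive (actY D ws)"
  by (induction ws) (simp_all add: additive_def additive.add[OF additive_reflY])

lemma actX_rev [simp]: "actX D ws (actX D (rev ws) x) = x"
  by (induction ws arbitrary: x) simp_all

lemma pair_actY: "pair (actY D ws y) x = pair y (actX D (rev ws) x)"
  by (induction ws arbitrary: x) (simp_all add: pair_reflY)

lemma actY_coset:
  assumes "ws \<in> lists J"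
  obtains c where "\<And>j. j \<notin> J \<Longrightarrow> c j = 0" "actY D ws y = y + (\<Sum>j\<in>UNIV. c j *\<^sub>Z \<eta> j)"
proof -
  have "\<exists>c. (\<forall>j. j \<notin> J \<longrightarrow> c j = 0) \<and> actY D ws y = y + (\<Sum>j\<in>UNIV. c j *\<^sub>Z \<eta> j)"
    using assms
  proof (induction ws)
    case Nil
    show ?case by (intro exI[of _ "\<lambda>_. 0"]) simp
  next
    case (Cons i ws)
    then have i: "i \<in> J" by auto
    from Cons obtain c where c: "\<forall>j. j \<notin> J \<longrightarrow> c j = 0" "actY D ws y = y + (\<Sum>j\<in>UNIV. c j *\<^sub>Z \<eta> j)"
      by auto
    let ?p = "pair (actY D ws y) (\<alpha> i)"
    have "(\<Sum>j\<in>UNIV. (c j - (if j = i then ?p else 0)) *\<^sub>Z \<eta> j)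
        = (\<Sum>j\<in>UNIV. c j *\<^sub>Z \<eta> j) - (\<Sum>j\<in>UNIV. if j = i then ?p *\<^sub>Z \<eta> j else 0)"
      unfolding sum_subtractf[symmetric] by (rule sum.cong) (auto simp: zscale_diff_left)
    then show ?case using i c
      by (intro exI[of _ "\<lambda>j. c j - (if j = i then ?p else 0)"]) (auto simp: reflY_def)
  qed
  then show thesis using that by blast
qed

lemma actX_coset:
  assumes "ws \<in> lists J"
  obtains c where "\<And>j. j \<notin> J \<Longrightarrow> c j = 0" "actX D ws y = y + (\<Sum>j\<in>UNIV. c j *\<^sub>Z \<alpha> j)"
proof -
  have "\<exists>c. (\<forall>j. j \<notin> J \<longrightarrow> c j = 0) \<and> actX D ws y = y + (\<Sum>j\<in>UNIV. c j *\<^sub>Z \<alpha> j)"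
    using assms
  proof (induction ws)
    case Nil
    show ?case by (intro exI[of _ "\<lambda>_. 0"]) simp
  next
    case (Cons i ws)
    then have i: "i \<in> J" by auto
    from Cons obtain c where c: "\<forall>j. j \<notin> J \<longrightarrow> c j = 0" "actX D ws y = y + (\<Sum>j\<in>UNIV. c j *\<^sub>Z \<alpha> j)"
      by auto
    let ?p = "pair (\<eta> i) (actX D ws y)"
    have "(\<Sum>j\<in>UNIV. (c j - (if j = i then ?p else 0)) *\<^sub>Z \<alpha> j)
        = (\<Sum>j\<in>UNIV. c j *\<^sub>Z \<alpha> j) - (\<Sum>j\<in>UNIV. if j = i then ?p *\<^sub>Z \<alpha> j else 0)"
      unfolding sum_subtractf[symmetric] by (rule sum.cong) (auto simp: zscale_diff_left)
    then show ?case using i c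
      by (intro exI[of _ "\<lambda>j. c j - (if j = i then ?p else 0)"]) (auto simp: reflX_def)
  qed
  then show thesis using that by blast
qed


subsection \<open>Finiteness of the Weyl group\<close>

lemma pair_coroot_span:
  "of_int (pair (\<Sum>j\<in>UNIV. c j *\<^sub>Z \<eta> j) (\<alpha> k)) = symm k * cartan_map (\<lambda>j. of_int (c j) / symm j) k"
proof -
  have "of_int (c j) * of_int (a j k) = symm k * (of_int (a k j) * (of_int (c j) / symm j))" for j
    using symm_sym[of j k] symm_pos[of j] by (simp add: field_simps)
  then show ?thesis by (simp add: pair_sum_left pair_coroot_alpha cartan_map_def sum_distrib_left)
qed

text \<open>A nonzero multiple of the difference lies in the coroot lattice, where the nonsingular
  Cartan matrix leaves only 0 orthogonal to all roots; and Y is torsion-free.\<close>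

lemma pair_alpha_eqI:
  assumes "\<And>k. pair y (\<alpha> k) = pair z (\<alpha> k)"
  shows "y = z"
proof -
  obtain m c where mc: "m \<noteq> 0" "m *\<^sub>Z (y - z) = (\<Sum>j\<in>UNIV. c j *\<^sub>Z \<eta> j)" by (rule coroots_span)
  have "symm k * cartan_map (\<lambda>j. of_int (c j) / symm j) k = 0" for k
    using assms[of k] by (simp add: pair_diff_left flip: pair_coroot_span mc(2))
  then have "cartan_map (\<lambda>j. of_int (c j) / symm j) k = 0" for k
    using symm_pos[of k] by (metis less_irrefl mult_eq_0_iff)
  then have "of_int (c j) / symm j = 0" for j by (rule cartan_map_eq_0D)
  then have "c j = 0" for j using symm_pos[of j] by (metis divide_eq_0_iff less_irrefl of_int_eq_0_iff)
  then have "m *\<^sub>Z (y - z) = m *\<^sub>Z 0" using mc(2) by simp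
  then show ?thesis using Y_torsion_free[OF mc(1)] by (metis eq_iff_diff_eq_0)
qed

lemma pair_coroot_eqI:
  assumes "\<And>k. pair (\<eta> k) x = pair (\<eta> k) z"
  shows "x = z"
proof (rule pair_eqI_right)
  fix y
  obtain m c where mc: "m \<noteq> 0" "m *\<^sub>Z y = (\<Sum>j\<in>UNIV. c j *\<^sub>Z \<eta> j)" by (rule coroots_span)
  have "m * pair y x = m * pair y z"
    unfolding pair_zscale_left[symmetric] mc(2) by (simp add: pair_sum_left assms)
  then show "pair y x = pair y z" using mc(1) by simp
qed

text \<open>On coordinates divided by the symmetrizer, the action on the coroot lattice becomes the one
  on the root lattice, so the same form \<^term>\<open>cartan_form\<close> is invariant.\<close>

lemma finite_coroot_orbit: "finite {actY D ws (\<eta> j) | ws. True}"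
proof -
  define C where "C = {y. \<exists>c. y = (\<Sum>j\<in>UNIV. c j *\<^sub>Z \<eta> j) \<and>
      cartan_form (\<lambda>k. of_int (c k) / symm k) = cartan_form (\<lambda>k. of_int (if k = j then 1 else 0) / symm k)}"
  define q where "q = cartan_form (\<lambda>k. of_int (if k = j then 1 else 0) / symm k)"
  have "actY D ws (\<eta> j) \<in> C" for ws
  proof (induction ws)
    case Nil
    have "\<eta> j = (\<Sum>k\<in>UNIV. if k = j then \<eta> k else 0)" by simp
    also have "\<dots> = (\<Sum>k\<in>UNIV. (if k = j then 1 else 0) *\<^sub>Z \<eta> k)" by (rule sum.cong) auto
    finally show ?case unfolding C_def by auto
  next
    case (Cons i ws)
    then obtain c where c: "actY D ws (\<eta> j) = (\<Sum>j\<in>UNIV. c j *\<^sub>Z \<eta> j)" "cartan_form (\<lambda>k. of_int (c k) / symm k) = q"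
      unfolding C_def q_def by auto
    define t where "t = cartan_map (\<lambda>k. of_int (c k) / symm k) i"
    define p where "p = pair (actY D ws (\<eta> j)) (\<alpha> i)"
    have p: "of_int p = symm i * t" unfolding p_def t_def c(1) by (rule pair_coroot_span)
    let ?c = "c(i := c i - p)"
    have "(\<Sum>j\<in>UNIV. ?c j *\<^sub>Z \<eta> j)
        = (\<Sum>j\<in>UNIV. c j *\<^sub>Z \<eta> j) - (\<Sum>j\<in>UNIV. if j = i then p *\<^sub>Z \<eta> j else 0)"
      unfolding sum_subtractf[symmetric] by (rule sum.cong) (auto simp: zscale_diff_left)
    then have 1: "actY D (i # ws) (\<eta> j) = (\<Sum>j\<in>UNIV. ?c j *\<^sub>Z \<eta> j)"
      by (simp add: reflY_def p_def c(1))
    have "(\<lambda>k. of_int (?c k) / symm k)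
        = (\<lambda>k. of_int (c k) / symm k)(i := of_int (c i) / symm i - t)"
      using symm_pos[of i] by (auto simp: p diff_divide_distrib)
    then have "cartan_form (\<lambda>k. of_int (?c k) / symm k) = q"
      using cartan_form_update[of "\<lambda>k. of_int (c k) / symm k" i t]
      by (simp add: c(2) t_def[symmetric] power2_eq_square)
    with 1 show ?case unfolding C_def q_def by blast
  qed
  moreover have "finite C"
  proof (rule finite_imageD)
    \<comment> \<open>The invariant form bounds the square of each pairing with a root, and an
      integer is at most its square in absolute value, so the pairings lie in a finite box. By
      \<open>pair_alpha_eqI\<close> they determine y.\<close>
    define N where "N i = \<lceil>2 * symm i * q + 1\<rceil>" for i
    have "(\<lambda>y i. pair y (\<alpha> i)) ` C \<subseteq> (\<Pi>\<^sub>E i\<in>UNIV. {- N i .. N i})"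
    proof (intro image_subsetI PiE_I)
      fix y i assume "y \<in> C"
      then obtain c where c: "y = (\<Sum>j\<in>UNIV. c j *\<^sub>Z \<eta> j)" "cartan_form (\<lambda>k. of_int (c k) / symm k) = q"
        unfolding C_def q_def by auto
      have "(of_int (pair y (\<alpha> i)))\<^sup>2 = (symm i)\<^sup>2 * (cartan_map (\<lambda>k. of_int (c k) / symm k) i)\<^sup>2"
        unfolding c(1) pair_coroot_span by (simp add: power_mult_distrib)
      also have "\<dots> \<le> (symm i)\<^sup>2 * (2 * cartan_form (\<lambda>k. of_int (c k) / symm k) / symm i)"
        by (rule mult_left_mono[OF cartan_map_bounded]) simp
      also have "\<dots> = 2 * symm i * q" using symm_pos[of i] c(2) by (simp add: power2_eq_square)
      finally have "(of_int ((pair y (\<alpha> i))\<^sup>2) :: real) \<le> of_int (N i)" unfolding N_def by simp linarith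
      then have "(pair y (\<alpha> i))\<^sup>2 \<le> N i" by simp
      moreover have "\<bar>pair y (\<alpha> i)\<bar> \<le> (pair y (\<alpha> i))\<^sup>2"
        using self_le_power[of "\<bar>pair y (\<alpha> i)\<bar>" 2] by (cases "pair y (\<alpha> i) = 0") simp_all
      ultimately show "pair y (\<alpha> i) \<in> {- N i .. N i}" by auto
    qed auto
    then show "finite ((\<lambda>y i. pair y (\<alpha> i)) ` C)"
      by (rule finite_subset) (intro finite_PiE; simp)
    show "inj_on (\<lambda>y i. pair y (\<alpha> i)) C"
      by (intro inj_onI pair_alpha_eqI) metis
  qed
  ultimately show ?thesis by (auto intro: finite_subset)
qed

text \<open>The coordinates of an orbit element are pairings of x itself with members of the finite
  coroot orbits. This carries finiteness to X before it is known that the roots span.\<close>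

lemma finite_X_orbit: "finite {actX D ws x | ws. True}" (is "finite ?O")
proof (rule finite_imageD)
  define C where "C = (\<lambda>j. {actY D ws (\<eta> j) | ws. True})"
  have fin: "finite (C j)" for j unfolding C_def by (rule finite_coroot_orbit)
  have "(\<lambda>z i. pair (\<eta> i) z) ` ?O \<subseteq> (\<Pi>\<^sub>E i\<in>UNIV. (\<lambda>y. pair y x) ` C i)"
  proof (intro image_subsetI PiE_I)
    fix z i assume "z \<in> ?O"
    then obtain ws where "z = actX D (rev (rev ws)) x" by auto
    then have "pair (\<eta> i) z = pair (actY D (rev ws) (\<eta> i)) x" by (simp only: pair_actY)
    then show "pair (\<eta> i) z \<in> (\<lambda>y. pair y x) ` C i" unfolding C_def by blast
  qed auto
  then show "finite ((\<lambda>z i. pair (\<eta> i) z) ` ?O)"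
    by (rule finite_subset) (intro finite_PiE; simp add: fin)
  show "inj_on (\<lambda>z i. pair (\<eta> i) z) ?O"
    by (intro inj_onI pair_coroot_eqI) metis
qed

text \<open>The sum over a Weyl group orbit is invariant, hence zero.\<close>

lemma alphas_span: obtains m c where "m \<noteq> 0" "m *\<^sub>Z x = (\<Sum>i\<in>UNIV. c i *\<^sub>Z \<alpha> i)"
proof -
  let ?O = "{actX D ws x | ws. True}"
  have fin: "finite ?O" by (rule finite_X_orbit)
  have "actX D [] x \<in> ?O" by blast
  then have ne: "card ?O \<noteq> 0" using fin by auto
  have stable: "reflX D i z \<in> ?O" if "z \<in> ?O" for i z
    using that by clarify (metis actX_simps(2))
  then have "bij_betw (reflX D i) ?O ?O" for i
    by (intro bij_betw_byWitness[where f' = "reflX D i"]) auto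
  then have inv: "reflX D i (\<Sum>?O) = \<Sum>?O" for i
    using sum.reindex_bij_betw[of "reflX D i" ?O ?O "\<lambda>z. z"]
    by (simp add: additive.sum[OF additive_reflX])
  have "pair (\<eta> i) (reflX D i (\<Sum>?O)) = - pair (\<eta> i) (\<Sum>?O)" for i
    by (simp add: reflX_def pair_diff_right pair_coroot_alpha)
  then have "pair (\<eta> i) (\<Sum>?O) = pair (\<eta> i) 0" for i unfolding inv by simp
  then have zero: "\<Sum>?O = 0" by (rule pair_coroot_eqI)
  have "\<exists>c. z = x + (\<Sum>i\<in>UNIV. c i *\<^sub>Z \<alpha> i)" if z: "z \<in> ?O" for z
  proof -
    from z obtain ws where "z = actX D ws x" by blast
    then show ?thesis using actX_coset[of ws UNIV x] by auto
  qed
  then have "\<forall>z\<in>?O. \<exists>c. z = x + (\<Sum>i\<in>UNIV. c i *\<^sub>Z \<alpha> i)" by (rule ballI)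
  from bchoice[OF this] obtain c where "\<forall>z\<in>?O. z = x + (\<Sum>i\<in>UNIV. c z i *\<^sub>Z \<alpha> i)" ..
  note c = this[rule_format]
  have "\<Sum>?O = (\<Sum>z\<in>?O. x + (\<Sum>i\<in>UNIV. c z i *\<^sub>Z \<alpha> i))" using c by (rule sum.cong[OF refl])
  also have "\<dots> = (\<Sum>z\<in>?O. 1 *\<^sub>Z x) + (\<Sum>i\<in>UNIV. (\<Sum>z\<in>?O. c z i) *\<^sub>Z \<alpha> i)"
    by (simp only: sum.distrib zscale_one zscale_sum_left sum.swap[of _ UNIV ?O])
  also have "(\<Sum>z\<in>?O. 1 *\<^sub>Z x) = int (card ?O) *\<^sub>Z x"
    unfolding zscale_sum_left[symmetric] by simp
  finally have "int (card ?O) *\<^sub>Z x + (\<Sum>i\<in>UNIV. (\<Sum>z\<in>?O. c z i) *\<^sub>Z \<alpha> i) = 0"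
    unfolding zero by (rule sym)
  then have "(- int (card ?O)) *\<^sub>Z x = (\<Sum>i\<in>UNIV. (\<Sum>z\<in>?O. c z i) *\<^sub>Z \<alpha> i)"
    unfolding zscale_minus_left by (rule minus_unique)
  then show thesis by (rule that[rotated]) (use ne in simp)
qed

lemma additive_eqI_alpha:
  fixes f g :: "'x \<Rightarrow> 'b::ab_group_add"
  assumes "additive f" "additive g" "\<And>j. f (\<alpha> j) = g (\<alpha> j)"
    and tf: "\<And>m (y::'b) z. m \<noteq> 0 \<Longrightarrow> m *\<^sub>Z y = m *\<^sub>Z z \<Longrightarrow> y = z"
  shows "f x = g x"
proof -
  obtain m c where mc: "m \<noteq> 0" "m *\<^sub>Z x = (\<Sum>i\<in>UNIV. c i *\<^sub>Z \<alpha> i)" by (rule alphas_span)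
  have "m *\<^sub>Z f x = m *\<^sub>Z g x"
    unfolding additive_zscale[OF assms(1), symmetric] additive_zscale[OF assms(2), symmetric] mc(2)
    by (rule additive_eq_on_span) (use assms in auto)
  then show ?thesis by (rule tf[OF mc(1)])
qed

text \<open>An operator is determined by its values on the simple roots, because these span
  rationally and X is torsion-free; each value lies in a finite orbit.\<close>

lemma finite_actX: "finite (range (actX D))"
proof (rule finite_imageD)
  have "(\<lambda>f j. f (\<alpha> j)) ` range (actX D) \<subseteq> (\<Pi>\<^sub>E j\<in>UNIV. {actX D ws (\<alpha> j) | ws. True})"
    by auto
  then show "finite ((\<lambda>f j. f (\<alpha> j)) ` range (actX D))"
    by (rule finite_subset) (intro finite_PiE finite_X_orbit; simp)
  show "inj_on (\<lambda>f j. f (\<alpha> j)) (range (actX D))"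
  proof (rule inj_onI, clarify)
    fix vs ws assume "(\<lambda>j. actX D vs (\<alpha> j)) = (\<lambda>j. actX D ws (\<alpha> j))"
    then have "actX D vs (\<alpha> j) = actX D ws (\<alpha> j)" for j by metis
    then show "actX D vs = actX D ws"
      using additive_eqI_alpha[OF additive_actX additive_actX] X_torsion_free by blast
  qed
qed

text \<open>The choice in \<open>longest_word\<close> is meaningful only if the lengths of reduced
  words are bounded. Such a length depends only on the operator, and there are finitely many
  operators.\<close>

lemma longest_word_in_lists: "longest_word D J \<in> lists J"
proof -
  let ?R = "{ws. ws \<in> lists J \<and> reduced_word D ws}"
  have "length ws = (LEAST n. \<exists>vs. actX D vs = actX D ws \<and> length vs = n)" if "reduced_word D ws" for ws
    using that by (intro Least_equality[symmetric]) (auto simp: reduced_word_def)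
  then have "length ` ?R \<subseteq> (\<lambda>f. LEAST n. \<exists>vs. actX D vs = f \<and> length vs = n) ` range (actX D)"
    by auto
  then have fin: "finite (length ` ?R)" by (rule finite_subset) (intro finite_imageI finite_actX)
  have ne: "[] \<in> ?R" by (auto simp: reduced_word_def)
  have "\<exists>ws. ws \<in> lists J \<and> reduced_word D ws \<and>
      (\<forall>vs \<in> lists J. reduced_word D vs \<longrightarrow> length vs \<le> length ws)"
  proof -
    from Max_in[OF fin] ne obtain ws where "ws \<in> ?R" "length ws = Max (length ` ?R)"
      by (metis (no_types, lifting) empty_iff image_iff)
    moreover have "length vs \<le> Max (length ` ?R)" if "vs \<in> ?R" for vs
      using that by (intro Max_ge[OF fin] imageI)
    ultimately show ?thesis by (intro exI[of _ ws]) auto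
  qed
  from someI_ex[OF this] show ?thesis unfolding longest_word_def by blast
qed


subsection \<open>The form\<close>

lemma form_alpha_left: "form D (\<alpha> i) m = of_int (half_norm i * pair (\<eta> i) m)"
proof (rule additive_eqI_alpha[OF additive_form])
  show "additive (\<lambda>m. of_int (half_norm i * pair (\<eta> i) m) :: rat)"
    by standard (simp add: pair_add_right algebra_simps)
qed (simp_all add: form_alpha pair_coroot_alpha zscale_eq_of_int_mult)

lemma h_of_eqI: "(\<And>m. of_int (pair y m) = form D l m) \<Longrightarrow> h_of D l = y"
  unfolding h_of_def by (rule the_equality) (auto intro!: pair_eqI_left simp flip: of_int_eq_iff[where 'a = rat])

lemma additive_form_left: "additive (\<lambda>l. form D l m)"
  by standard (simp add: form_sym[of _ m] additive.add[OF additive_form])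

lemma h_of_alpha: "h_of D (\<alpha> i) = half_norm i *\<^sub>Z \<eta> i"
  and h_of_minus_alpha: "h_of D (- \<alpha> i) = - (half_norm i *\<^sub>Z \<eta> i)"
  by (rule h_of_eqI; simp add: form_alpha_left additive.minus[OF additive_form_left])+

lemma form_zscale_right: "form D l (n *\<^sub>Z m) = of_int n * form D l m"
  using additive_zscale[OF additive_form] by (simp add: zscale_eq_of_int_mult)

lemma form_zscale_left: "form D (n *\<^sub>Z l) m = of_int n * form D l m"
  using additive_zscale[OF additive_form_left] by (simp add: zscale_eq_of_int_mult)

lemma form_alpha_right: "form D l (\<alpha> i) = of_int (half_norm i * pair (\<eta> i) l)"
  by (subst form_sym) (rule form_alpha_left)

lemma form_reflX: "form D (reflX D i l) (reflX D i m) = form D l m"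
  unfolding reflX_def additive.diff[OF additive_form] additive.diff[OF additive_form_left]
    form_zscale_left form_zscale_right form_alpha_left form_alpha_right
    pair_diff_right pair_zscale_right pair_coroot_alpha
  by (simp add: algebra_simps)

lemma form_actX: "form D (actX D ws l) (actX D ws m) = form D l m"
  by (induction ws) (simp_all add: form_reflX)

end

section \<open>Satake diagrams\<close>

locale satake_pair = semisimple_datum D
  for D :: "('i::finite, 'x::ab_group_add, 'y::ab_group_add) satake_datum" +
  assumes satake: "satake_diagram D"
begin

abbreviation \<tau> where "\<tau> \<equiv> tau D"
abbreviation bl where "bl \<equiv> black D"

lemma tau_tau [simp]: "\<tau> (\<tau> j) = j"
  and cartan_tau [simp]: "a (\<tau> j) (\<tau> k) = a j k"
  and additive_tauX: "additive (tauX D)"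
  and additive_tauY: "additive (tauY D)"
  and pair_tau [simp]: "pair (tauY D h) (tauX D m) = pair h m"
  and tauX_alpha [simp]: "tauX D (\<alpha> j) = \<alpha> (\<tau> j)"
  and black_alpha: "j \<in> bl \<Longrightarrow> actX D (w_black D) (\<alpha> j) = - \<alpha> (\<tau> j)"
proof -
  note s = satake[unfolded satake_diagram_def]
  show "\<tau> (\<tau> j) = j"
    by (rule s[THEN conjunct1, rule_format])
  show "a (\<tau> j) (\<tau> k) = a j k"
    by (rule s[THEN conjunct2, THEN conjunct1, rule_format])
  show "additive (tauX D)"
    by (rule s[THEN conjunct2, THEN conjunct2, THEN conjunct1])
  show "additive (tauY D)"
    by (rule s[THEN conjunct2, THEN conjunct2, THEN conjunct2, THEN conjunct2, THEN conjunct1])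
  show "pair (tauY D h) (tauX D m) = pair h m"
    by (rule s[THEN conjunct2, THEN conjunct2, THEN conjunct2, THEN conjunct2, THEN conjunct2, THEN conjunct2, THEN conjunct1, rule_format])
  show "tauX D (\<alpha> j) = \<alpha> (\<tau> j)"
    by (rule s[THEN conjunct2, THEN conjunct2, THEN conjunct2, THEN conjunct2, THEN conjunct2, THEN conjunct2, THEN conjunct2, THEN conjunct1, rule_format])
  assume "j \<in> bl"
  then show "actX D (w_black D) (\<alpha> j) = - \<alpha> (\<tau> j)"
    by (rule s[THEN conjunct2, THEN conjunct2, THEN conjunct2, THEN conjunct2, THEN conjunct2, THEN conjunct2, THEN conjunct2, THEN conjunct2, THEN conjunct1, rule_format])
qed

lemma tau_eq_iff [simp]: "\<tau> j = \<tau> k \<longleftrightarrow> j = k"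
  by (metis tau_tau)

lemma cartan_tau_left: "a (\<tau> j) k = a j (\<tau> k)"
  using cartan_tau[of j "\<tau> k"] by simp

lemma tauY_coroot [simp]: "tauY D (\<eta> j) = \<eta> (\<tau> j)"
proof (rule pair_alpha_eqI)
  fix k
  show "pair (tauY D (\<eta> j)) (\<alpha> k) = pair (\<eta> (\<tau> j)) (\<alpha> k)"
    using pair_tau[of "\<eta> j" "\<alpha> (\<tau> k)"] by (simp add: pair_coroot_alpha cartan_tau_left)
qed

lemma w_black_in_lists: "w_black D \<in> lists bl"
  by (rule longest_word_in_lists)

text \<open>\<open>w_black\<close> changes \<alpha>_j by black simple roots only. If \<tau>(j) were
  white, its root would have coefficient 1 in the vanishing sum of \<alpha>_j, \<alpha>_{\<tau>(j)}
  and black roots.\<close>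

lemma tau_black: "j \<in> bl \<Longrightarrow> \<tau> j \<in> bl"
proof (rule ccontr)
  assume j: "j \<in> bl" and tj: "\<tau> j \<notin> bl"
  obtain c where c: "\<And>k. k \<notin> bl \<Longrightarrow> c k = 0"
      "actX D (w_black D) (\<alpha> j) = \<alpha> j + (\<Sum>k\<in>UNIV. c k *\<^sub>Z \<alpha> k)"
    using actX_coset[OF w_black_in_lists, of "\<alpha> j"] by blast
  define e where "e = (\<lambda>k. (if k = j then 1 else 0) + (if k = \<tau> j then 1 else 0) + c k)"
  have "(\<Sum>k\<in>UNIV. e k *\<^sub>Z \<alpha> k) = (\<Sum>k\<in>UNIV. (if k = j then \<alpha> k else 0)
      + (if k = \<tau> j then \<alpha> k else 0) + c k *\<^sub>Z \<alpha> k)"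
    by (rule sum.cong) (auto simp: e_def zscale_add_left)
  also have "\<dots> = \<alpha> j + \<alpha> (\<tau> j) + (\<Sum>k\<in>UNIV. c k *\<^sub>Z \<alpha> k)"
    by (simp add: sum.distrib)
  also have "\<dots> = 0" using black_alpha[OF j] unfolding c(2) by (simp add: eq_neg_iff_add_eq_0 ac_simps)
  finally have "e (\<tau> j) = 0" by (rule alpha_independent)
  then show False using j tj c(1)[OF tj] by (auto simp: e_def split: if_splits)
qed

lemma tau_black_iff [simp]: "\<tau> j \<in> bl \<longleftrightarrow> j \<in> bl"
  using tau_black tau_tau by metis

lemma actX_fixes:
  assumes "ws \<in> lists J" "\<And>k. k \<in> J \<Longrightarrow> pair (\<eta> k) x = 0"
  shows "actX D ws x = x"
  using assms by (induction ws) (auto simp: reflX_def)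

lemma actY_fixes:
  assumes "ws \<in> lists J" "\<And>k. k \<in> J \<Longrightarrow> pair y (\<alpha> k) = 0"
  shows "actY D ws y = y"
  using assms by (induction ws) (auto simp: reflY_def)

lemma half_norm_tau_black:
  assumes "k \<in> bl"
  shows "half_norm (\<tau> k) = half_norm k"
proof -
  have "form D (\<alpha> (\<tau> k)) (\<alpha> (\<tau> k)) = form D (\<alpha> k) (\<alpha> k)"
    using form_actX[of "w_black D" "\<alpha> k" "\<alpha> k"] black_alpha[OF assms]
    by (simp add: additive.minus[OF additive_form] additive.minus[OF additive_form_left])
  then show ?thesis by (simp add: half_norm_def)
qed

text \<open>The sign condition is given for roots. It passes to coroots through the invariant form:
  \<open>half_norm k\<close> times the pairing with a coroot is the form with the root, and k and
  \<tau>(k) have equal norm because \<open>w_black\<close> acts by isometries.\<close>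

lemma actY_black_coroot:
  assumes k: "k \<in> bl"
  shows "actY D (w_black D) (\<eta> k) = - \<eta> (\<tau> k)"
proof (rule pair_eqI_left)
  fix x
  let ?x = "actX D (rev (w_black D)) x"
  have "of_int (half_norm k * pair (actY D (w_black D) (\<eta> k)) x) = form D (\<alpha> k) ?x"
    by (simp add: pair_actY form_alpha_left)
  also have "\<dots> = form D (- \<alpha> (\<tau> k)) x"
    using form_actX[of "w_black D" "\<alpha> k" ?x] by (simp add: black_alpha[OF k])
  also have "\<dots> = of_int (half_norm k * pair (- \<eta> (\<tau> k)) x)"
    by (simp add: additive.minus[OF additive_form_left] form_alpha_left half_norm_tau_black[OF k])
  finally show "pair (actY D (w_black D) (\<eta> k)) x = pair (- \<eta> (\<tau> k)) x"
    using half_norm_pos[of k] by (metis less_irrefl mult_cancel_left of_int_eq_iff)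
qed

lemma Y_theta_coroot_black: "k \<in> bl \<Longrightarrow> \<eta> k \<in> Y_theta D"
  by (simp add: Y_theta_def thetaY_def actY_black_coroot)

text \<open>Without black neighbours both coroots are fixed by \<open>w_black\<close>, so \<Theta>
  acts on them as -\<tau>.\<close>

lemma Y_theta_coroot_diff:
  assumes "\<And>k. k \<in> bl \<Longrightarrow> a j k = 0"
  shows "\<eta> j - \<eta> (\<tau> j) \<in> Y_theta D"
proof -
  have j: "actY D (w_black D) (\<eta> j) = \<eta> j"
    by (rule actY_fixes[OF w_black_in_lists]) (simp add: pair_coroot_alpha assms)
  have tj: "actY D (w_black D) (\<eta> (\<tau> j)) = \<eta> (\<tau> j)"
    by (rule actY_fixes[OF w_black_in_lists]) (simp add: pair_coroot_alpha cartan_tau_left assms)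
  show ?thesis
    by (simp add: Y_theta_def thetaY_def additive.diff[OF additive_tauY] additive.diff[OF additive_actY] j tj)
qed

lemma additive_thetaY: "additive (thetaY D)"
  by standard (simp add: thetaY_def additive.add[OF additive_tauY] additive.add[OF additive_actY])

lemma Y_theta_zero: "0 \<in> Y_theta D"
  and Y_theta_add: "h \<in> Y_theta D \<Longrightarrow> h' \<in> Y_theta D \<Longrightarrow> h + h' \<in> Y_theta D"
  and Y_theta_minus: "h \<in> Y_theta D \<Longrightarrow> - h \<in> Y_theta D"
  by (simp_all add: Y_theta_def additive.zero[OF additive_thetaY] additive.add[OF additive_thetaY]
      additive.minus[OF additive_thetaY])

lemma Y_theta_zscale: "h \<in> Y_theta D \<Longrightarrow> n *\<^sub>Z h \<in> Y_theta D"
  by (simp add: Y_theta_def additive_zscale[OF additive_thetaY])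

text \<open>On Y^Theta the weight of the braided generator E_{\<tau>(j)} agrees with -\<alpha>_j, so
  both summands of B_j have the same weight.\<close>

lemma pair_thetaY: "h \<in> Y_theta D \<Longrightarrow> pair h (actX D (w_black D) (\<alpha> (\<tau> j))) = - pair h (\<alpha> j)"
proof -
  assume "h \<in> Y_theta D"
  then have h: "actY D (w_black D) (tauY D h) = - h"
    unfolding Y_theta_def thetaY_def by (metis (mono_tags) mem_Collect_eq minus_minus)
  have inv: "pair (actY D ws y) (actX D ws x) = pair y x" for ws y x
    using actX_rev[of "rev ws" x] by (simp add: pair_actY)
  have "pair h (\<alpha> j) = pair (tauY D h) (\<alpha> (\<tau> j))"
    using pair_tau[of h "\<alpha> j"] by simp
  also have "\<dots> = pair (- h) (actX D (w_black D) (\<alpha> (\<tau> j)))"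
    unfolding h[symmetric] by (rule inv[symmetric])
  finally show ?thesis by simp
qed

text \<open>Modulo the black coroots, \<open>\<Theta>\<close> is \<open>- \<tau>\<close>.\<close>

lemma Y_theta_coordinates:
  assumes h: "h \<in> Y_theta D" and mh: "m *\<^sub>Z h = (\<Sum>j\<in>UNIV. c j *\<^sub>Z \<eta> j)" and j: "j \<notin> bl"
  shows "c (\<tau> j) = - c j"
proof -
  have bij: "bij \<tau>" by (rule involuntory_imp_bij) simp
  have 1: "tauY D (m *\<^sub>Z h) = (\<Sum>j\<in>UNIV. c (\<tau> j) *\<^sub>Z \<eta> j)"
    unfolding mh using sum.reindex_bij_betw[OF bij, of "\<lambda>j. c (\<tau> j) *\<^sub>Z \<eta> j"]
    by (simp add: additive.sum[OF additive_tauY] additive_zscale[OF additive_tauY])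
  obtain e where e: "\<And>k. k \<notin> bl \<Longrightarrow> e k = 0"
      "actY D (w_black D) (tauY D (m *\<^sub>Z h)) = tauY D (m *\<^sub>Z h) + (\<Sum>k\<in>UNIV. e k *\<^sub>Z \<eta> k)"
    using actY_coset[OF w_black_in_lists, of "tauY D (m *\<^sub>Z h)"] by blast
  have "m *\<^sub>Z h = - actY D (w_black D) (tauY D (m *\<^sub>Z h))"
    using Y_theta_zscale[OF h, of m] by (simp add: Y_theta_def thetaY_def)
  then have "m *\<^sub>Z h = - ((\<Sum>k\<in>UNIV. c (\<tau> k) *\<^sub>Z \<eta> k) + (\<Sum>k\<in>UNIV. e k *\<^sub>Z \<eta> k))"
    unfolding e(2) unfolding 1 .
  then have "(\<Sum>k\<in>UNIV. c k *\<^sub>Z \<eta> k) + (\<Sum>k\<in>UNIV. c (\<tau> k) *\<^sub>Z \<eta> k) + (\<Sum>k\<in>UNIV. e k *\<^sub>Z \<eta> k) = 0"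
    unfolding mh by (simp add: eq_neg_iff_add_eq_0 add.assoc)
  then have "(\<Sum>k\<in>UNIV. (c k + c (\<tau> k) + e k) *\<^sub>Z \<eta> k) = 0"
    by (simp add: zscale_add_left sum.distrib)
  then have "c j + c (\<tau> j) + e j = 0" by (rule coroot_independent)
  then show ?thesis using e(1)[OF j] by simp
qed

text \<open>The description in \<open>fund_weight\<close> is satisfied uniquely because the coroots
  span Y rationally. The witness \<open>w\<close> picks for each y a multiple in the coroot lattice
  and divides its coordinate by the multiplier.\<close>

lemma fund_weight_coordinate:
  assumes "m \<noteq> 0" and mh: "m *\<^sub>Z h = (\<Sum>j\<in>UNIV. c j *\<^sub>Z \<eta> j)"
  shows "fund_weight D i h = of_int (c i) / of_int m"
proof -
  have "\<exists>p. fst p \<noteq> 0 \<and> fst p *\<^sub>Z y = (\<Sum>j\<in>UNIV. snd p j *\<^sub>Z \<eta> j)" for y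
    using coroots_span[of y] by (metis fst_conv snd_conv)
  then obtain p where p: "\<And>y. fst (p y) \<noteq> 0" "\<And>y. fst (p y) *\<^sub>Z y = (\<Sum>j\<in>UNIV. snd (p y) j *\<^sub>Z \<eta> j)"
    by metis
  define w where "w y = (of_int (snd (p y) i) / of_int (fst (p y)) :: rat)" for y
  have w: "w y = of_int (e i) / of_int n" if "n \<noteq> 0" "n *\<^sub>Z y = (\<Sum>j\<in>UNIV. e j *\<^sub>Z \<eta> j)" for n y e
  proof -
    have "(\<Sum>j\<in>UNIV. (n * snd (p y) j) *\<^sub>Z \<eta> j) = n *\<^sub>Z fst (p y) *\<^sub>Z y"
      by (simp add: p(2) zscale_sum_right zscale_zscale)
    also have "\<dots> = fst (p y) *\<^sub>Z n *\<^sub>Z y" by (simp add: zscale_zscale mult.commute)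
    also have "\<dots> = (\<Sum>j\<in>UNIV. (fst (p y) * e j) *\<^sub>Z \<eta> j)"
      by (simp add: that(2) zscale_sum_right zscale_zscale)
    finally have "(\<lambda>j. n * snd (p y) j) = (\<lambda>j. fst (p y) * e j)" by (simp only: coroot_span_eq_iff)
    then have "n * snd (p y) i = fst (p y) * e i" by metis
    then have "(of_int n * of_int (snd (p y) i) :: rat) = of_int (fst (p y)) * of_int (e i)"
      by (metis of_int_mult)
    then show ?thesis using that(1) p(1)[of y] by (simp add: w_def frac_eq_eq mult.commute)
  qed
  have addw: "additive w"
  proof
    fix y z
    have "(fst (p y) * fst (p z)) *\<^sub>Z (y + z)
        = fst (p z) *\<^sub>Z fst (p y) *\<^sub>Z y + fst (p y) *\<^sub>Z fst (p z) *\<^sub>Z z"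
      by (simp add: zscale_zscale zscale_add_right mult.commute)
    also have "\<dots> = (\<Sum>j\<in>UNIV. (fst (p z) * snd (p y) j + fst (p y) * snd (p z) j) *\<^sub>Z \<eta> j)"
      unfolding p(2) by (simp add: zscale_sum_right zscale_zscale zscale_add_left sum.distrib)
    finally have "w (y + z) = of_int (fst (p z) * snd (p y) i + fst (p y) * snd (p z) i)
        / of_int (fst (p y) * fst (p z))"
      by (rule w[rotated]) (simp add: p(1))
    then show "w (y + z) = w y + w z" by (simp add: w_def p(1) add_frac_eq mult.commute)
  qed
  have weta: "w (\<eta> j) = (if j = i then 1 else 0)" for j
    using w[of 1 "\<eta> j" "\<lambda>k. if k = j then 1 else 0"] coroot_as_span[of j] by auto
  have uniq: "u = w" if u: "additive u" "\<forall>j. u (\<eta> j) = (if j = i then 1 else 0)" for u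
  proof
    fix y
    have "of_int (fst (p y)) * u y = u (fst (p y) *\<^sub>Z y)"
      by (simp add: additive_zscale[OF u(1)] zscale_eq_of_int_mult)
    also have "\<dots> = w (fst (p y) *\<^sub>Z y)"
      unfolding p(2) by (rule additive_eq_on_span) (simp_all add: u addw weta)
    also have "\<dots> = of_int (fst (p y)) * w y"
      by (simp add: additive_zscale[OF addw] zscale_eq_of_int_mult)
    finally show "u y = w y" using p(1)[of y] by simp
  qed
  have "fund_weight D i = w"
    unfolding fund_weight_def
  proof (rule the_equality)
    show "additive w \<and> (\<forall>j. w (\<eta> j) = (if j = i then 1 else 0))"
      using addw weta by simp
    show "u = w" if "additive u \<and> (\<forall>j. u (\<eta> j) = (if j = i then 1 else 0))" for u
      using that by (elim conjE) (rule uniq)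
  qed
  then show ?thesis using w[OF assms] by simp
qed

end

section \<open>Combinatorics of the diagram\<close>

context semisimple_datum
begin

definition adj :: "'i \<Rightarrow> 'i \<Rightarrow> bool" where "adj k l \<longleftrightarrow> k \<noteq> l \<and> a k l \<noteq> 0"

lemma adj_sym: "adj k l \<longleftrightarrow> adj l k"
  using cartan_zero_sym[of k l] by (auto simp: adj_def)

lemma adj_cartan: "adj k l \<Longrightarrow> a k l \<le> -1"
  using cartan_nonpos[of k l] by (auto simp: adj_def)

text \<open>If every row were nonpositive on the support of x, the form at x would be a sum of
  nonpositive terms.\<close>

lemma finite_type_vector:
  fixes x :: "'i \<Rightarrow> nat"
  assumes "x j > 0"
  obtains k where "x k > 0" "2 * int (x k) > (\<Sum>l\<in>-{k}. - a k l * int (x l))"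
proof (rule ccontr)
  assume neg: "\<not> thesis"
  have "(\<Sum>k\<in>UNIV. symm k * real (x k) * cartan_map (\<lambda>l. real (x l)) k) \<le> 0"
  proof (rule sum_nonpos)
    fix k
    show "symm k * real (x k) * cartan_map (\<lambda>l. real (x l)) k \<le> 0"
    proof (cases "x k > 0")
      case True
      have "2 * int (x k) \<le> (\<Sum>l\<in>-{k}. - a k l * int (x l))"
      proof (rule ccontr)
        assume "\<not> ?thesis"
        then have "2 * int (x k) > (\<Sum>l\<in>-{k}. - a k l * int (x l))" by simp
        from that[OF True this] neg show False by blast
      qed
      moreover have "(\<Sum>l\<in>UNIV. a k l * int (x l)) = 2 * int (x k) + (\<Sum>l\<in>-{k}. a k l * int (x l))"
        using sum.remove[of UNIV k "\<lambda>l. a k l * int (x l)"] by (simp add: Compl_eq_Diff_UNIV)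
      ultimately have "(\<Sum>l\<in>UNIV. a k l * int (x l)) \<le> 0"
        by (simp add: sum_negf)
      then have "of_int (\<Sum>l\<in>UNIV. a k l * int (x l)) \<le> (0::real)"
        by (simp only: of_int_le_0_iff)
      then have "cartan_map (\<lambda>l. real (x l)) k \<le> 0" by (simp add: cartan_map_def)
      then show ?thesis using symm_pos[of k] by (simp add: mult_nonneg_nonpos)
    qed simp
  qed
  moreover have "cartan_form (\<lambda>l. real (x l)) > 0" by (rule cartan_pos_def[of _ j]) (use assms in simp)
  ultimately show False by (simp add: cartan_form_def)
qed

text \<open>Such an \<open>x\<close> would be a null vector of an affine (or indefinite) subdiagram.\<close>

lemma no_affine:
  fixes x :: "'i \<Rightarrow> nat"
  assumes "x j > 0"
    and N: "\<And>k. x k > 0 \<Longrightarrow> \<exists>N. k \<notin> N \<and> 2 * int (x k) \<le> (\<Sum>l\<in>N. - a k l * int (x l))"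
  shows False
proof -
  obtain k where k: "x k > 0" "2 * int (x k) > (\<Sum>l\<in>-{k}. - a k l * int (x l))"
    using finite_type_vector[of x j, OF assms(1)] by blast
  obtain N where "k \<notin> N" "2 * int (x k) \<le> (\<Sum>l\<in>N. - a k l * int (x l))" using N[OF k(1)] by blast
  moreover have "(\<Sum>l\<in>N. - a k l * int (x l)) \<le> (\<Sum>l\<in>-{k}. - a k l * int (x l))"
    using \<open>k \<notin> N\<close> cartan_nonpos[of k] by (intro sum_mono2) (auto intro!: mult_nonneg_nonneg mult_nonpos_nonneg)
  ultimately show False using k(2) by linarith
qed

text \<open>Every bond is counted as simple; entries at adjacent nodes are at most -1, so multiple
  bonds only strengthen the inequality. This suffices for the tests of types D and E.\<close>

lemma no_affine_adj:
  fixes x :: "'i \<Rightarrow> nat"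
  assumes "x j > 0"
    and N: "\<And>k. x k > 0 \<Longrightarrow> \<exists>N. (\<forall>l\<in>N. adj k l) \<and> 2 * x k \<le> sum x N"
  shows False
proof (rule no_affine[of x j, OF assms(1)])
  fix k assume "x k > 0"
  then obtain N where N: "\<forall>l\<in>N. adj k l" "2 * x k \<le> sum x N" using N by blast
  have "2 * int (x k) = int (2 * x k)" by simp
  also have "\<dots> \<le> int (sum x N)" using N(2) by (simp only: of_nat_le_iff)
  also have "int (sum x N) = (\<Sum>l\<in>N. 1 * int (x l))" by simp
  also have "\<dots> \<le> (\<Sum>l\<in>N. - a k l * int (x l))"
    by (rule sum_mono, rule mult_right_mono) (use N(1) adj_cartan[of k] in force)+
  finally show "\<exists>N. k \<notin> N \<and> 2 * int (x k) \<le> (\<Sum>l\<in>N. - a k l * int (x l))"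
    using N(1) by (auto simp: adj_def)
qed

text \<open>Evaluate the form at x_k = 1 / sqrt(symm k): each diagonal term becomes 2, and each
  ordered pair of adjacent nodes contributes at most -1. Positivity of the total gives the
  bound.\<close>

lemma edge_count: "card {(k, l). adj k l} < 2 * card (UNIV :: 'i set)"
proof -
  let ?E = "{(k, l). adj k l}"
  let ?x = "\<lambda>k. 1 / sqrt (symm k)"
  let ?g = "\<lambda>k l. symm k * ?x k * (of_int (a k l) * ?x l)"
  have pos: "sqrt (symm k) > 0" "sqrt (symm k) * sqrt (symm k) = symm k" for k using symm_pos[of k] by simp_all
  have diag: "?g k k = 2" for k
    using pos[of k] by (simp add: field_simps)
  have off: "?g k l \<le> (if adj k l then -1 else 0)" if "k \<noteq> l" for k l
  proof (cases "adj k l")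
    case True
    define s where "s = symm k * - of_int (a k l)"
    have s': "s = symm l * - of_int (a l k)" unfolding s_def using symm_sym[of k l] by simp
    have 1: "- of_int (a k l) \<ge> (1::real)" using adj_cartan[OF True] by linarith
    have 2: "- of_int (a l k) \<ge> (1::real)" using adj_cartan[of l k] True adj_sym by force
    have k: "symm k \<le> s"
      using mult_left_mono[OF 1, of "symm k"] symm_pos[of k] by (simp add: s_def)
    have l: "symm l \<le> s"
      using mult_left_mono[OF 2, of "symm l"] symm_pos[of l] by (simp add: s')
    have s: "s \<ge> 0" using k symm_pos[of k] by simp
    then have "symm k * symm l \<le> s * s"
      by (intro mult_mono k l) (use symm_pos[of l] in simp_all)
    moreover note s
    ultimately have "sqrt (symm k * symm l) \<le> s" by (simp add: real_le_lsqrt power2_eq_square)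
    then have "sqrt (symm k) * sqrt (symm l) \<le> s" by (simp add: real_sqrt_mult)
    moreover have "?g k l = - s / (sqrt (symm k) * sqrt (symm l))" by (simp add: s_def)
    ultimately show ?thesis using True pos[of k] pos[of l] by (simp add: divide_simps)
  next
    case False
    then show ?thesis using that by (simp add: adj_def)
  qed
  have fin: "finite ?E" by (rule finite_subset[of _ UNIV]) simp_all
  have "0 < cartan_form ?x" by (rule cartan_pos_def) (use symm_pos in \<open>metis divide_eq_0_iff less_irrefl real_sqrt_eq_zero_cancel_iff zero_neq_one\<close>)
  also have "cartan_form ?x = (\<Sum>k\<in>UNIV. \<Sum>l\<in>UNIV. ?g k l)" by (simp add: cartan_form_def cartan_map_def sum_distrib_left)
  also have "\<dots> \<le> (\<Sum>k\<in>UNIV. \<Sum>l\<in>UNIV. (if l = k then 2 else 0) + (if adj k l then -1 else 0))"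
  proof (intro sum_mono)
    fix k l
    show "?g k l \<le> (if l = k then 2 else 0) + (if adj k l then -1 else 0)"
    proof (cases "l = k")
      case True
      then show ?thesis using diag[of k] by (simp add: adj_def)
    next
      case False
      then show ?thesis using off[of k l] by simp
    qed
  qed
  also have "\<dots> = 2 * real (card (UNIV :: 'i set)) + (\<Sum>k\<in>UNIV. \<Sum>l\<in>UNIV. if adj k l then -1 else 0)"
    by (simp add: sum.distrib)
  also have "(\<Sum>k\<in>UNIV. \<Sum>l\<in>UNIV. if adj k l then -1 else 0 :: real)
      = (\<Sum>e\<in>UNIV. if e \<in> ?E then -1 else 0)"
    by (simp add: sum.cartesian_product case_prod_beta flip: UNIV_Times_UNIV)
  also have "\<dots> = - real (card ?E)"
    by (simp add: sum.If_cases Int_def)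
  finally show ?thesis by simp
qed

text \<open>This is the triviality of the Weyl group on coweights modulo coroots, multiplied by N:
  each reflection subtracts a multiple of N times a coroot, which keeps the divisibility for the
  next one.\<close>

lemma actY_coset_mod:
  assumes "ws \<in> lists J" "\<And>j. j \<in> J \<Longrightarrow> N dvd pair y (\<alpha> j)"
  obtains c where "actY D ws y = y + N *\<^sub>Z (\<Sum>j\<in>UNIV. c j *\<^sub>Z \<eta> j)"
proof -
  have "\<exists>c. actY D ws y = y + N *\<^sub>Z (\<Sum>j\<in>UNIV. c j *\<^sub>Z \<eta> j)"
    using assms(1)
  proof (induction ws)
    case Nil
    show ?case by (intro exI[of _ "\<lambda>_. 0"]) simp
  next
    case (Cons k ws)
    then have k: "k \<in> J" by auto
    from Cons obtain c where c: "actY D ws y = y + N *\<^sub>Z (\<Sum>j\<in>UNIV. c j *\<^sub>Z \<eta> j)" by auto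
    have "N dvd pair (actY D ws y) (\<alpha> k)"
      unfolding c by (simp add: pair_add_left assms(2)[OF k])
    then obtain t where t: "pair (actY D ws y) (\<alpha> k) = N * t" by (auto elim: dvdE)
    have "(\<Sum>j\<in>UNIV. (c j - (if j = k then t else 0)) *\<^sub>Z \<eta> j)
        = (\<Sum>j\<in>UNIV. c j *\<^sub>Z \<eta> j) - (\<Sum>j\<in>UNIV. if j = k then t *\<^sub>Z \<eta> j else 0)"
      unfolding sum_subtractf[symmetric] by (rule sum.cong) (auto simp: zscale_diff_left)
    then have "actY D (k # ws) y = y + N *\<^sub>Z (\<Sum>j\<in>UNIV. (c j - (if j = k then t else 0)) *\<^sub>Z \<eta> j)"
      by (simp add: reflY_def t zscale_diff_right zscale_zscale) (simp add: c)
    then show ?case by (intro exI[of _ "\<lambda>j. c j - (if j = k then t else 0)"])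
  qed
  then show thesis using that by blast
qed

lemma finite_pos_coroots: "finite (pos_coroots D J)"
proof (rule finite_subset)
  show "pos_coroots D J \<subseteq> (\<Union>j. {actY D ws (\<eta> j) | ws. True})"
    unfolding pos_coroots_def by blast
  show "finite (\<Union>j. {actY D ws (\<eta> j) | ws. True})"
    by (intro finite_UN_I finite_coroot_orbit) simp
qed

text \<open>The component of b has type A_1: the black reflections send \<eta> b to itself or its
  negative and preserve the span \<open>V\<close> of the other black coroots. Only the positive sign
  is counted, which gives the coefficient 1.\<close>

lemma two_rho_check_isolated:
  assumes b: "b \<in> black D" and isol: "\<And>l. l \<in> black D \<Longrightarrow> l \<noteq> b \<Longrightarrow> \<not> adj b l"
  obtains c where "c b = 1" "\<And>l. l \<notin> black D \<Longrightarrow> c l = 0"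
    "two_rho_check D = (\<Sum>l\<in>UNIV. c l *\<^sub>Z \<eta> l)"
proof -
  define V where "V = {y. \<exists>c. c b = 0 \<and> (\<forall>l. l \<notin> black D \<longrightarrow> c l = 0) \<and> y = (\<Sum>l\<in>UNIV. c l *\<^sub>Z \<eta> l)}"
  have ab: "a l b = 0" "a b l = 0" if "l \<in> black D" "l \<noteq> b" for l
    using isol[OF that] that cartan_zero_sym[of b l] by (auto simp: adj_def)
  have V_zero: "0 \<in> V" unfolding V_def by (rule CollectI, rule exI[of _ "\<lambda>_. 0"]) simp
  have V_add: "y + z \<in> V" if y: "y \<in> V" and z: "z \<in> V" for y z
  proof -
    from y obtain c where c: "c b = 0" "\<forall>l. l \<notin> black D \<longrightarrow> c l = 0" "y = (\<Sum>l\<in>UNIV. c l *\<^sub>Z \<eta> l)"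
      unfolding V_def by blast
    from z obtain e where e: "e b = 0" "\<forall>l. l \<notin> black D \<longrightarrow> e l = 0" "z = (\<Sum>l\<in>UNIV. e l *\<^sub>Z \<eta> l)"
      unfolding V_def by blast
    show ?thesis unfolding V_def
      by (rule CollectI, rule exI[of _ "\<lambda>l. c l + e l"]) (use c e in \<open>simp add: zscale_add_left sum.distrib\<close>)
  qed
  have V_sum: "(\<And>x. x \<in> S \<Longrightarrow> f x \<in> V) \<Longrightarrow> sum f S \<in> V" for f and S :: "'y set"
    by (induction S rule: infinite_finite_induct) (auto simp: V_zero V_add)
  have V_eta: "n *\<^sub>Z \<eta> l \<in> V" if "l \<in> black D" "l \<noteq> b" for l n
  proof -
    have "n *\<^sub>Z \<eta> l = (\<Sum>k\<in>UNIV. (n * (if k = l then 1 else 0)) *\<^sub>Z \<eta> k)"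
      by (subst coroot_as_span) (simp only: zscale_sum_right zscale_zscale)
    then show ?thesis unfolding V_def using that
      by (intro CollectI exI[of _ "\<lambda>k. n * (if k = l then 1 else 0)"]) auto
  qed
  have orbit_b: "actY D ws (\<eta> b) \<in> {\<eta> b, - \<eta> b}" if "ws \<in> lists (black D)" for ws
    using that
  proof (induction ws)
    case (Cons k ws)
    then have k: "k \<in> black D" and "actY D ws (\<eta> b) \<in> {\<eta> b, - \<eta> b}" by auto
    moreover have "reflY D k (\<eta> b) = (if k = b then - \<eta> b else \<eta> b)"
    proof (cases "k = b")
      case True
      have "2 *\<^sub>Z \<eta> b = \<eta> b + \<eta> b" using zscale_add_left[of 1 1 "\<eta> b"] by simp
      then show ?thesis using True by (simp add: reflY_def pair_coroot_alpha)
    next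
      case False
      then show ?thesis using ab[OF k False] by (simp add: reflY_def pair_coroot_alpha)
    qed
    ultimately show ?case by (auto simp: additive.minus[OF additive_reflY] split: if_splits)
  qed simp
  have orbit_V: "actY D ws y \<in> V" if "ws \<in> lists (black D)" "y \<in> V" for ws y
    using that(1)
  proof (induction ws)
    case (Cons k ws)
    then have k: "k \<in> black D" and y: "actY D ws y \<in> V" by auto
    show ?case
    proof (cases "k = b")
      case True
      from y obtain c where c: "c b = 0" "\<forall>l. l \<notin> black D \<longrightarrow> c l = 0"
          "actY D ws y = (\<Sum>l\<in>UNIV. c l *\<^sub>Z \<eta> l)"
        unfolding V_def by blast
      have "pair (actY D ws y) (\<alpha> b) = (\<Sum>l\<in>UNIV. c l * a l b)"
        unfolding c(3) by (simp add: pair_sum_left pair_coroot_alpha)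
      also have "\<dots> = 0" by (rule sum.neutral) (metis ab(1) c(1,2) mult_eq_0_iff)
      finally show ?thesis using y True by (simp add: reflY_def)
    next
      case False
      then show ?thesis using V_add[OF y V_eta[OF k False, of "- pair (actY D ws y) (\<alpha> k)"]]
        by (simp add: reflY_def)
    qed
  qed (simp add: that(2))
  have "\<eta> b \<in> pos_coroots D (black D)"
  proof -
    have "\<eta> b = (\<Sum>j\<in>black D. if j = b then \<eta> j else 0)" using b by simp
    also have "\<dots> = (\<Sum>j\<in>black D. int (if j = b then 1 else 0) *\<^sub>Z \<eta> j)" by (rule sum.cong) auto
    finally have "\<exists>n :: 'i \<Rightarrow> nat. \<eta> b = (\<Sum>j\<in>black D. int (n j) *\<^sub>Z \<eta> j)"
      by (intro exI[of _ "\<lambda>j. if j = b then 1 else 0"])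
    moreover have "\<eta> b = actY D [] (\<eta> b)" by simp
    ultimately show ?thesis unfolding pos_coroots_def using b by blast
  qed
  then have "two_rho_check D = \<eta> b + \<Sum>(pos_coroots D (black D) - {\<eta> b})"
    unfolding two_rho_check_def using finite_pos_coroots by (rule sum.remove[rotated])
  moreover have "\<Sum>(pos_coroots D (black D) - {\<eta> b}) \<in> V"
  proof (rule V_sum)
    fix y assume y: "y \<in> pos_coroots D (black D) - {\<eta> b}"
    then obtain ws j n where ws: "ws \<in> lists (black D)" "j \<in> black D" "y = actY D ws (\<eta> j)"
      and n: "y = (\<Sum>j\<in>black D. int (n j) *\<^sub>Z \<eta> j)"
      unfolding pos_coroots_def by blast
    show "y \<in> V"
    proof (cases "j = b")
      case True
      then have "y = - \<eta> b" using orbit_b[OF ws(1)] ws(3) y by auto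
      then have "(\<Sum>k\<in>UNIV. (if k = b then 1 else 0) *\<^sub>Z \<eta> k) + (\<Sum>j\<in>black D. int (n j) *\<^sub>Z \<eta> j) = 0"
        unfolding n coroot_as_span[of b, symmetric] by (simp add: eq_neg_iff_add_eq_0 add.commute)
      also have "(\<Sum>j\<in>black D. int (n j) *\<^sub>Z \<eta> j) = (\<Sum>j\<in>UNIV. (if j \<in> black D then int (n j) else 0) *\<^sub>Z \<eta> j)"
        by (rule sum.mono_neutral_cong_left) auto
      finally have "(\<Sum>k\<in>UNIV. ((if k = b then 1 else 0) + (if k \<in> black D then int (n k) else 0)) *\<^sub>Z \<eta> k) = 0"
        by (simp only: zscale_add_left sum.distrib)
      from coroot_independent[OF this, of b] b show ?thesis by simp
    next
      case False
      then show ?thesis using orbit_V[OF ws(1) V_eta[OF ws(2) False, of 1]] ws(3) by simp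
    qed
  qed
  then obtain c where c: "c b = 0" "\<forall>l. l \<notin> black D \<longrightarrow> c l = 0"
      "\<Sum>(pos_coroots D (black D) - {\<eta> b}) = (\<Sum>l\<in>UNIV. c l *\<^sub>Z \<eta> l)"
    unfolding V_def by blast
  ultimately have "two_rho_check D = (\<Sum>l\<in>UNIV. ((if l = b then 1 else 0) + c l) *\<^sub>Z \<eta> l)"
    using coroot_as_span[of b] by (simp only: zscale_add_left sum.distrib)
  then show thesis by (rule that[rotated 2]) (use c b in auto)
qed

end

context satake_pair
begin

lemma adj_tau [simp]: "adj (\<tau> k) (\<tau> l) \<longleftrightarrow> adj k l"
  by (simp add: adj_def)

abbreviation black_edges where
  "black_edges \<equiv> {(k, l). k \<in> bl \<and> l \<in> bl \<and> k \<noteq> l \<and> a k l \<noteq> 0}"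

text \<open>\<open>w\<^sub>\<bullet>\<close> preserves the span of every black component and maps \<open>\<alpha>\<^sub>k\<close> to \<open>- \<alpha>\<^bsub>\<tau>(k)\<^esub>\<close>.\<close>

lemma tau_black_component:
  assumes k: "k \<in> bl"
  shows "(k, \<tau> k) \<in> black_edges\<^sup>*"
proof (rule ccontr)
  assume neg: "(k, \<tau> k) \<notin> black_edges\<^sup>*"
  let ?C = "{l. (k, l) \<in> black_edges\<^sup>*}"
  have "\<exists>c. (\<forall>l. l \<notin> ?C \<longrightarrow> c l = 0) \<and> actX D ws (\<alpha> k) = (\<Sum>l\<in>UNIV. c l *\<^sub>Z \<alpha> l)"
    if "ws \<in> lists bl" for ws
    using that
  proof (induction ws)
    case Nil
    have "\<alpha> k = (\<Sum>l\<in>UNIV. if l = k then \<alpha> l else 0)" by simp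
    also have "\<dots> = (\<Sum>l\<in>UNIV. (if l = k then 1 else 0) *\<^sub>Z \<alpha> l)" by (rule sum.cong) auto
    finally show ?case by (intro exI[of _ "\<lambda>l. if l = k then 1 else 0"]) auto
  next
    case (Cons m ws)
    then have m: "m \<in> bl" by auto
    from Cons obtain c where c: "\<forall>l. l \<notin> ?C \<longrightarrow> c l = 0"
        "actX D ws (\<alpha> k) = (\<Sum>l\<in>UNIV. c l *\<^sub>Z \<alpha> l)" by auto
    let ?t = "pair (\<eta> m) (actX D ws (\<alpha> k))"
    have t: "?t = (\<Sum>l\<in>UNIV. c l * a m l)"
      unfolding c(2) by (simp add: pair_sum_right pair_coroot_alpha)
    have t0: "?t = 0" if m': "m \<notin> ?C"
      unfolding t
    proof (rule sum.neutral, rule ballI)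
      fix l
      show "c l * a m l = 0"
      proof (cases "l \<in> ?C")
        case True
        then have "l \<in> bl" using k by (auto elim: rtranclE)
        then have "a l m = 0" using True m m' by (auto dest: rtrancl_into_rtrancl)
        then show ?thesis using cartan_zero_sym[of l m] by simp
      qed (use c(1) in auto)
    qed
    have "(\<Sum>l\<in>UNIV. (c l - (if l = m then ?t else 0)) *\<^sub>Z \<alpha> l)
        = (\<Sum>l\<in>UNIV. c l *\<^sub>Z \<alpha> l) - (\<Sum>l\<in>UNIV. if l = m then ?t *\<^sub>Z \<alpha> l else 0)"
      unfolding sum_subtractf[symmetric] by (rule sum.cong) (auto simp: zscale_diff_left)
    then have "actX D (m # ws) (\<alpha> k) = (\<Sum>l\<in>UNIV. (c l - (if l = m then ?t else 0)) *\<^sub>Z \<alpha> l)"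
      by (simp add: reflX_def) (simp add: c(2))
    then show ?case using c(1) t0
      by (intro exI[of _ "\<lambda>l. c l - (if l = m then ?t else 0)"]) auto
  qed
  from this[OF w_black_in_lists] obtain c where c: "\<forall>l. l \<notin> ?C \<longrightarrow> c l = 0"
      "- \<alpha> (\<tau> k) = (\<Sum>l\<in>UNIV. c l *\<^sub>Z \<alpha> l)"
    using black_alpha[OF k] by auto
  have "\<alpha> (\<tau> k) = (\<Sum>l\<in>UNIV. if l = \<tau> k then \<alpha> l else 0)" by simp
  also have "\<dots> = (\<Sum>l\<in>UNIV. (if l = \<tau> k then 1 else 0) *\<^sub>Z \<alpha> l)" by (rule sum.cong) auto
  finally have e: "\<alpha> (\<tau> k) = (\<Sum>l\<in>UNIV. (if l = \<tau> k then 1 else 0) *\<^sub>Z \<alpha> l)" .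
  have "(\<Sum>l\<in>UNIV. ((if l = \<tau> k then 1 else 0) + c l) *\<^sub>Z \<alpha> l) = \<alpha> (\<tau> k) + - \<alpha> (\<tau> k)"
    by (subst e, subst c(2)) (simp only: zscale_add_left sum.distrib)
  then have "(if \<tau> k = \<tau> k then 1 else 0) + c (\<tau> k) = 0"
    by (intro alpha_independent[of "\<lambda>l. (if l = \<tau> k then 1 else 0) + c l"]) simp
  then show False using c(1) neg by auto
qed

end

section \<open>The diagram as a forest growing out of the path I[i0]\<close>

locale aiv_pair = satake_pair D
  for D :: "('i::finite, 'x::ab_group_add, 'y::ab_group_add) satake_datum" +
  fixes i0 :: 'i and p :: "'i list"
  assumes irreducible: "irreducible_diagram D"
    and dist: "distinct p"
    and set_p: "set p = rank_one_subdiagram D i0"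
    and len: "length p \<ge> 2"
    and cartan_p: "\<And>m n. m < length p \<Longrightarrow> n < length p \<Longrightarrow>
           cartan D (p ! m) (p ! n) = (if m = n then 2 else if m = Suc n \<or> n = Suc m then -1 else 0)"
    and hd_p: "hd p = i0" and last_p: "last p = tau D i0"
    and white_i0: "i0 \<notin> black D"
    and interior: "\<And>m. 0 < m \<Longrightarrow> m < length p - 1 \<Longrightarrow> p ! m \<in> black D"
begin

abbreviation P where "P \<equiv> set p"

lemma p_0: "p ! 0 = i0" and p_last: "p ! (length p - 1) = \<tau> i0"
  using len hd_p last_p by (metis hd_conv_nth last_conv_nth list.size(3) not_numeral_le_zero)+

lemma p_inj: "m < length p \<Longrightarrow> n < length p \<Longrightarrow> p ! m = p ! n \<longleftrightarrow> m = n"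
  using dist by (simp add: nth_eq_iff_index_eq)

lemma in_P: "k \<in> P \<longleftrightarrow> (\<exists>m < length p. k = p ! m)"
  by (metis in_set_conv_nth)

lemma adj_p: "m < length p \<Longrightarrow> n < length p \<Longrightarrow> adj (p ! m) (p ! n) \<longleftrightarrow> m = Suc n \<or> n = Suc m"
  using p_inj[of m n] by (auto simp: adj_def cartan_p)

lemma white_P: "k \<in> P \<Longrightarrow> k \<notin> bl \<Longrightarrow> k = i0 \<or> k = \<tau> i0"
proof (rule ccontr)
  assume k: "k \<in> P" "k \<notin> bl" and neg: "\<not> (k = i0 \<or> k = \<tau> i0)"
  then obtain m where m: "m < length p" "k = p ! m" unfolding in_P by blast
  have "m \<noteq> 0" "m \<noteq> length p - 1" using neg m(2) p_0 p_last by metis+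
  then have "p ! m \<in> bl" using m(1) by (intro interior) auto
  then show False using k(2) m(2) by simp
qed

definition rank1_edges where
  "rank1_edges = {(k, l). k \<in> bl \<union> {i0, \<tau> i0} \<and> l \<in> bl \<union> {i0, \<tau> i0} \<and> k \<noteq> l \<and> a k l \<noteq> 0}"

lemma P_eq: "P = {k. (i0, k) \<in> rank1_edges\<^sup>*} \<union> {k. (\<tau> i0, k) \<in> rank1_edges\<^sup>*}"
  unfolding set_p rank_one_subdiagram_def component_def rank1_edges_def by simp

lemma rank1_edges_tau: "(k, l) \<in> rank1_edges \<Longrightarrow> (\<tau> k, \<tau> l) \<in> rank1_edges"
  unfolding rank1_edges_def by auto

lemma tau_P: "k \<in> P \<Longrightarrow> \<tau> k \<in> P"
proof -
  have "(\<tau> k, \<tau> l) \<in> rank1_edges\<^sup>*" if "(k, l) \<in> rank1_edges\<^sup>*" for k l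
    using that by induction (auto dest: rank1_edges_tau intro: rtrancl_into_rtrancl)
  from this[of i0] this[of "\<tau> i0"] show "k \<in> P \<Longrightarrow> \<tau> k \<in> P" unfolding P_eq by auto
qed

lemma tau_P_iff [simp]: "\<tau> k \<in> P \<longleftrightarrow> k \<in> P"
  using tau_P[of k] tau_P[of "\<tau> k"] by auto

lemma P_black_closed: "k \<in> P \<Longrightarrow> k \<in> bl \<Longrightarrow> l \<in> bl \<Longrightarrow> adj k l \<Longrightarrow> l \<in> P"
  unfolding P_eq using rtrancl_into_rtrancl[of _ k rank1_edges l]
  by (auto simp: rank1_edges_def adj_def)

text \<open>An automorphism exchanging the ends of a path reverses it: successive images are
  adjacent, and turning back would repeat an image.\<close>

lemma tau_p: "m < length p \<Longrightarrow> \<tau> (p ! m) = p ! (length p - 1 - m)"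
proof (induction m rule: less_induct)
  case (less m)
  show ?case
  proof (cases m)
    case 0
    then show ?thesis using p_0 p_last by simp
  next
    case (Suc m')
    have IH: "\<tau> (p ! m') = p ! (length p - 1 - m')" using less Suc by simp
    have "\<tau> (p ! m) \<in> P" using less.prems by simp
    then obtain b where b: "b < length p" "\<tau> (p ! m) = p ! b" unfolding in_P by blast
    have "adj (\<tau> (p ! m')) (\<tau> (p ! m))" using adj_p[of m' m] less.prems Suc by simp
    then have "adj (p ! (length p - 1 - m')) (p ! b)" by (simp add: IH b)
    then have "length p - 1 - m' = Suc b \<or> b = Suc (length p - 1 - m')"
      using b(1) less.prems Suc by (subst (asm) adj_p) auto
    \<comment> \<open>Turning back would give \<tau>(p ! m) = \<tau>(p ! (m' - 1)); for m' = 0 the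
      index b would already leave the path.\<close>
    moreover have "b \<noteq> Suc (length p - 1 - m')"
    proof
      assume bm: "b = Suc (length p - 1 - m')"
      then have m': "b = length p - 1 - (m' - 1)" using b(1) less.prems Suc by auto
      then have "\<tau> (p ! m) = \<tau> (p ! (m' - 1))"
        using less.IH[of "m' - 1"] less.prems Suc b bm by simp
      then have "m = m' - 1" using p_inj[of m "m' - 1"] less.prems Suc by simp
      then show False using Suc by linarith
    qed
    ultimately have "b = length p - 1 - m" using Suc by simp
    then show ?thesis using b(2) by simp
  qed
qed

definition E where "E = {(k, l). adj k l}"

lemma E_tau: "(k, l) \<in> E ^^ m \<Longrightarrow> (\<tau> k, \<tau> l) \<in> E ^^ m"
proof (induction m arbitrary: l)
  case (Suc m)
  then obtain z where "(k, z) \<in> E ^^ m" "(z, l) \<in> E" by auto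
  then show ?case using Suc.IH[of z] by (auto simp: E_def)
qed simp

text \<open>Irreducibility only forbids \<tau>-stable decompositions. The path is \<tau>-stable,
  hence so is the set of nodes reachable from it.\<close>

lemma connected: "\<exists>m. \<exists>q\<in>P. (q, k) \<in> E ^^ m"
proof -
  let ?J = "{k. \<exists>m. \<exists>q\<in>P. (q, k) \<in> E ^^ m}"
  have i0: "i0 \<in> P" using p_0 len in_P[of i0] by (metis less_le_trans pos2)
  have "?J = UNIV"
  proof (rule irreducible[unfolded irreducible_diagram_def, rule_format], intro conjI ballI)
    have "i0 \<in> ?J" using i0 by (auto intro!: exI[of _ 0])
    then show "?J \<noteq> {}" by blast
    show "\<tau> ` ?J \<subseteq> ?J" using E_tau tau_P by blast
    fix k l assume k: "k \<in> ?J" and l: "l \<in> - ?J"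
    show "a k l = 0"
    proof (rule ccontr)
      assume "a k l \<noteq> 0"
      moreover have "k \<noteq> l" using k l by auto
      ultimately have "(k, l) \<in> E" by (simp add: E_def adj_def)
      then have "l \<in> ?J" using k by (blast intro: relpow_Suc_I)
      then show False using l by simp
    qed
  qed
  then show ?thesis by blast
qed

text \<open>Graph distance from the path, which is the height in the forest; \<tau> preserves
  it.\<close>

definition dep where "dep k = (LEAST m. \<exists>q\<in>P. (q, k) \<in> E ^^ m)"

lemma dep_ex: "\<exists>q\<in>P. (q, k) \<in> E ^^ dep k"
  unfolding dep_def using connected by (rule LeastI_ex)

lemma dep_le: "q \<in> P \<Longrightarrow> (q, k) \<in> E ^^ m \<Longrightarrow> dep k \<le> m"
  unfolding dep_def by (rule Least_le) blast

lemma dep_0 [simp]: "dep k = 0 \<longleftrightarrow> k \<in> P"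
  using dep_ex[of k] dep_le[of k k 0] by auto

lemma dep_adj: "adj k l \<Longrightarrow> dep l \<le> Suc (dep k)"
proof -
  assume kl: "adj k l"
  obtain q where "q \<in> P" "(q, k) \<in> E ^^ dep k" using dep_ex by blast
  then show ?thesis using kl by (intro dep_le[of q]) (auto simp: E_def)
qed

lemma dep_tau [simp]: "dep (\<tau> k) = dep k"
proof -
  have "dep (\<tau> k) \<le> dep k" for k
    using dep_ex[of k] E_tau tau_P by (meson dep_le)
  from this[of k] this[of "\<tau> k"] show ?thesis by simp
qed

lemma parent_ex: "k \<notin> P \<Longrightarrow> \<exists>l. adj k l \<and> Suc (dep l) = dep k"
proof -
  assume k: "k \<notin> P"
  obtain q where q: "q \<in> P" "(q, k) \<in> E ^^ dep k" using dep_ex by blast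
  obtain m where m: "dep k = Suc m" using k dep_0[of k] by (cases "dep k") auto
  then obtain l where l: "(q, l) \<in> E ^^ m" "adj l k" using q(2) by (auto simp: E_def)
  then have "dep l \<le> m" using q(1) dep_le by blast
  moreover have "dep k \<le> Suc (dep l)" using l(2) by (rule dep_adj)
  ultimately show ?thesis using m l(2) adj_sym by (intro exI[of _ l]) auto
qed

definition par where "par k = (SOME l. adj k l \<and> Suc (dep l) = dep k)"

lemma par: "k \<notin> P \<Longrightarrow> adj k (par k)" "k \<notin> P \<Longrightarrow> Suc (dep (par k)) = dep k"
  using someI_ex[OF parent_ex[of k]] unfolding par_def by blast+

text \<open>The path and the edges to the parents already exhaust the number of edges of a forest.\<close>

lemma edge_cases:
  assumes "adj k l"
  shows "k \<in> P \<and> l \<in> P \<or> k \<notin> P \<and> l = par k \<or> l \<notin> P \<and> k = par l"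
proof (rule ccontr)
  assume neg: "\<not> ?thesis"
  let ?O = "- P" and ?n = "length p - 1"
  \<comment> \<open>Ordered edges: between nodes outside P and their parents (T1, T2), along the
    path (T3, T4), and the supposed additional edge (T5). With n nodes these are 2(n - |P|) + 2(|P|
    - 1) + 2 = 2n pairs, too many for \<open>edge_count\<close>.\<close>
  define T1 where "T1 = (\<lambda>k. (k, par k)) ` ?O"
  define T2 where "T2 = (\<lambda>k. (par k, k)) ` ?O"
  define T3 where "T3 = (\<lambda>m. (p ! m, p ! Suc m)) ` {..<?n}"
  define T4 where "T4 = (\<lambda>m. (p ! Suc m, p ! m)) ` {..<?n}"
  define T5 where "T5 = {(k, l), (l, k)}"
  have kl: "k \<noteq> l" using assms by (simp add: adj_def)
  have c: "card T1 = card ?O" "card T2 = card ?O" "card T3 = ?n" "card T4 = ?n" "card T5 = 2"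
    unfolding T1_def T2_def T3_def T4_def T5_def using kl
    by (auto simp: card_image inj_on_def p_inj)
  have fin: "finite T1" "finite T2" "finite T3" "finite T4" "finite T5"
    unfolding T1_def T2_def T3_def T4_def T5_def by auto
  have pp: "p ! m \<in> P" "p ! Suc m \<in> P" if "m < ?n" for m using that by auto
  have d12: "T1 \<inter> T2 = {}"
  proof -
    have False if "x \<notin> P" "y \<notin> P" "x = par y" "par x = y" for x y
      using par(2)[OF that(1)] par(2)[OF that(2)] that(3,4) by simp
    then show ?thesis unfolding T1_def T2_def by auto
  qed
  have d3: "(T1 \<union> T2) \<inter> T3 = {}" "(T1 \<union> T2) \<inter> T4 = {}"
    unfolding T1_def T2_def T3_def T4_def using pp by force+
  have d34: "T3 \<inter> T4 = {}"
    unfolding T3_def T4_def by (auto simp: p_inj)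
  have d5: "(T1 \<union> T2 \<union> T3 \<union> T4) \<inter> T5 = {}"
    using neg pp unfolding T1_def T2_def T3_def T4_def T5_def by auto
  have "card (T1 \<union> T2 \<union> T3 \<union> T4 \<union> T5) = 2 * card ?O + 2 * ?n + 2"
    using c fin d12 d3 d34 d5
    by (subst card_Un_disjoint; (simp add: Int_Un_distrib2)?)+
  moreover have "card ?O + length p = card (UNIV :: 'i set)"
    using card_Un_disjoint[of "- P" P] distinct_card[OF dist] by simp
  moreover have "T1 \<union> T2 \<union> T3 \<union> T4 \<union> T5 \<subseteq> {(k, l). adj k l}"
    unfolding T1_def T2_def T3_def T4_def T5_def using assms par(1) adj_sym
    by (auto simp: adj_p)
  then have "card (T1 \<union> T2 \<union> T3 \<union> T4 \<union> T5) \<le> card {(k, l). adj k l}"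
    by (rule card_mono[rotated]) (rule finite_subset[of _ UNIV], simp_all)
  ultimately show False using edge_count len by simp
qed

lemma par_unique: "k \<notin> P \<Longrightarrow> adj k l \<Longrightarrow> dep l < dep k \<Longrightarrow> l = par k"
  using edge_cases[of k l] par(2)[of l] dep_0[of l] by (metis Suc_n_not_le_n less_imp_le_nat not_less_zero)

lemma dep_neq: "k \<notin> P \<Longrightarrow> adj k l \<Longrightarrow> dep l \<noteq> dep k"
  using edge_cases[of k l] par(2)[of l] par(2)[of k] by (metis n_not_Suc_n)

lemma par_tau: "k \<notin> P \<Longrightarrow> par (\<tau> k) = \<tau> (par k)"
  using par_unique[of "\<tau> k" "\<tau> (par k)"] par[of k] by simp

text \<open>Edges outside the path change the depth, while \<tau> preserves it.\<close>

lemma not_adj_tau: "k \<notin> P \<Longrightarrow> \<not> adj k (\<tau> k)"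
  using dep_neq[of k "\<tau> k"] dep_tau[of k] by blast

lemma fixed_ancestor:
  assumes "k \<notin> P" "\<tau> k = k" "0 < d" "d \<le> dep k"
  obtains l where "l \<notin> P" "\<tau> l = l" "dep l = d"
proof -
  have "\<exists>l. l \<notin> P \<and> \<tau> l = l \<and> dep l = d"
    using assms
  proof (induction "dep k" arbitrary: k)
    case 0
    then show ?case by simp
  next
    case (Suc m)
    show ?case
    proof (cases "d = dep k")
      case True
      then show ?thesis using Suc.prems by blast
    next
      case False
      have m: "dep (par k) = m" using par(2)[OF Suc.prems(1)] Suc.hyps(2) by simp
      then have "par k \<notin> P" using dep_0[of "par k"] False Suc by simp
      moreover have "\<tau> (par k) = par k" using par_tau[OF Suc.prems(1)] Suc.prems(2) by simp
      ultimately show ?thesis using Suc.hyps(1)[of "par k"] m False Suc by simp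
    qed
  qed
  then show thesis using that by blast
qed

text \<open>The parent of a \<tau>-fixed node is \<tau>-fixed, and \<tau> reverses the path, so the
  parent is the midpoint. The number of nodes of the path is therefore odd and at least 3, and the
  midpoint is interior.\<close>

lemma fixed_parent_in_P:
  assumes "k \<notin> P" "\<tau> k = k" "dep k = 1"
  obtains c where "length p = 2 * c + 1" "1 \<le> c" "par k = p ! c"
proof -
  have "par k \<in> P" using par(2)[OF assms(1)] assms(3) dep_0[of "par k"] by simp
  then obtain c where c: "c < length p" "par k = p ! c" unfolding in_P by blast
  have "\<tau> (par k) = par k" using par_tau[OF assms(1)] assms(2) by simp
  then have "p ! (length p - 1 - c) = p ! c" using tau_p[OF c(1)] c(2) by simp
  then have "length p - 1 - c = c" using c(1) by (subst (asm) p_inj) auto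
  then show thesis using that[of c] c len by linarith
qed

text \<open>A node t of least depth in the black component of k is an ancestor of every node of that
  component, hence the only one of its depth. As \<tau> preserves the component and the depth, it
  fixes t. At depth 1 the parent of t would be the black midpoint of the path, but P contains all
  black neighbours of its black nodes.\<close>

lemma black_fixed:
  assumes k: "k \<notin> P" "k \<in> bl"
  obtains t where "t \<notin> P" "t \<in> bl" "\<tau> t = t" "2 \<le> dep t"
proof -
  let ?C = "{l. (k, l) \<in> black_edges\<^sup>*}"
  have k': "k \<in> ?C" by simp
  obtain t where t: "t \<in> ?C" and min: "\<And>l. l \<in> ?C \<Longrightarrow> dep t \<le> dep l"
    using ex_has_least_nat[of "\<lambda>l. l \<in> ?C" k dep] k' by blast
  have C: "l \<in> bl \<and> l \<notin> P" if "(k, l) \<in> black_edges\<^sup>*" for l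
    using that
  proof induction
    case (step y z)
    then show ?case using P_black_closed[of z y] by (auto simp: adj_def cartan_zero_sym[of y z])
  qed (use k in simp)
  have "sym black_edges" by (auto simp: sym_def cartan_zero_sym)
  then have "sym (black_edges\<^sup>*)" by (rule sym_rtrancl)
  then have tk: "(t, k) \<in> black_edges\<^sup>*" using t by (auto dest: symD)
  \<comment> \<open>Along black edges from t, a step to a child lengthens the chain of ancestors and
    a step to the parent shortens it; minimality of \<open>dep t\<close> prevents a step above
    t.\<close>
  have anc: "\<exists>m. (par ^^ m) l = t \<and> dep l = dep t + m" if "(t, l) \<in> black_edges\<^sup>*" for l
    using that
  proof induction
    case base
    show ?case by (intro exI[of _ 0]) simp
  next
    case (step y z)
    then obtain m where m: "(par ^^ m) y = t" "dep y = dep t + m" by blast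
    have yz: "y \<notin> P" "z \<notin> P" "adj y z" "z \<in> ?C"
      using C[of y] C[of z] step t by (auto simp: adj_def intro: rtrancl_trans rtrancl_into_rtrancl)
    from edge_cases[OF yz(3)] yz(1) consider "z = par y" | "y = par z" by blast
    then show ?case
    proof cases
      case 1
      then have dz: "Suc (dep z) = dep y" using par(2)[OF yz(1)] by simp
      then obtain m' where m': "m = Suc m'" using m(2) min[OF yz(4)] by (cases m) auto
      then show ?thesis using m 1 dz by (intro exI[of _ m']) (simp add: funpow_Suc_right del: funpow.simps(2))
    next
      case 2
      then show ?thesis using m par(2)[OF yz(2)]
        by (intro exI[of _ "Suc m"]) (simp add: funpow_Suc_right del: funpow.simps(2))
    qed
  qed
  have "(k, t) \<in> black_edges\<^sup>*" using t by (rule CollectD)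
  from C[OF this] have "t \<in> bl" "t \<notin> P" by (rule conjunct1, rule conjunct2)
  have "\<tau> t = t"
  proof -
    obtain m where m: "(par ^^ m) (\<tau> t) = t" "dep (\<tau> t) = dep t + m"
      using anc[OF tau_black_component[OF \<open>t \<in> bl\<close>]] by blast
    from m(2) have "m = 0" by simp
    with m(1) show ?thesis by simp
  qed
  moreover have "dep t \<noteq> 1"
  proof
    assume "dep t = 1"
    then obtain c where c: "length p = 2 * c + 1" "1 \<le> c" "par t = p ! c"
      using fixed_parent_in_P \<open>t \<notin> P\<close> calculation by blast
    then have "p ! c \<in> bl" by (intro interior) auto
    moreover have "adj (p ! c) t" using par(1)[OF \<open>t \<notin> P\<close>] c(3) adj_sym by simp
    ultimately show False using P_black_closed[of "p ! c" t] \<open>t \<in> bl\<close> \<open>t \<notin> P\<close> c(1) by simp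
  qed
  moreover have "dep t \<noteq> 0" using \<open>t \<notin> P\<close> by simp
  ultimately have "\<tau> t = t" "2 \<le> dep t" by linarith+
  then show thesis using that \<open>t \<in> bl\<close> \<open>t \<notin> P\<close> by blast
qed

text \<open>\<tau> is only known to preserve the Cartan matrix, and the form could be scaled
  differently on components exchanged by \<tau>. On the simply laced path all norms agree; from
  there the equality spreads along edges, since \<open>half_norm k * a k l\<close> is
  symmetric.\<close>

lemma half_norm_tau: "half_norm (\<tau> k) = half_norm k"
proof -
  let ?J = "{k. half_norm (\<tau> k) = half_norm k}"
  have d0: "half_norm (p ! m) = half_norm (p ! 0)" if "m < length p" for m
    using that
  proof (induction m)
    case (Suc m)
    then show ?case using half_norm_sym[of "p ! m" "p ! Suc m"] by (simp add: cartan_p)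
  qed simp
  have "?J = UNIV"
  proof (rule irreducible[unfolded irreducible_diagram_def, rule_format], intro conjI ballI)
    have "i0 \<in> ?J" using d0[of "length p - 1"] len p_0 p_last by simp
    then show "?J \<noteq> {}" by blast
    show "\<tau> ` ?J \<subseteq> ?J" by auto
    fix k l assume k: "k \<in> ?J" and l: "l \<in> - ?J"
    show "a k l = 0"
    proof (rule ccontr)
      assume "a k l \<noteq> 0"
      then have "a l k \<noteq> 0" using cartan_zero_sym[of k l] by simp
      moreover have "half_norm (\<tau> l) * a l k = half_norm l * a l k"
        using half_norm_sym[of "\<tau> k" "\<tau> l"] unfolding cartan_tau CollectD[OF k] half_norm_sym[of k l] by (rule sym)
      ultimately have "half_norm (\<tau> l) = half_norm l" using mult_right_cancel by blast
      then show False using l by simp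
    qed
  qed
  then show ?thesis by blast
qed

end

context satake_pair
begin

lemma even_two_rho_check:
  assumes "j \<notin> bl" "\<tau> j = j"
  shows "even (pair (two_rho_check D) (\<alpha> j))"
proof -
  have "of_int (pair (two_rho_check D) (\<alpha> j)) / 2 \<in> (\<int> :: rat set)"
    using satake assms unfolding satake_diagram_def by (metis ComplI)
  then obtain n where "of_int (pair (two_rho_check D) (\<alpha> j)) / 2 = (of_int n :: rat)"
    by (auto elim: Ints_cases)
  then have "(of_int (pair (two_rho_check D) (\<alpha> j)) :: rat) = of_int (2 * n)"
    by (simp add: field_simps)
  then have "pair (two_rho_check D) (\<alpha> j) = 2 * n" by (simp only: of_int_eq_iff)
  then show ?thesis by simp
qed

end

section \<open>Neighbours of the interior nodes of the path\<close>

context aiv_pair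
begin

text \<open>Otherwise there would be an affine subdiagram of type \<open>D\<close>.\<close>

lemma interior_nbr_fixed_aux:
  assumes j: "\<tau> j \<noteq> j" "j \<notin> P" and b: "0 < b" "b \<le> length p - 1 - b" "adj (p ! b) j"
  shows False
proof -
  define c where "c = length p - 1 - b"
  have c: "b \<le> c" "Suc c < length p" "b < length p" "c < length p" using b by (auto simp: c_def)
  have tj: "\<tau> j \<notin> P" "adj (p ! c) (\<tau> j)"
    using j b(3) tau_p[of b] c adj_tau[of "p ! b" j] by (simp_all add: c_def)
  have P: "p ! e \<noteq> j" "p ! e \<noteq> \<tau> j" if "e < length p" for e
    using that j(2) by (metis nth_mem tau_P_iff)+
  \<comment> \<open>Marks of the affine diagram: 1 on the four leaves j, \<tau>(j),
    \<open>p ! (b - 1)\<close> and \<open>p ! Suc c\<close>, and 2 on the segment from b to its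
    mirror image \<open>c\<close>. For b = c a single centre carries all four leaves.\<close>
  define x where "x k = (if k = j \<or> k = \<tau> j then 1 else if \<exists>e. k = p ! e \<and> b \<le> e \<and> e \<le> c then 2
      else if k = p ! (b - 1) \<or> k = p ! Suc c then 1 else 0 :: nat)" for k
  have xj: "x j = 1" "x (\<tau> j) = 1" by (simp_all add: x_def)
  have x2: "x (p ! e) = 2" if "b \<le> e" "e \<le> c" for e
    using that c P[of e] by (auto simp: x_def)
  have x1: "x (p ! (b - 1)) = 1" "x (p ! Suc c) = 1"
  proof -
    have "p ! (b - 1) \<noteq> p ! e" "p ! Suc c \<noteq> p ! e" if "b \<le> e" "e \<le> c" for e
      using that c b(1) by (subst p_inj; simp)+
    then show "x (p ! (b - 1)) = 1" "x (p ! Suc c) = 1"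
      using P[of "b - 1"] P[of "Suc c"] c by (auto simp: x_def)
  qed
  show False
  proof (rule no_affine_adj[of x j])
    fix k assume "x k > 0"
    then consider "k = j" | "k = \<tau> j" | e where "k = p ! e" "b \<le> e" "e \<le> c"
      | "k = p ! (b - 1)" | "k = p ! Suc c"
      unfolding x_def by (auto split: if_splits)
    then show "\<exists>N. (\<forall>l\<in>N. adj k l) \<and> 2 * x k \<le> sum x N"
    proof cases
      case 1
      then show ?thesis using b(3) adj_sym[of j] x2[of b] xj c by (intro exI[of _ "{p ! b}"]) simp
    next
      case 2
      then show ?thesis using tj(2) adj_sym[of "\<tau> j"] x2[of c] xj c by (intro exI[of _ "{p ! c}"]) simp
    next
      case 4
      then show ?thesis using x2[of b] x1 c b(1) by (intro exI[of _ "{p ! b}"]) (simp add: adj_p)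
    next
      case 5
      then show ?thesis using x2[of c] x1 c b(1) by (intro exI[of _ "{p ! c}"]) (simp add: adj_p)
    next
      case 3
      have xk: "x k = 2" using 3 x2 by simp
      consider "b < e" "e < c" | "e = b" "b < c" | "e = c" "b < c" | "e = b" "e = c"
        using 3 by linarith
      then show ?thesis
      proof cases
        case 1
        then have "p ! (e - 1) \<noteq> p ! Suc e" using c by (subst p_inj) auto
        then show ?thesis using 1 3 c x2[of "e - 1"] x2[of "Suc e"] xk
          by (intro exI[of _ "{p ! (e - 1), p ! Suc e}"]) (auto simp: adj_p)
      next
        case 2
        then have "p ! (b - 1) \<noteq> p ! Suc b" using c by (subst p_inj) auto
        then show ?thesis using 2 3 c b x1 x2[of "Suc b"] xk xj P[of "b - 1"] P[of "Suc b"]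
          by (intro exI[of _ "{p ! (b - 1), p ! Suc b, j}"]) (auto simp: adj_p)
      next
        case 3
        then have "p ! (c - 1) \<noteq> p ! Suc c" using c by (subst p_inj) auto
        then show ?thesis using 3 \<open>k = p ! e\<close> c x1 x2[of "c - 1"] xk xj P[of "c - 1"] P[of "Suc c"] tj
          by (intro exI[of _ "{p ! (c - 1), p ! Suc c, \<tau> j}"]) (auto simp: adj_p)
      next
        case 4
        then have "p ! (b - 1) \<noteq> p ! Suc c" using c by (subst p_inj) auto
        then show ?thesis using 4 3 c b x1 xk xj P[of "b - 1"] P[of "Suc c"] tj j
          by (intro exI[of _ "{p ! (b - 1), p ! Suc c, j, \<tau> j}"]) (auto simp: adj_p)
      qed
    qed
  qed (simp add: xj)
qed

text \<open>Passing from j to \<tau>(j) moves b to its mirror image, so b may be taken in the left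
  half of the path.\<close>

lemma interior_nbr_fixed:
  assumes j: "j \<notin> P" and b: "0 < b" "b < length p - 1" "adj (p ! b) j"
  shows "\<tau> j = j"
proof (rule ccontr)
  assume tj: "\<tau> j \<noteq> j"
  show False
  proof (cases "b \<le> length p - 1 - b")
    case True
    then show ?thesis using interior_nbr_fixed_aux[OF tj j] b by blast
  next
    case False
    have "adj (p ! (length p - 1 - b)) (\<tau> j)"
      using b adj_tau[of "p ! b" j] tau_p[of b] by simp
    moreover have "\<tau> (\<tau> j) \<noteq> \<tau> j" "\<tau> j \<notin> P" using tj j by (simp_all add: eq_commute)
    moreover have "0 < length p - 1 - b" "length p - 1 - b \<le> length p - 1 - (length p - 1 - b)"
      using b False by auto
    ultimately show ?thesis by (intro interior_nbr_fixed_aux[of "\<tau> j" "length p - 1 - b"])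
  qed
qed

end

text \<open>The case where some vertex far from the path is fixed by \<open>\<tau>\<close>; the diagram then turns out to be
  of type \<open>D\<close>.\<close>

locale deep_pair = aiv_pair D i0 p
  for D :: "('i::finite, 'x::ab_group_add, 'y::ab_group_add) satake_datum" and i0 p +
  fixes c :: nat and u1 u2 :: 'i
  assumes len_c: "length p = 2 * c + 1" "1 \<le> c"
    and u2: "u2 \<notin> P" "tau D u2 = u2" "dep u2 = 2"
    and u1: "par u2 = u1" "par u1 = p ! c"
begin

definition v where "v = p ! c"
definition y where "y = p ! (c - 1)"
definition y' where "y' = p ! Suc c"

lemma u1': "u1 \<notin> P" "dep u1 = 1" "\<tau> u1 = u1" "adj u1 u2" "adj v u1"
proof -
  show 1: "dep u1 = 1" using par(2)[OF u2(1)] u2(3) u1(1) by simp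
  then show 2: "u1 \<notin> P" using dep_0[of u1] by simp
  show "\<tau> u1 = u1" using par_tau[OF u2(1)] u2(2) u1(1) by simp
  show "adj u1 u2" using par(1)[OF u2(1)] u1(1) adj_sym by simp
  show "adj v u1" using par(1)[OF 2] u1(2) adj_sym by (simp add: v_def)
qed

lemma P_facts: "v \<in> P" "y \<in> P" "y' \<in> P" "\<tau> v = v" "\<tau> y = y'" "\<tau> y' = y" "y \<noteq> y'" "y \<noteq> v" "y' \<noteq> v"
  "adj v y" "adj v y'" "adj y v" "adj y' v" "\<not> adj y y'" "v \<in> bl"
  "a y v = -1" "a v y = -1" "a y' v = -1" "a v y' = -1"
  using len_c unfolding v_def y_def y'_def by (auto simp: adj_p p_inj tau_p cartan_p intro!: interior)

lemma dep_P: "dep v = 0" "dep y = 0" "dep y' = 0"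
  using P_facts by simp_all

text \<open>Otherwise there would be an affine subdiagram of type \<open>E\<^sub>6\<close>.\<close>

lemma y_leaf: "adj y z \<Longrightarrow> z = v"
proof (rule ccontr)
  assume yz: "adj y z" and zv: "z \<noteq> v"
  have yz': "adj y' (\<tau> z)" using yz adj_tau[of y z] P_facts by simp
  have dz: "dep z \<le> 1" using dep_adj[OF yz] dep_P by simp
  have par_z: "par z = y" if "z \<notin> P"
  proof -
    have "0 < dep z" using that dep_0 neq0_conv by blast
    then show ?thesis using par_unique[OF that, of y] yz adj_sym[of y z] dep_P(2) by simp
  qed
  have par_tz: "par (\<tau> z) = y'" if "z \<notin> P"
    using par_tau[OF that] par_z[OF that] P_facts by simp
  have z: "z \<noteq> y" "z \<noteq> y'" "z \<noteq> u1" "z \<noteq> u2"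
    using yz P_facts par_z u1(2)[folded v_def] u1' u2 dz by (auto simp: adj_def)
  have zt: "z \<noteq> \<tau> z"
  proof
    assume zz: "z = \<tau> z"
    show False
    proof (cases "z \<in> P")
      case True
      then obtain e where e: "e < length p" "z = p ! e" unfolding in_P by blast
      then have "p ! e = p ! (length p - 1 - e)" using zz tau_p[OF e(1)] by metis
      then have "e = length p - 1 - e" using e(1) by (subst (asm) p_inj) auto
      then have "e = c" using len_c by simp
      then show False using e zv by (simp add: v_def)
    next
      case False
      then show False using par_z par_tz zz P_facts by simp
    qed
  qed
  have tz: "\<tau> z \<noteq> y" "\<tau> z \<noteq> y'" "\<tau> z \<noteq> u1" "\<tau> z \<noteq> u2" "\<tau> z \<noteq> v"
    using z zv P_facts u1'(3) u2(2) by (metis tau_tau)+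
  have u: "u1 \<noteq> y" "u1 \<noteq> y'" "u1 \<noteq> v" "u2 \<noteq> y" "u2 \<noteq> y'" "u2 \<noteq> v" "u1 \<noteq> u2"
    using u1' u2 P_facts by auto
  \<comment> \<open>Marks of affine E_6: 3 at the midpoint v, then 2 and 1 along the arms y, z and
    y', \<tau>(z) and u1, u2.\<close>
  define x where "x k = (if k \<in> {z, \<tau> z, u2} then 1 else if k \<in> {y, y', u1} then 2
      else if k = v then 3 else 0 :: nat)" for k
  have x: "x z = 1" "x (\<tau> z) = 1" "x u2 = 1" "x y = 2" "x y' = 2" "x u1 = 2" "x v = 3"
    using z tz u zv P_facts by (auto simp: x_def)
  show False
  proof (rule no_affine_adj[of x v])
    fix k assume "x k > 0"
    then consider "k = z" | "k = \<tau> z" | "k = u2" | "k = y" | "k = y'" | "k = u1" | "k = v"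
      unfolding x_def by (auto split: if_splits)
    then show "\<exists>N. (\<forall>l\<in>N. adj k l) \<and> 2 * x k \<le> sum x N"
    proof cases
      case 1
      then show ?thesis using yz adj_sym[of z y] by (intro exI[of _ "{y}"]) (simp add: x)
    next
      case 2
      then show ?thesis using yz' adj_sym[of "\<tau> z" y'] by (intro exI[of _ "{y'}"]) (simp add: x)
    next
      case 3
      then show ?thesis using u1'(4) adj_sym[of u2 u1] by (intro exI[of _ "{u1}"]) (simp add: x)
    next
      case 4
      then show ?thesis using yz P_facts zv by (intro exI[of _ "{v, z}"]) (simp add: x)
    next
      case 5
      then show ?thesis using yz' P_facts tz by (intro exI[of _ "{v, \<tau> z}"]) (simp add: x)
    next
      case 6
      then show ?thesis using u1' u adj_sym[of u1 v] by (intro exI[of _ "{v, u2}"]) (simp add: x)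
    next
      case 7
      then show ?thesis using u1' u P_facts by (intro exI[of _ "{y, y', u1}"]) (simp add: x)
    qed
  qed (simp add: x)
qed

lemma y'_leaf: "adj y' z \<Longrightarrow> z = v"
  using y_leaf[of "\<tau> z"] adj_tau[of y' z] P_facts by (metis tau_tau)

lemma c_eq: "c = 1"
proof (rule ccontr)
  assume "c \<noteq> 1"
  then have "adj y (p ! (c - 2))" "p ! (c - 2) \<noteq> v"
    using len_c unfolding y_def v_def by (subst adj_p p_inj; auto)+
  then show False using y_leaf by blast
qed

lemma P_cases: "k \<in> P \<longleftrightarrow> k = y \<or> k = v \<or> k = y'"
proof -
  have "length p = Suc (Suc (Suc 0))" using len_c c_eq by simp
  then have "k \<in> P \<longleftrightarrow> (\<exists>m \<in> {0, Suc 0, Suc (Suc 0)}. k = p ! m)" unfolding in_P by (auto simp: less_Suc_eq)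
  then show ?thesis unfolding v_def y_def y'_def by (simp add: c_eq)
qed

lemma y_white: "y \<notin> bl" "y' \<notin> bl"
  using white_i0 p_0 p_last len_c unfolding y_def y'_def by (simp_all add: c_eq numeral_2_eq_2)

lemma par_v: "k \<notin> P \<Longrightarrow> dep k = 1 \<Longrightarrow> par k = v"
proof -
  assume k: "k \<notin> P" "dep k = 1"
  then have "par k \<in> P" using par(2)[OF k(1)] dep_0[of "par k"] by simp
  moreover have "adj (par k) k" using par(1)[OF k(1)] adj_sym by simp
  ultimately show ?thesis using y_leaf[of k] y'_leaf[of k] k(1) P_facts by (auto simp: P_cases)
qed

lemma par_notin_P: "k \<notin> P \<Longrightarrow> dep k = Suc (Suc d) \<Longrightarrow> par k \<notin> P \<and> dep (par k) = Suc d"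
  using par(2)[of k] dep_0[of "par k"] by auto

lemma level_ex:
  assumes "k \<notin> P" "0 < d" "d \<le> dep k"
  shows "\<exists>l. l \<notin> P \<and> dep l = d"
  using assms
proof (induction "dep k" arbitrary: k)
  case (Suc m)
  show ?case
  proof (cases "d = dep k")
    case False
    then obtain m' where "m = Suc m'" using Suc by (cases m) auto
    then show ?thesis using Suc.hyps(1)[of "par k"] Suc.hyps(2) Suc.prems False par_notin_P[of k m'] by auto
  qed (use Suc.prems in blast)
qed simp

text \<open>An affine subdiagram of type \<open>D\<close> or \<open>B\<close> or a twisted version, depending on the tail \<open>S\<close>.\<close>

lemma no_tail:
  fixes t :: "'i \<Rightarrow> nat"
  assumes uniq: "\<And>k l. k \<notin> P \<Longrightarrow> l \<notin> P \<Longrightarrow> dep k = dep l \<Longrightarrow> dep k \<le> d \<Longrightarrow> k = l"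
    and w: "d = 0 \<and> w = v \<or> 0 < d \<and> w \<notin> P \<and> dep w = d"
    and S: "\<And>k. k \<in> S \<Longrightarrow> k \<notin> P \<and> dep k = Suc d \<and> adj w k"
    and bal1: "(\<Sum>k\<in>S. - a w k * int (t k)) \<ge> 2"
    and bal2: "\<And>k. k \<in> S \<Longrightarrow> - a k w \<ge> int (t k)"
  shows False
proof -
  \<comment> \<open>The ends y and y' carry 1, the chain from v to \<open>w\<close> carries 2, and
    the tail \<open>S\<close> carries \<open>t\<close>. The hypotheses \<open>bal1\<close> and
    \<open>bal2\<close> are the balance at \<open>w\<close> and on \<open>S\<close>; inside the
    chain each node sees two neighbours of mark 2, and v may see y, y' and one neighbour of mark
    2.\<close>
  define x where "x k = (if k \<in> S then t k else if k \<in> {y, y'} then 1 else if k = v then 2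
      else if k \<notin> P \<and> dep k \<le> d then 2 else 0)" for k
  have SP: "k \<notin> S" if "k \<in> P" for k using S[of k] that by blast
  have xy: "x y = 1" "x y' = 1" "x v = 2" using P_facts SP by (auto simp: x_def)
  have xS: "x k = t k" if "k \<in> S" for k using that by (simp add: x_def)
  have xd: "x k = 2" if "k \<notin> P" "dep k \<le> d" for k
    using that S[of k] P_facts by (auto simp: x_def)
  have xw: "x w = 2" using w xy xd by auto
  have xpar: "x (par k) = 2" if "k \<notin> P" "dep k \<le> Suc d" for k
  proof (cases "dep k = 1")
    case False
    moreover have "dep k \<noteq> 0" using that(1) by simp
    ultimately have "dep k = Suc (Suc (dep k - 2))" by linarith
    then obtain e where e: "dep k = Suc (Suc e)" by blast
    show ?thesis using par_notin_P[OF that(1) e] xd[of "par k"] that(2) e by simp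
  qed (use par_v that xy in simp)
  have level: "\<exists>l. l \<notin> P \<and> dep l = e" if "0 < e" "e \<le> d" for e
    using level_ex[of w e] that w by auto
  have sumS: "(\<Sum>k\<in>S. - a w k * int (x k)) \<ge> 2" using bal1 xS by simp
  have finS: "finite S" by (rule finite_subset[of _ UNIV]) simp_all
  have two: "- a k l * int (x l) \<ge> 2" if "adj k l" "x l = 2" for k l
    using adj_cartan[OF that(1)] that(2) by simp
  show False
  proof (rule no_affine[of x v])
    fix k assume xk: "x k > 0"
    show "\<exists>N. k \<notin> N \<and> 2 * int (x k) \<le> (\<Sum>l\<in>N. - a k l * int (x l))"
    proof (cases "k \<in> S")
      case True
      then show ?thesis using bal2[of k] xw xS[of k] S[of k]
        by (intro exI[of _ "{w}"]) (auto simp: adj_def)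
    next
      case kS: False
      consider "k = y" | "k = y'" | "k = v" "d = 0" | "k = v" "d > 0"
        | "k \<notin> P" "dep k < d" | "k \<notin> P" "dep k = d"
        using xk kS unfolding x_def by (auto simp: le_less split: if_splits)
      then show ?thesis
      proof cases
        case 1
        then show ?thesis using xy P_facts by (intro exI[of _ "{v}"]) simp
      next
        case 2
        then show ?thesis using xy P_facts by (intro exI[of _ "{v}"]) simp
      next
        case 3
        then have "w = v" using w by simp
        have "(\<Sum>l\<in>{y, y'} \<union> S. - a v l * int (x l))
            = (\<Sum>l\<in>{y, y'}. - a v l * int (x l)) + (\<Sum>l\<in>S. - a v l * int (x l))"
          by (rule sum.union_disjoint) (use finS SP P_facts in auto)
        also have "(\<Sum>l\<in>{y, y'}. - a v l * int (x l)) = 2" using xy P_facts by simp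
        finally show ?thesis using 3 sumS \<open>w = v\<close> xy P_facts SP[of v]
          by (intro exI[of _ "{y, y'} \<union> S"]) auto
      next
        case 4
        then obtain l where l: "l \<notin> P" "dep l = 1" using level[of 1] by auto
        then have "adj v l" "x l = 2" using par[of l] par_v[of l] adj_sym xd[of l] 4 by auto
        moreover have "l \<noteq> y" "l \<noteq> y'" "l \<noteq> v" using l(1) P_facts by auto
        ultimately show ?thesis using two[of v l] 4 xy P_facts
          by (intro exI[of _ "{y, y', l}"]) auto
      next
        case 5
        then obtain l where l: "l \<notin> P" "dep l = Suc (dep k)" using level[of "Suc (dep k)"] by auto
        obtain e where e: "dep k = Suc e" using 5 dep_0[of k] by (cases "dep k") auto
        have "par l = k"
          using par_notin_P[of l e] l e 5 uniq[of "par l" k] by simp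
        then have kl: "adj k l" "x l = 2" using par(1)[OF l(1)] adj_sym xd[of l] l 5 by auto
        have kp: "adj k (par k)" "x (par k) = 2" using par(1) xpar[of k] 5 by auto
        have "par k \<noteq> l" using par(2)[OF 5(1)] l(2) by auto
        then show ?thesis using two[OF kl] two[OF kp] kl kp xd[of k] 5
          by (intro exI[of _ "{par k, l}"]) (auto simp: adj_def)
      next
        case 6
        then have kw: "k = w" "d > 0" using w uniq[of k w] dep_0[of k] P_facts by auto
        have kp: "adj k (par k)" "x (par k) = 2" using par(1) xpar[of k] 6 by auto
        have pS: "par k \<notin> S" using S[of "par k"] par(2)[OF 6(1)] 6(2) by auto
        have "(\<Sum>l\<in>insert (par k) S. - a k l * int (x l))
            = - a k (par k) * int (x (par k)) + (\<Sum>l\<in>S. - a k l * int (x l))"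
          using finS pS by simp
        then show ?thesis using two[OF kp] sumS kw xw kp kS
          by (intro exI[of _ "insert (par k) S"]) (auto simp: adj_def)
      qed
    qed
  qed (simp add: xy)
qed

text \<open>At the first depth where uniqueness fails, the two nodes share a parent, and with mark 1
  each they complete the chain to an affine diagram by \<open>no_tail\<close>.\<close>

lemma dep_inj: "k \<notin> P \<Longrightarrow> l \<notin> P \<Longrightarrow> dep k = dep l \<Longrightarrow> k = l"
proof (induction "dep k" arbitrary: k l rule: less_induct)
  case less
  obtain d where d: "dep k = Suc d" using less.prems(1) dep_0[of k] by (cases "dep k") auto
  have uniq: "k' = l'" if "k' \<notin> P" "l' \<notin> P" "dep k' = dep l'" "dep k' \<le> d" for k' l'
    using less.hyps[of k' l'] that d by simp
  have pkl: "par l = par k \<and> (d = 0 \<and> par k = v \<or> 0 < d \<and> par k \<notin> P \<and> dep (par k) = d)"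
  proof (cases d)
    case 0
    then show ?thesis using par_v[of k] par_v[of l] less.prems d by simp
  next
    case (Suc e)
    then show ?thesis using par_notin_P[of k e] par_notin_P[of l e] less.prems d uniq[of "par l" "par k"] by simp
  qed
  show ?case
  proof (rule ccontr)
    assume "k \<noteq> l"
    have kl: "adj (par k) k" "adj (par k) l" "adj k (par k)" "adj l (par k)"
      using par(1)[OF less.prems(1)] par(1)[OF less.prems(2)] pkl adj_sym by auto
    note ac = kl[THEN adj_cartan]
    show False
    proof (rule no_tail[of d "par k" "{k, l}" "\<lambda>_. 1"])
      show "2 \<le> (\<Sum>m\<in>{k, l}. - a (par k) m * int 1)" using ac \<open>k \<noteq> l\<close> by simp
    qed (use uniq pkl less.prems d kl ac in auto)
  qed
qed

text \<open>A multiple bond would complete the chain below it to a forbidden tail. The mark of k is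
  1 if the entry \<open>a (par k) k\<close> is below -1, and 2 if it is the opposite entry.\<close>

lemma simple_bonds:
  assumes k: "k \<notin> P"
  shows "a k (par k) = -1 \<and> a (par k) k = -1"
proof -
  obtain d where d: "dep k = Suc d" using k dep_0[of k] by (cases "dep k") auto
  have pk: "d = 0 \<and> par k = v \<or> 0 < d \<and> par k \<notin> P \<and> dep (par k) = d"
    using par_v[of k] par_notin_P[of k "d - 1"] k d by (cases d) auto
  have adj: "adj (par k) k" "adj k (par k)" using par(1)[OF k] adj_sym by auto
  note ac = adj[THEN adj_cartan]
  have "a (par k) k \<ge> -1"
  proof (rule ccontr)
    assume "\<not> ?thesis"
    then show False
      by (intro no_tail[of d "par k" "{k}" "\<lambda>_. 1"]) (use dep_inj pk k d adj ac in auto)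
  qed
  moreover have "a k (par k) \<ge> -1"
  proof (rule ccontr)
    assume "\<not> ?thesis"
    then show False
      by (intro no_tail[of d "par k" "{k}" "\<lambda>_. 2"]) (use dep_inj pk k d adj ac in auto)
  qed
  ultimately show ?thesis using ac by simp
qed

text \<open>\<tau> preserves the depth, and outside the path the depth determines the node.\<close>

lemma all_fixed: "k \<notin> P \<Longrightarrow> \<tau> k = k"
  by (rule dep_inj) simp_all

end

section \<open>The tail of the type D diagram and its colouring\<close>

context deep_pair
begin

definition H where "H = Max (range dep)"

lemma dep_le_H: "dep k \<le> H"
  unfolding H_def by (rule Max_ge) auto

text \<open>Depth 0 is shared by y, v and y'; taking v there makes U 0, ..., U H a chain of type A,
  as \<open>cartan_U\<close> states.\<close>

definition U where "U d = (if d = 0 then v else SOME k. k \<notin> P \<and> dep k = d)"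

lemma U_0: "U 0 = v"
  by (simp add: U_def)

lemma U: "0 < d \<Longrightarrow> d \<le> H \<Longrightarrow> U d \<notin> P \<and> dep (U d) = d"
proof -
  assume d: "0 < d" "d \<le> H"
  have "H \<in> range dep" unfolding H_def by (rule Max_in) auto
  then obtain k where k: "dep k = H" by auto
  then have "k \<notin> P" using d dep_0[of k] by auto
  then have "\<exists>l. l \<notin> P \<and> dep l = d" using level_ex[of k d] d k by simp
  from someI_ex[OF this] d(1) show ?thesis unfolding U_def by simp
qed

lemma U_dep: "k \<notin> P \<Longrightarrow> U (dep k) = k"
proof -
  assume k: "k \<notin> P"
  then have "0 < dep k" using dep_0 neq0_conv by blast
  then show ?thesis using U[of "dep k"] dep_le_H[of k] k dep_inj by blast
qed

lemma dep_U: "d \<le> H \<Longrightarrow> dep (U d) = d"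
  using U[of d] dep_P(1) by (cases "d = 0") (auto simp: U_0)

lemma U_inj: "d \<le> H \<Longrightarrow> e \<le> H \<Longrightarrow> U d = U e \<longleftrightarrow> d = e"
  using dep_U by metis

lemma par_U: "Suc d \<le> H \<Longrightarrow> par (U (Suc d)) = U d"
proof (cases "d = 0")
  case True
  assume "Suc d \<le> H"
  then show ?thesis using par_v[of "U (Suc d)"] U[of "Suc d"] True by (simp add: U_0)
next
  case False
  assume d: "Suc d \<le> H"
  from False obtain e where e: "d = Suc e" by (cases d) auto
  have "par (U (Suc d)) \<notin> P" "dep (par (U (Suc d))) = d"
    using par_notin_P[of "U (Suc d)" e] U[of "Suc d"] d e by simp_all
  then show ?thesis using U[of d] d False dep_inj by simp
qed

lemma adj_U: "d \<le> H \<Longrightarrow> e \<le> H \<Longrightarrow> adj (U d) (U e) \<Longrightarrow> d = Suc e \<or> e = Suc d"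
proof -
  assume de: "d \<le> H" "e \<le> H" "adj (U d) (U e)"
  have "\<not> (U d \<in> P \<and> U e \<in> P)"
  proof
    assume P: "U d \<in> P \<and> U e \<in> P"
    then have "d = 0" "e = 0" using U[of d] U[of e] de by auto
    then show False using de(3) by (simp add: adj_def)
  qed
  with edge_cases[OF de(3)] show ?thesis
    using par(2)[of "U d"] par(2)[of "U e"] dep_U[OF de(1)] dep_U[OF de(2)] by auto
qed

lemma cartan_U: "d \<le> H \<Longrightarrow> e \<le> H \<Longrightarrow>
    a (U d) (U e) = (if d = e then 2 else if d = Suc e \<or> e = Suc d then -1 else 0)"
proof -
  have S: "a (U d) (U (Suc d)) = -1 \<and> a (U (Suc d)) (U d) = -1" if "Suc d \<le> H" for d
    using simple_bonds[of "U (Suc d)"] par_U[OF that] U[of "Suc d"] that by simp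
  assume de: "d \<le> H" "e \<le> H"
  consider "d = e" | "d = Suc e" | "e = Suc d" | "d \<noteq> e" "d \<noteq> Suc e" "e \<noteq> Suc d" by blast
  then show ?thesis
  proof cases
    case 4
    then have "\<not> adj (U d) (U e)" using adj_U de by blast
    then show ?thesis using 4 U_inj[OF de] by (simp add: adj_def)
  qed (use S de in auto)
qed

lemma black_U: "l \<in> bl \<Longrightarrow> U (dep l) = l"
  using U_dep[of l] P_cases[of l] y_white dep_P U_0 by metis

lemma tau_U: "d \<le> H \<Longrightarrow> \<tau> (U d) = U d"
  using all_fixed[of "U d"] U[of d] P_facts U_0 by (cases "d = 0") auto

text \<open>The coefficients s + 1 - e are s - b + 2 times the first column of the inverse Cartan
  matrix of type A on the nodes b, ..., s.\<close>

lemma tridiagonal_sum: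
  assumes "2 \<le> b" "b < s" "b \<le> d" "d \<le> s"
  shows "(\<Sum>e\<in>{b..s}. int (s + 1 - e) * (if e = d then 2 else if e = Suc d \<or> d = Suc e then -1 else 0))
    = (if d = b then int (s - b + 2) else 0)"
proof -
  have "(\<Sum>e\<in>{b..s}. int (s + 1 - e) * (if e = d then 2 else if e = Suc d \<or> d = Suc e then -1 else 0))
      = (\<Sum>e\<in>{b..s}. (if e = d then 2 * int (s + 1 - e) else 0)
          - (if e = Suc d then int (s + 1 - e) else 0) - (if e = d - 1 then int (s + 1 - e) else 0))"
    using assms by (intro sum.cong) auto
  also have "\<dots> = 2 * int (s + 1 - d) - (if Suc d \<le> s then int (s + 1 - Suc d) else 0)
      - (if b \<le> d - 1 then int (s + 1 - (d - 1)) else 0)"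
    using assms by (simp add: sum_subtractf)
  also have "\<dots> = (if d = b then int (s - b + 2) else 0)"
    using assms by auto
  finally show ?thesis .
qed

text \<open>A black run \<open>b, \<dots>, s\<close> of length at least two would be of type \<open>A\<close> with \<open>-1\<close> in its Weyl group.
  The Weyl group acts trivially on coweights modulo coroots, a group of order \<open>s - b + 2 > 2\<close>
  generated by the first fundamental coweight, which is \<open>Y\<close> divided by this order.\<close>

lemma no_black_run:
  assumes b: "2 \<le> b" "b < s" "s \<le> H" and run: "\<And>e. b \<le> e \<Longrightarrow> e \<le> s \<Longrightarrow> U e \<in> bl"
    and left: "U (b - 1) \<notin> bl" and right: "s = H \<or> U (Suc s) \<notin> bl"
  shows False
proof -
  define N where "N = int (s - b + 2)"
  define Y where "Y = (\<Sum>e\<in>{b..s}. int (s + 1 - e) *\<^sub>Z \<eta> (U e))"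
  have dvd: "N dvd pair Y (\<alpha> l)" if l: "l \<in> bl" for l
  proof -
    define d where "d = dep l"
    have d: "d \<le> H" "U d = l" using dep_le_H black_U[OF l] by (simp_all add: d_def)
    have "pair Y (\<alpha> l) = (\<Sum>e\<in>{b..s}. int (s + 1 - e) * a (U e) (U d))"
      unfolding Y_def d(2) by (simp add: pair_sum_left pair_coroot_alpha)
    also have "\<dots> = (\<Sum>e\<in>{b..s}. int (s + 1 - e) * (if e = d then 2 else if e = Suc d \<or> d = Suc e then -1 else 0))"
      using cartan_U[of _ d] d b by (intro sum.cong) auto
    finally have eq: "pair Y (\<alpha> l) = \<dots>" .
    consider "b \<le> d" "d \<le> s" | "d < b" | "s < d" by linarith
    then show ?thesis
    proof cases
      case 1
      then show ?thesis unfolding eq tridiagonal_sum[OF b(1,2) 1] by (simp add: N_def)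
    next
      case 2
      then have "d \<noteq> b - 1" using left d l by auto
      then have "pair Y (\<alpha> l) = 0" unfolding eq using 2 by (intro sum.neutral) auto
      then show ?thesis by simp
    next
      case 3
      then have "d \<noteq> Suc s" using right d l by auto
      then have "pair Y (\<alpha> l) = 0" unfolding eq using 3 by (intro sum.neutral) auto
      then show ?thesis by simp
    qed
  qed
  obtain z where z: "actY D (w_black D) Y = Y + N *\<^sub>Z (\<Sum>j\<in>UNIV. z j *\<^sub>Z \<eta> j)"
    using actY_coset_mod[OF w_black_in_lists dvd] by blast
  have "actY D (w_black D) Y = (\<Sum>e\<in>{b..s}. int (s + 1 - e) *\<^sub>Z (- \<eta> (U e)))"
    unfolding Y_def additive.sum[OF additive_actY] additive_zscale[OF additive_actY]
    using actY_black_coroot[OF run] tau_U b(3) by (intro sum.cong) auto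
  also have "\<dots> = - Y" by (simp add: Y_def sum_negf)
  finally have Y0: "Y + Y + N *\<^sub>Z (\<Sum>j\<in>UNIV. z j *\<^sub>Z \<eta> j) = 0"
    unfolding z by (simp add: eq_neg_iff_add_eq_0 ac_simps)
  define f where "f l = (\<Sum>e\<in>{b..s}. if U e = l then int (s + 1 - e) else 0)" for l
  have Yf: "Y = (\<Sum>l\<in>UNIV. f l *\<^sub>Z \<eta> l)"
  proof -
    have "(\<Sum>l\<in>UNIV. f l *\<^sub>Z \<eta> l) = (\<Sum>e\<in>{b..s}. \<Sum>l\<in>UNIV. (if U e = l then int (s + 1 - e) else 0) *\<^sub>Z \<eta> l)"
      unfolding f_def zscale_sum_left by (rule sum.swap)
    also have "\<dots> = (\<Sum>e\<in>{b..s}. \<Sum>l\<in>UNIV. if U e = l then int (s + 1 - e) *\<^sub>Z \<eta> l else 0)"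
      by (intro sum.cong) auto
    also have "\<dots> = Y" by (simp add: Y_def)
    finally show ?thesis by simp
  qed
  have "(\<Sum>l\<in>UNIV. (f l + f l + N * z l) *\<^sub>Z \<eta> l) = 0"
    using Y0 unfolding Yf by (simp only: zscale_add_left sum.distrib zscale_sum_right zscale_zscale)
  \<comment> \<open>The coefficient of Y at the first node is N - 1, so this equation says that 2(N
    - 1) vanishes modulo N, that is, N divides 2.\<close>
  then have "f (U b) + f (U b) + N * z (U b) = 0" by (rule coroot_independent)
  moreover have "f (U b) = N - 1"
  proof -
    have "f (U b) = (\<Sum>e\<in>{b..s}. if e = b then int (s + 1 - e) else 0)"
      unfolding f_def using U_inj b by (intro sum.cong) auto
    then show ?thesis using b by (simp add: N_def)
  qed
  ultimately have "2 = N * (z (U b) + 2)" by (simp add: algebra_simps)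
  then have "N dvd 2" by (rule dvdI)
  then have "N \<le> 2" by (rule zdvd_imp_le) simp
  then show False using b by (simp add: N_def)
qed

text \<open>U 1 is white because P contains the black neighbours of v. A black node at odd depth d
  \<ge> 3 would follow a black one at d - 1 and a white one at d - 2, a run excluded by
  \<open>no_black_run\<close>. A white node at even depth d \<ge> 2 would leave U (d - 2) isolated
  among the black nodes and the only black neighbour of the \<tau>-fixed white node U (d - 1); then
  \<open>two_rho_check\<close> pairs to -1 with its root, against the parity condition.\<close>

lemma black_iff_even: "d \<le> H \<Longrightarrow> U d \<in> bl \<longleftrightarrow> even d"
proof (induction d rule: less_induct)
  case (less d)
  consider "d = 0" | "d = 1" | "odd d" "3 \<le> d" | "even d" "2 \<le> d"
    by (metis One_nat_def Suc_1 Suc_leI antisym_conv2 even_numeral gr0I less_one linorder_le_less_linear not_less_eq_eq numeral_3_eq_3 odd_one)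
  then show ?case
  proof cases
    case 1
    then show ?thesis using P_facts by (simp add: U_0)
  next
    case 2
    then have "U 1 \<notin> P" "adj v (U 1)" using U[of 1] par_U[of 0] par(1)[of "U 1"] less.prems adj_sym
      by (auto simp: U_0)
    then show ?thesis using 2 P_black_closed[of v "U 1"] P_facts by auto
  next
    case 3
    have "U d \<notin> bl"
    proof
      assume Ud: "U d \<in> bl"
      \<comment> \<open>Right ends of black runs starting at depth d - 1; the largest one bounds a
        maximal run.\<close>
      define S where "S = {s. s \<le> H \<and> (\<forall>e. d - 1 \<le> e \<longrightarrow> e \<le> s \<longrightarrow> U e \<in> bl)}"
      have "U (d - 1) \<in> bl" using less.IH[of "d - 1"] less.prems 3 by simp
      then have dS: "d \<in> S" using less.prems Ud 3 unfolding S_def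
        by (auto simp: le_Suc_eq le_diff_conv)
      have fin: "finite S" unfolding S_def by simp
      define s where "s = Max S"
      have sS: "s \<in> S" unfolding s_def using fin dS by (intro Max_in) auto
      have symm: "d \<le> s" unfolding s_def using fin dS by (rule Max_ge)
      have "s = H \<or> U (Suc s) \<notin> bl"
      proof (rule ccontr)
        assume "\<not> ?thesis"
        then have "Suc s \<in> S" using sS unfolding S_def by (auto simp: le_Suc_eq)
        then have "Suc s \<le> s" unfolding s_def using fin by (intro Max_ge)
        then show False by simp
      qed
      moreover have "U (d - 1 - 1) \<notin> bl" using less.IH[of "d - 1 - 1"] less.prems 3 by simp
      ultimately show False using sS symm 3 unfolding S_def
        by (intro no_black_run[of "d - 1" s]) auto
    qed
    then show ?thesis using 3 by simp
  next
    case 4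
    have "U d \<in> bl"
    proof (rule ccontr)
      assume Ud: "U d \<notin> bl"
      let ?b = "d - 2" and ?j = "U (d - 1)"
      have b: "U ?b \<in> bl" "?j \<notin> bl" using less.IH[of ?b] less.IH[of "d - 1"] less.prems 4 by simp_all
      have isol: "\<not> adj (U ?b) l" if l: "l \<in> bl" "l \<noteq> U ?b" for l
      proof
        assume "adj (U ?b) l"
        then have "adj (U ?b) (U (dep l))" using black_U[OF l(1)] by simp
        then have "?b = Suc (dep l) \<or> dep l = Suc ?b"
          using adj_U less.prems dep_le_H[of l] by simp
        moreover have "even ?b" using 4 by simp
        ultimately have "odd (dep l)" "dep l < d" using 4 by (metis even_Suc, linarith)
        then show False using less.IH[of "dep l"] dep_le_H[of l] black_U[OF l(1)] l(1) by simp
      qed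
      obtain z where z: "z (U ?b) = 1" "\<And>l. l \<notin> bl \<Longrightarrow> z l = 0"
          "two_rho_check D = (\<Sum>l\<in>UNIV. z l *\<^sub>Z \<eta> l)"
        using two_rho_check_isolated[OF b(1) isol] by blast
      have zl: "z l * a l ?j = (if l = U ?b then -1 else 0)" for l
      proof (cases "l = U ?b")
        case True
        have d1: "d - 1 = Suc ?b" using 4 by linarith
        then have "a (U ?b) ?j = -1" using cartan_U[of ?b "Suc ?b"] less.prems 4 by simp
        then show ?thesis using z(1) True by simp
      next
        case False
        show ?thesis
        proof (cases "l \<in> bl")
          case True
          define e where "e = dep l"
          have e: "e \<le> H" "l = U e" using dep_le_H black_U[OF True] by (simp_all add: e_def)
          have "e \<noteq> d - 1" "e \<noteq> d" "e \<noteq> d - 2" using e True b(2) Ud False by auto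
          then have "a l ?j = 0" using cartan_U[of e "d - 1"] e less.prems 4 by auto
          then show ?thesis using False by simp
        qed (use z(2) False in simp)
      qed
      have "pair (two_rho_check D) (\<alpha> ?j) = -1"
        unfolding z(3) pair_sum_left pair_zscale_left pair_coroot_alpha zl by simp
      moreover have "even (pair (two_rho_check D) (\<alpha> ?j))"
        using even_two_rho_check[OF b(2)] tau_U[of "d - 1"] less.prems by simp
      ultimately show False by simp
    qed
    then show ?thesis using 4 by simp
  qed
qed

lemma white_has_black_nbr:
  assumes "j \<notin> P" "j \<notin> bl"
  shows "\<exists>k\<in>bl. a k j \<noteq> 0"
proof -
  have j: "U (dep j) = j" "dep j \<le> H" using U_dep assms dep_le_H by auto
  then have odd: "odd (dep j)" using black_iff_even[of "dep j"] assms(2) by simp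
  then obtain d where d: "dep j = Suc d" by (cases "dep j") auto
  have "U d \<in> bl" using black_iff_even[of d] j d odd by simp
  moreover have "a (U d) j = -1" using cartan_U[of d "Suc d"] j d by simp
  ultimately show ?thesis by (metis neg_0_equal_iff_equal zero_neq_one)
qed

end

section \<open>The white nodes other than i0 and its image\<close>

context aiv_pair
begin

lemma deep_pairI:
  assumes "t \<notin> P" "\<tau> t = t" "2 \<le> dep t"
  obtains c u1 u2 where "deep_pair D i0 p c u1 u2"
proof -
  obtain u2 where u2: "u2 \<notin> P" "\<tau> u2 = u2" "dep u2 = 2"
    using fixed_ancestor[OF assms(1,2), of 2] assms(3) by auto
  have "dep (par u2) = 1" using par(2)[OF u2(1)] u2(3) by simp
  moreover from this have "par u2 \<notin> P" using dep_0[of "par u2"] by simp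
  moreover have "\<tau> (par u2) = par u2" using par_tau[OF u2(1)] u2(2) by simp
  ultimately obtain c where "length p = 2 * c + 1" "1 \<le> c" "par (par u2) = p ! c"
    using fixed_parent_in_P by blast
  then have "deep_pair D i0 p c (par u2) u2"
    using u2 by unfold_locales auto
  then show thesis by (rule that)
qed

text \<open>The role of the type \<open>AIV\<close> subdiagram: on the other white nodes, either \<open>B\<^sub>j\<close> has nonzero weight
  for a black coroot, or \<open>j\<close> and \<open>\<tau>(j)\<close> span a subdiagram of type \<open>A\<^sub>1 \<times> A\<^sub>1\<close>.\<close>

lemma white_cases:
  assumes j: "j \<notin> bl" "j \<noteq> i0" "j \<noteq> \<tau> i0"
  shows "\<tau> j = j \<and> (\<exists>k\<in>bl. a k j \<noteq> 0) \<or>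
    \<tau> j \<noteq> j \<and> (\<forall>k\<in>bl. a k j = 0) \<and> a j (\<tau> j) = 0"
proof (cases "\<tau> j = j")
  case True
  have jP: "j \<notin> P" using white_P[of j] j by blast
  have "\<exists>k\<in>bl. a k j \<noteq> 0"
  proof (cases "dep j = 1")
    case dj: True
    obtain c where c: "length p = 2 * c + 1" "1 \<le> c" "par j = p ! c"
      using fixed_parent_in_P[OF jP True dj] .
    have "p ! c \<in> bl" using c by (intro interior) auto
    moreover have "a (p ! c) j \<noteq> 0" using par(1)[OF jP] c(3) adj_sym by (auto simp: adj_def)
    ultimately show ?thesis by blast
  next
    case False
    moreover have "dep j \<noteq> 0" using jP by simp
    ultimately have "2 \<le> dep j" by linarith
    then obtain c u1 u2 where "deep_pair D i0 p c u1 u2" using deep_pairI[OF jP True] by blast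
    then interpret deep_pair D i0 p c u1 u2 .
    show ?thesis using white_has_black_nbr[OF jP j(1)] .
  qed
  then show ?thesis using True by blast
next
  case False
  have jP: "j \<notin> P" using white_P[of j] j by blast
  have "a k j = 0" if k: "k \<in> bl" for k
  proof (rule ccontr)
    assume "a k j \<noteq> 0"
    then have kj: "adj k j" using k j(1) by (auto simp: adj_def)
    show False
    proof (cases "k \<in> P")
      case True
      then obtain b where b: "b < length p" "k = p ! b" unfolding in_P by blast
      have "b \<noteq> 0" using b(2) k white_i0 p_0 by metis
      moreover have "b \<noteq> length p - 1" using b k white_i0 p_last tau_black_iff[of i0] by metis
      ultimately have "0 < b" "b < length p - 1" using b(1) by linarith+
      then show False using interior_nbr_fixed[OF jP, of b] b(2) kj False by simp
    next
      case kP: False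
      obtain t where "t \<notin> P" "\<tau> t = t" "2 \<le> dep t" using black_fixed[OF kP k] .
      then obtain c u1 u2 where "deep_pair D i0 p c u1 u2" using deep_pairI by blast
      then interpret deep_pair D i0 p c u1 u2 .
      show False using all_fixed[OF jP] False by blast
    qed
  qed
  moreover have "a j (\<tau> j) = 0" using not_adj_tau[OF jP] False by (auto simp: adj_def)
  ultimately show ?thesis using False by blast
qed

end

section \<open>The quantum group\<close>

lemma to_fract_power: "(Fract p 1 :: 'a::idom fract) ^ n = Fract (p ^ n) 1"
  by (induction n) (simp_all add: One_fract_def)

lemma qq_power_eq_1: "qq ^ n = 1 \<longleftrightarrow> n = 0"
proof
  assume "qq ^ n = 1"
  then have "to_ac (Fract ([:0, 1:] ^ n) 1 :: complex poly fract) = to_ac 1"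
    by (simp add: qq_def to_fract_power flip: to_ac_power)
  then have "(Fract ([:0, 1:] ^ n) 1 :: complex poly fract) = 1"
    by (simp only: to_ac_eq_iff)
  then have "[:0, 1:] ^ n = (1 :: complex poly)"
    by (simp add: One_fract_def eq_fract)
  then have "Polynomial.degree ([:0, 1:] ^ n :: complex poly) = 0" by simp
  then show "n = 0" by (simp add: Polynomial.degree_power_eq)
qed simp

lemma qq_nonzero [simp]: "qq \<noteq> 0"
  using qq_power_eq_1[of 1] unfolding qq_def
  by (simp add: Zero_fract_def eq_fract)

lemma qq_powi_eq_1: "qq powi n = 1 \<longleftrightarrow> n = 0"
proof
  assume 1: "qq powi n = 1"
  then have "qq ^ nat \<bar>n\<bar> = 1"
    by (cases "0 \<le> n") (auto simp: power_int_def inverse_eq_1_iff power_inverse)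
  then show "n = 0" by (simp add: qq_power_eq_1)
qed simp

lemma qq_powi_inj: "qq powi m = qq powi n \<longleftrightarrow> m = n"
proof
  assume "qq powi m = qq powi n"
  then have "qq powi (m - n) = 1" by (simp add: power_int_diff)
  then show "m = n" by (simp add: qq_powi_eq_1)
qed simp

lemma scal_mult: "scal x * scal y = scal (x * y)"
  by (simp add: scal_def mult_single)

lemma scal_add: "scal x + scal y = scal (x + y)"
  by (simp add: scal_def single_add)

lemma scal_0 [simp]: "scal 0 = 0"
  by (simp add: scal_def)

lemma scal_1 [simp]: "scal 1 = 1"
  by (simp add: scal_def)

lemma scal_minus: "scal (- x) = - scal x"
  using scal_add[of x "- x"] by (simp add: eq_neg_iff_add_eq_0 add.commute)

lemma scal_commute: "x * scal s = scal s * x"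
proof (induction x rule: free_alg_induct)
  case (2 w b)
  show ?case by (simp add: scal_def mult_single mult.commute)
qed (simp_all add: algebra_simps)

lemma alg_extend_scal_hom:
  "alg_extend scal \<phi> (x + y) = alg_extend scal \<phi> x + alg_extend scal \<phi> y"
  "alg_extend scal \<phi> (x * y) = alg_extend scal \<phi> x * alg_extend scal \<phi> y"
  "alg_extend scal \<phi> (scal s) = scal s"
  "alg_extend scal \<phi> (gen_elem g) = \<phi> g"
proof -
  show "alg_extend scal \<phi> (x + y) = alg_extend scal \<phi> x + alg_extend scal \<phi> y"
    by (rule alg_extend_add) (simp_all add: scal_add)
  show "alg_extend scal \<phi> (x * y) = alg_extend scal \<phi> x * alg_extend scal \<phi> y"
    by (rule alg_extend_mult) (simp_all add: scal_add scal_mult, rule scal_commute[symmetric])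
  have "alg_extend scal \<phi> (Poly_Mapping.single 0 s) = scal s * prod_list (map \<phi> (letters 0))"
    by (rule alg_extend_single) simp
  then show "alg_extend scal \<phi> (scal s) = scal s" by (simp add: scal_def[of s] zero_word_def)
  show "alg_extend scal \<phi> (gen_elem g) = \<phi> g"
    by (simp add: gen_elem_def alg_extend_single)
qed

lemma counit_free_power [simp]: "counit_free (x ^ n) = counit_free x ^ n"
  by (induction n) simp_all

section \<open>Computing with cosets, and the X-grading\<close>

lemma cls_add: "cls D (x + y) = cls D x \<oplus>\<^bsub>UU D\<^esub> cls D y"
  and cls_mult: "cls D (x * y) = cls D x \<otimes>\<^bsub>UU D\<^esub> cls D y"
  and cls_one: "cls D 1 = \<one>\<^bsub>UU D\<^esub>"
  using ring_hom_add[OF cls_hom, of x y D] ring_hom_mult[OF cls_hom, of x y D]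
    ring_hom_one[OF cls_hom, of D]
  by (simp_all add: ring_of_type_algebra_def)

lemma carrier_UU: "carrier (UU D) = range (cls D)"
  unfolding UU_def cls_def FactRing_simps by (auto simp: ring_of_type_algebra_def)

lemma cls_closed [simp]: "cls D x \<in> carrier (UU D)"
  by (simp add: carrier_UU)

lemma free_ring_simps: "carrier free_ring = UNIV" "monoid.mult free_ring = (*)" "add free_ring = (+)"
  "zero free_ring = 0" "one free_ring = 1"
  by (simp_all add: ring_of_type_algebra_def)

lemma free_ring_minus: "\<ominus>\<^bsub>free_ring\<^esub> (x :: ('i, 'y) free) = - x"
  by (rule abelian_group.minus_equality[OF ring.is_abelian_group[OF ring_free_ring]])
     (simp_all add: free_ring_simps)

lemma cls_eq_iff: "cls D x = cls D y \<longleftrightarrow> x - y \<in> rel_ideal D"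
  using ring.quotient_eq_iff_same_a_r_cos[OF ring_free_ring ideal_rel_ideal[of D], of x y]
  by (simp add: cls_def a_minus_def free_ring_minus free_ring_simps)

lemma rel_ideal_add: "x \<in> rel_ideal D \<Longrightarrow> y \<in> rel_ideal D \<Longrightarrow> x + y \<in> rel_ideal D"
  and rel_ideal_minus: "x \<in> rel_ideal D \<Longrightarrow> - x \<in> rel_ideal D"
  and rel_ideal_zero: "0 \<in> rel_ideal D"
  and rel_ideal_lmult: "x \<in> rel_ideal D \<Longrightarrow> u * x \<in> rel_ideal D"
  and rel_ideal_rmult: "x \<in> rel_ideal D \<Longrightarrow> x * u \<in> rel_ideal D"
  using additive_subgroup.a_closed[OF ideal.axioms(1)[OF ideal_rel_ideal], of x D y]
    additive_subgroup.a_inv_closed[OF ideal.axioms(1)[OF ideal_rel_ideal], of x D]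
    additive_subgroup.zero_closed[OF ideal.axioms(1)[OF ideal_rel_ideal], of D]
    ideal.I_l_closed[OF ideal_rel_ideal, of x D u] ideal.I_r_closed[OF ideal_rel_ideal, of x D u]
  by (simp_all add: free_ring_simps free_ring_minus)

lemma rel_ideal_diff: "x \<in> rel_ideal D \<Longrightarrow> y \<in> rel_ideal D \<Longrightarrow> x - y \<in> rel_ideal D"
  using rel_ideal_add[of x D "- y"] rel_ideal_minus[of y D] by simp

lemma relators_rel_ideal: "r \<in> relators D \<Longrightarrow> r \<in> rel_ideal D"
  unfolding rel_ideal_def using ring.genideal_self[OF ring_free_ring, of "relators D"]
  by (auto simp: free_ring_simps)

lemma cls_lmult: "cls D x = cls D y \<Longrightarrow> cls D (u * x) = cls D (u * y)"
  and cls_rmult: "cls D x = cls D y \<Longrightarrow> cls D (x * u) = cls D (y * u)"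
  by (simp_all add: cls_mult)

lemma relations:
  "KK 0 - 1 \<in> rel_ideal D"
  "KK h * KK h' - KK (h + h') \<in> rel_ideal D"
  "KK h * EE j - scal (qq powi pairing D h (alpha D j)) * EE j * KK h \<in> rel_ideal D"
  "KK h * FF j - scal (qq powi (- pairing D h (alpha D j))) * FF j * KK h \<in> rel_ideal D"
  "EE j * FF k - FF k * EE j -
          (if j = k then scal (inverse (qi D j - inverse (qi D j))) *
                         (Kw D (alpha D j) - Kw D (- alpha D j)) else 0) \<in> rel_ideal D"
  "j \<noteq> k \<Longrightarrow> serre D EE j k \<in> rel_ideal D"
  "j \<noteq> k \<Longrightarrow> serre D FF j k \<in> rel_ideal D"
  unfolding relators_def by (rule relators_rel_ideal, unfold relators_def, blast)+

text \<open>The X-grading with E_i, F_i, K_h in degrees \<alpha>_i, -\<alpha>_i, 0, kept as a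
  predicate on the free algebra. It serves to commute K_h past braided generators by
  \<open>homog_commute\<close>, for which the braid operators need not be known to preserve
  \<open>rel_ideal\<close>.\<close>

inductive homog :: "('i, 'x::ab_group_add, 'y::ab_group_add) satake_datum \<Rightarrow> ('i, 'y) free \<Rightarrow> 'x \<Rightarrow> bool"
  for D where
  homog_EE: "homog D (EE i) (alpha D i)"
| homog_FF: "homog D (FF i) (- alpha D i)"
| homog_KK: "homog D (KK h) 0"
| homog_scal: "homog D (scal s) 0"
| homog_zero: "homog D 0 \<mu>"
| homog_add: "homog D x \<mu> \<Longrightarrow> homog D y \<mu> \<Longrightarrow> homog D (x + y) \<mu>"
| homog_mult: "homog D x \<mu> \<Longrightarrow> homog D y \<nu> \<Longrightarrow> homog D (x * y) (\<mu> + \<nu>)"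

lemma homog_scal_mult: "homog D x \<mu> \<Longrightarrow> homog D (scal s * x) \<mu>"
  using homog_mult[OF homog_scal, of D x \<mu> s] by simp

lemma homog_uminus: "homog D x \<mu> \<Longrightarrow> homog D (- x) \<mu>"
  using homog_scal_mult[of D x \<mu> "-1"] by (simp add: scal_minus)

lemma homog_power: "homog D x \<mu> \<Longrightarrow> homog D (x ^ n) (int n *\<^sub>Z \<mu>)"
proof (induction n)
  case 0
  show ?case using homog_scal[of D 1] by simp
next
  case (Suc n)
  then show ?case using homog_mult[of D x \<mu> "x ^ n" "int n *\<^sub>Z \<mu>"]
    by (simp add: zscale_succ add.commute[of 1])
qed

lemma homog_dpow: "homog D x \<mu> \<Longrightarrow> homog D (dpow s x n) (int n *\<^sub>Z \<mu>)"
  unfolding dpow_def by (intro homog_scal_mult homog_power)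

lemma homog_Kw: "homog D (Kw D l) 0"
  unfolding Kw_def by (rule homog_KK)

lemma homog_sum: "(\<And>s. s \<in> S \<Longrightarrow> homog D (f s) \<mu>) \<Longrightarrow> homog D (sum f S) \<mu>"
  by (induction S rule: infinite_finite_induct) (auto intro: homog_zero homog_add)

lemma homog_cong: "homog D x \<mu> \<Longrightarrow> \<mu> = \<nu> \<Longrightarrow> homog D x \<nu>"
  by simp

lemma dpow_0 [simp]: "dpow s x 0 = 1"
  by (simp add: dpow_def q_fact_def)

text \<open>Every term in the image of an E or F still contains a factor E or F, and K_h goes to
  some K. This yields that the counit of B_j is 0.\<close>

lemma counit_free_braid: "counit_free (braid D i x) = counit_free x"
proof -
  have gen: "counit_free (braid_gen D i g) = counit_gen g" for g
    by (cases g) (auto simp: Let_def counit_free_sum)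
  have prod: "counit_free (prod_list (map (braid_gen D i) ws)) = prod_list (map counit_gen ws)" for ws
    by (induction ws) (simp_all add: gen)
  show ?thesis
  proof (induction x rule: free_alg_induct)
    case (2 w b)
    show ?case
      by (simp add: braid_def alg_extend_single prod)
         (simp add: counit_free_def alg_extend_single)
  qed (simp_all add: braid_def alg_extend_scal_hom, simp add: alg_extend_def)
qed

lemma counit_free_braid_word: "counit_free (braid_word D ws x) = counit_free x"
  by (induction ws) (simp_all add: braid_word_def counit_free_braid)

section \<open>Weights of the braid operators, and orthogonal nodes\<close>

context semisimple_datum
begin

lemma homog_commute:
  assumes "homog D x \<mu>"
  shows "KK h * x - scal (qq powi pair h \<mu>) * x * KK h \<in> rel_ideal D"
  using assms
proof induction
  case (homog_EE i)
  show ?case by (rule relations)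
next
  case (homog_FF i)
  show ?case using relations(4)[of h i D] by simp
next
  case (homog_KK h')
  have "KK h * KK h' - KK h' * KK h = (KK h * KK h' - KK (h + h')) - (KK h' * KK h - KK (h' + h))"
    by (simp add: add.commute)
  then show ?case using rel_ideal_diff[OF relations(2) relations(2)] by (metis mult_1 pair_zero_right power_int_0_right scal_1)
next
  case (homog_scal s)
  show ?case by (simp add: scal_commute[of "KK h"] rel_ideal_zero)
next
  case (homog_zero \<mu>)
  show ?case by (simp add: rel_ideal_zero)
next
  case (homog_add x \<mu> y)
  then show ?case using rel_ideal_add by (fastforce simp: algebra_simps)
next
  case (homog_mult x \<mu> y \<nu>)
  let ?a = "scal (qq powi pair h \<mu>)" and ?b = "scal (qq powi pair h \<nu>)"
  have ab: "scal (qq powi pair h (\<mu> + \<nu>)) = ?a * ?b"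
    by (simp add: scal_mult pair_add_right power_int_add)
  have "KK h * (x * y) - ?a * ?b * (x * y) * KK h
      = (KK h * x - ?a * x * KK h) * y + ?a * x * (KK h * y - ?b * y * KK h)
        + ?a * (x * ?b - ?b * x) * (y * KK h)"
    by (simp add: algebra_simps)
  also have "x * ?b - ?b * x = 0" by (simp add: scal_commute)
  finally show ?case unfolding ab
    using rel_ideal_add[OF rel_ideal_rmult[OF homog_mult.IH(1), of y] rel_ideal_lmult[OF homog_mult.IH(2), of "?a * x"]]
    by simp
qed

lemma homog_braid_gen: "homog D (braid_gen D i (GE j)) (reflX D i (\<alpha> j))"
  "homog D (braid_gen D i (GF j)) (reflX D i (- \<alpha> j))"
  "homog D (braid_gen D i (GK h)) (reflX D i 0)"
proof -
  have refl_i: "reflX D i (\<alpha> i) = - \<alpha> i" "reflX D i (- \<alpha> i) = \<alpha> i" "reflX D i 0 = 0"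
    using zscale_add_left[of 1 1 "\<alpha> i"]
    by (simp_all add: reflX_def pair_coroot_alpha algebra_simps)
  show "homog D (braid_gen D i (GK h)) (reflX D i 0)"
    by (simp add: refl_i homog_KK)
  have m: "int (nat (- a i j)) = - a i j" if "i \<noteq> j" using cartan_nonpos[OF that] by simp
  have refl_j: "reflX D i (\<alpha> j) = \<alpha> j + int (nat (- a i j)) *\<^sub>Z \<alpha> i"
    "reflX D i (- \<alpha> j) = - \<alpha> j + int (nat (- a i j)) *\<^sub>Z (- \<alpha> i)" if "i \<noteq> j"
    unfolding m[OF that] by (simp_all add: reflX_def pair_coroot_alpha)
  show "homog D (braid_gen D i (GE j)) (reflX D i (\<alpha> j))"
  proof (cases "j = i")
    case True
    then show ?thesis
      using homog_uminus[OF homog_mult[OF homog_FF[of D i] homog_Kw[of D "\<alpha> i"]]] by (simp add: refl_i)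
  next
    case False
    have "homog D (dpow s (EE i) (m - r) * EE j * dpow s (EE i) r) (\<alpha> j + int m *\<^sub>Z \<alpha> i)" if "r \<le> m" for s m r
    proof (rule homog_cong)
      show "homog D (dpow s (EE i) (m - r) * EE j * dpow s (EE i) r)
          (int (m - r) *\<^sub>Z \<alpha> i + \<alpha> j + int r *\<^sub>Z \<alpha> i)"
        by (intro homog_mult homog_dpow homog_EE)
      show "int (m - r) *\<^sub>Z \<alpha> i + \<alpha> j + int r *\<^sub>Z \<alpha> i = \<alpha> j + int m *\<^sub>Z \<alpha> i"
        using that zscale_add_left[of "int (m - r)" "int r" "\<alpha> i"] by (simp add: algebra_simps)
    qed
    moreover have "braid_gen D i (GE j) = (\<Sum>r\<le>nat (- a i j). scal ((-1) ^ r * qi D i powi (- int r)) *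
        (dpow (qi D i) (EE i) (nat (- a i j) - r) * EE j * dpow (qi D i) (EE i) r))"
      using False by (simp add: Let_def mult.assoc)
    ultimately show ?thesis unfolding refl_j(1)[OF False[symmetric]]
      by (auto simp only: atMost_iff intro!: homog_sum homog_scal_mult)
  qed
  show "homog D (braid_gen D i (GF j)) (reflX D i (- \<alpha> j))"
  proof (cases "j = i")
    case True
    then show ?thesis
      using homog_uminus[OF homog_mult[OF homog_Kw[of D "- \<alpha> i"] homog_EE[of D i]]] by (simp add: refl_i)
  next
    case False
    have "homog D (dpow s (FF i) r * FF j * dpow s (FF i) (m - r)) (- \<alpha> j + int m *\<^sub>Z (- \<alpha> i))" if "r \<le> m" for s m r
    proof (rule homog_cong)
      show "homog D (dpow s (FF i) r * FF j * dpow s (FF i) (m - r))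
          (int r *\<^sub>Z (- \<alpha> i) + - \<alpha> j + int (m - r) *\<^sub>Z (- \<alpha> i))"
        by (intro homog_mult homog_dpow homog_FF)
      show "int r *\<^sub>Z (- \<alpha> i) + - \<alpha> j + int (m - r) *\<^sub>Z (- \<alpha> i) = - \<alpha> j + int m *\<^sub>Z (- \<alpha> i)"
        using that zscale_add_left[of "int r" "int (m - r)" "- \<alpha> i"] by (simp add: algebra_simps)
    qed
    moreover have "braid_gen D i (GF j) = (\<Sum>r\<le>nat (- a i j). scal ((-1) ^ r * qi D i powi int r) *
        (dpow (qi D i) (FF i) r * FF j * dpow (qi D i) (FF i) (nat (- a i j) - r)))"
      using False by (simp add: Let_def mult.assoc)
    ultimately show ?thesis unfolding refl_j(2)[OF False[symmetric]]
      by (auto simp only: atMost_iff intro!: homog_sum homog_scal_mult)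
  qed
qed

lemma homog_braid:
  assumes "homog D x \<mu>"
  shows "homog D (braid D i x) (reflX D i \<mu>)"
  using assms
proof induction
  case (homog_EE j)
  show ?case using homog_braid_gen(1) by (simp add: braid_def EE_def alg_extend_scal_hom)
next
  case (homog_FF j)
  show ?case using homog_braid_gen(2) by (simp add: braid_def FF_def alg_extend_scal_hom)
next
  case (homog_KK h)
  show ?case using homog_braid_gen(3) by (simp only: braid_def KK_def alg_extend_scal_hom)
next
  case (homog_scal s)
  show ?case using homog.homog_scal[of D s] by (simp add: braid_def alg_extend_scal_hom additive.zero[OF additive_reflX])
next
  case (homog_zero \<mu>)
  show ?case by (simp add: braid_def alg_extend_def homog.homog_zero)
next
  case (homog_add x \<mu> y)
  then show ?case by (simp add: braid_def alg_extend_scal_hom homog.homog_add)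
next
  case (homog_mult x \<mu> y \<nu>)
  then show ?case
    by (simp add: braid_def alg_extend_scal_hom homog.homog_mult additive.add[OF additive_reflX])
qed

lemma homog_braid_word: "homog D x \<mu> \<Longrightarrow> homog D (braid_word D ws x) (actX D ws \<mu>)"
  by (induction ws) (simp_all add: braid_word_def homog_braid)

text \<open>When the Cartan entry is 0, the sum defining the braided generator has the single term r
  = 0. So for white nodes without black neighbours B_j takes its rank-one form already in the free
  algebra.\<close>

lemma braid_word_EE_fixed:
  assumes "\<And>k. k \<in> set ws \<Longrightarrow> k \<noteq> j \<and> a k j = 0"
  shows "braid_word D ws (EE j) = EE j"
  using assms
proof (induction ws)
  case (Cons k ws)
  then have "braid_word D ws (EE j) = EE j" "k \<noteq> j" "a k j = 0" by auto
  then show ?case by (auto simp: braid_word_def braid_def EE_def alg_extend_scal_hom Let_def)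
qed (simp add: braid_word_def)

lemma qi_eq: "qi D i = qq powi half_norm i"
  by (simp add: qi_def half_norm_def)

lemma qi_diff_nonzero: "qi D i - inverse (qi D i) \<noteq> 0"
proof
  assume "qi D i - inverse (qi D i) = 0"
  then have "qq powi half_norm i = qq powi (- half_norm i)" by (simp add: qi_eq power_int_minus)
  then show False using half_norm_pos[of i] by (simp add: qq_powi_inj)
qed

lemma Kw_alpha: "Kw D (\<alpha> i) = KK (half_norm i *\<^sub>Z \<eta> i)" "Kw D (- \<alpha> i) = KK (- (half_norm i *\<^sub>Z \<eta> i))"
  by (simp_all add: Kw_def h_of_alpha h_of_minus_alpha)

lemma serre_0:
  assumes "a i j = 0"
  shows "serre D x i j = x j * x i - x i * x j"
proof -
  have "q_fact (qi D i) 1 = 1"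
    using qi_diff_nonzero[of i] by (simp add: q_fact_def q_int_def)
  then have "dpow (qi D i) z 1 = z" for z :: "('i, 'y) free" by (simp add: dpow_def)
  then show ?thesis using assms
    by (simp add: serre_def Let_def atMost_Suc scal_minus)
qed

lemma orthogonal_commute:
  assumes "i \<noteq> j" "a i j = 0"
  shows "EE i * EE j - EE j * EE i \<in> rel_ideal D" "FF i * FF j - FF j * FF i \<in> rel_ideal D"
  using relations(6,7)[OF assms(1), of D] rel_ideal_minus unfolding serre_0[OF assms(2)] by fastforce+

end

section \<open>Coideal subalgebras and their characters\<close>

lemma cls_zero: "cls D 0 = \<zero>\<^bsub>UU D\<^esub>"
  using ring_hom_zero[OF cls_hom ring_free_ring ring_UU, of D] by (simp add: free_ring_simps)

lemma cls_uminus: "cls D (- x) = \<ominus>\<^bsub>UU D\<^esub> cls D x"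
  by (rule abelian_group.minus_equality[OF ring.is_abelian_group[OF ring_UU], symmetric])
     (simp_all flip: cls_add cls_zero)

lemma subalg_subset: "S \<subseteq> carrier (UU D) \<Longrightarrow> subalg D S \<subseteq> carrier (UU D)"
  unfolding subalg_def by (rule ring.generate_ring_incl[OF ring_UU]) auto

lemma subalg_scal: "cls D (scal s) \<in> subalg D S"
  and subalg_incl: "z \<in> S \<Longrightarrow> z \<in> subalg D S"
  and subalg_add: "cls D x \<in> subalg D S \<Longrightarrow> cls D y \<in> subalg D S \<Longrightarrow> cls D (x + y) \<in> subalg D S"
  and subalg_mult: "cls D x \<in> subalg D S \<Longrightarrow> cls D y \<in> subalg D S \<Longrightarrow> cls D (x * y) \<in> subalg D S"
  unfolding subalg_def cls_add cls_mult by (auto intro: generate_ring.intros)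

lemma subalg_one: "cls D 1 \<in> subalg D S"
  using subalg_scal[of D 1] by simp

text \<open>Stated on representatives, and without a case for negation, which is multiplication by
  \<open>scal (-1)\<close>.\<close>

lemma subalg_induct [consumes 2, case_names scal gen add mult]:
  assumes z: "z \<in> subalg D S" and S: "S \<subseteq> carrier (UU D)"
    and scal: "\<And>s. Q (cls D (scal s))" and gen: "\<And>x. x \<in> S \<Longrightarrow> Q x"
    and add: "\<And>x y. cls D x \<in> subalg D S \<Longrightarrow> cls D y \<in> subalg D S \<Longrightarrow>
      Q (cls D x) \<Longrightarrow> Q (cls D y) \<Longrightarrow> Q (cls D (x + y))"
    and mult: "\<And>x y. cls D x \<in> subalg D S \<Longrightarrow> cls D y \<in> subalg D S \<Longrightarrow>
      Q (cls D x) \<Longrightarrow> Q (cls D y) \<Longrightarrow> Q (cls D (x * y))"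
  shows "Q z"
proof -
  have ex: "\<exists>x. z = cls D x" if "z \<in> subalg D S" for z
    using subalg_subset[OF S] that by (auto simp: carrier_UU)
  have "z \<in> generate_ring (UU D) (range (\<lambda>s. cls D (scal s)) \<union> S)"
    using z by (simp add: subalg_def)
  then show ?thesis
  proof (induction rule: generate_ring.induct)
    case one
    show ?case using scal[of 1] by (simp add: cls_one)
  next
    case (incl h)
    then show ?case using scal gen by auto
  next
    case (a_inv h)
    then have h: "h \<in> subalg D S" by (simp add: subalg_def)
    then obtain x where x: "h = cls D x" using ex by blast
    have "\<ominus>\<^bsub>UU D\<^esub> h = cls D (scal (-1) * x)" unfolding x by (simp add: scal_minus flip: cls_uminus)
    then show ?case using mult[of "scal (-1)" x] subalg_scal[of D "-1" S] scal[of "-1"] a_inv.IH h x by simp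
  next
    case (eng_add h1 h2)
    then have h: "h1 \<in> subalg D S" "h2 \<in> subalg D S" by (simp_all add: subalg_def)
    then obtain x y where "h1 = cls D x" "h2 = cls D y" using ex by metis
    then show ?case using add[of x y] h eng_add.IH by (simp add: cls_add)
  next
    case (eng_mult h1 h2)
    then have h: "h1 \<in> subalg D S" "h2 \<in> subalg D S" by (simp_all add: subalg_def)
    then obtain x y where "h1 = cls D x" "h2 = cls D y" using ex by metis
    then show ?case using mult[of x y] h eng_mult.IH by (simp add: cls_mult)
  qed
qed

lemma subalg_mono: "S \<subseteq> subalg D T \<Longrightarrow> S \<subseteq> carrier (UU D) \<Longrightarrow> subalg D S \<subseteq> subalg D T"
proof
  fix z assume *: "S \<subseteq> subalg D T" "S \<subseteq> carrier (UU D)" "z \<in> subalg D S"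
  from *(3,2) show "z \<in> subalg D T"
    by (induction rule: subalg_induct) (use *(1) in \<open>auto intro: subalg_scal subalg_add subalg_mult\<close>)
qed

abbreviation black_gens where
  "black_gens D \<equiv> (\<Union>j \<in> black D. {cls D (EE j), cls D (FF j), cls D (Kw D (alpha D j)), cls D (Kw D (- alpha D j))})"

text \<open>A representative of \<open>B_gen\<close> in the free algebra, where relations become
  membership in \<open>rel_ideal\<close>.\<close>

definition BB ::
  "('i, 'x::ab_group_add, 'y::ab_group_add) satake_datum \<Rightarrow> ('i \<Rightarrow> kk) \<Rightarrow> 'i \<Rightarrow> ('i, 'y) free" where
  "BB D c j = FF j + scal (c j) * braid_word D (w_black D) (EE (tau D j)) * Kw D (- alpha D j)"

lemma B_gen_eq: "B_gen D c j = cls D (BB D c j)"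
  by (simp add: B_gen_def BB_def)

lemma counit_BB [simp]: "counit_free (BB D c j) = 0"
  by (simp add: BB_def counit_free_braid_word)

lemma U_black_subset: "U_black D \<subseteq> carrier (UU D)"
  unfolding U_black_def by (rule subalg_subset) auto

lemma B_gens_subset:
  "U_black D \<union> (\<lambda>h. cls D (KK h)) ` Y \<union> B_gen D c ` J \<subseteq> carrier (UU D)"
  using U_black_subset by (auto simp: B_gen_eq)

lemma QSP_B_subset: "QSP_B D c \<subseteq> carrier (UU D)"
  unfolding QSP_B_def by (rule subalg_subset[OF B_gens_subset])

lemma QSP_C_subset_B: "QSP_C D c i \<subseteq> QSP_B D c"
  unfolding QSP_C_def QSP_B_def by (rule subalg_mono[OF _ B_gens_subset]) (auto intro: subalg_incl)

lemma black_gens_C: "black_gens D \<subseteq> QSP_C D c i"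
  unfolding QSP_C_def U_black_def by (auto intro!: subalg_incl)

lemma commute_add:
  assumes "k * x - s * x * k \<in> rel_ideal D" "k * y - s * y * k \<in> rel_ideal D"
  shows "k * (x + y) - s * (x + y) * k \<in> rel_ideal D"
  using rel_ideal_add[OF assms] by (simp add: algebra_simps)

context satake_pair
begin

lemma BB_commute:
  assumes "h \<in> Y_theta D"
  shows "KK h * BB D c j - scal (qq powi - pair h (\<alpha> j)) * BB D c j * KK h \<in> rel_ideal D"
  unfolding BB_def
proof (rule commute_add)
  show "KK h * FF j - scal (qq powi - pair h (\<alpha> j)) * FF j * KK h \<in> rel_ideal D"
    by (rule relations)
  have "homog D (scal (c j) * braid_word D (w_black D) (EE (\<tau> j)) * Kw D (- \<alpha> j))
      (0 + actX D (w_black D) (\<alpha> (\<tau> j)) + 0)"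
    by (intro homog_mult homog_scal homog_braid_word homog_EE homog_Kw)
  from homog_commute[OF this, of h]
  show "KK h * (scal (c j) * braid_word D (w_black D) (EE (\<tau> j)) * Kw D (- \<alpha> j))
      - scal (qq powi - pair h (\<alpha> j)) * (scal (c j) * braid_word D (w_black D) (EE (\<tau> j)) * Kw D (- \<alpha> j)) * KK h
      \<in> rel_ideal D"
    by (simp add: pair_thetaY[OF assms])
qed

end

text \<open>A noncommutative identity, with \<open>C\<close> central; all brackets on the right hand side vanish in \<open>U\<close>.\<close>

lemma commutator_identity:
  fixes C :: "'a::ring_1"
  assumes C: "\<And>x. x * C = C * x"
  shows "(F + C * E' * K) * (F' + C * E * K') - (F' + C * E * K') * (F + C * E' * K)
      - C * s * (L - L') =
    (F * F' - F' * F)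
    + C * E' * (K * F' - F' * K) - C * E * (K' * F - F * K')
    - C * (E * F - F * E - s * (M - K)) * K' + C * (E' * F' - F' * E' - s * (M' - K')) * K
    + C * C * (E' * (K * E - q * E * K) * K' - E * (K' * E' - q * E' * K') * K
        + (E' * q - q * E') * E * K * K' - (E * q - q * E) * E' * K' * K
        + q * (E' * E - E * E') * K * K' - q * E * E' * (K' * K - K * K'))
    - C * s * (M * K' - L') + C * s * (M' * K - L) - C * s * (K' * K - K * K')"
proof -
  have C': "x * (C * y) = C * (x * y)" for x y
    unfolding mult.assoc[symmetric] by (simp only: C)
  show ?thesis
    by (simp add: algebra_simps C'[of F] C'[of F'] C'[of E] C'[of E'] C'[of K] C'[of K'] C'[of s] C'[of q])
qed

text \<open>A character that occurs in a nonzero spherical function satisfies \<open>weight\<close>,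
  by \<open>eig_KK_power\<close>. Stating it for every K_h in B makes it unnecessary to decide which
  h outside Y^Theta might occur.\<close>

locale weight_character = aiv_pair D i0 p
  for D :: "('i::finite, 'x::ab_group_add, 'y::ab_group_add) satake_datum" and i0 p +
  fixes c :: "'i \<Rightarrow> kk" and \<chi> :: "('i, 'y) free set \<Rightarrow> kk"
  assumes c_nonzero: "\<And>j. j \<notin> black D \<Longrightarrow> c j \<noteq> 0"
    and c_tau: "\<And>j. j \<notin> black D \<Longrightarrow> form D (alpha D j) (thetaX D (alpha D j)) = 0 \<Longrightarrow> c (tau D j) = c j"
    and character: "\<chi> \<in> characters D (QSP_B D c)"
    and weight: "\<And>h. cls D (KK h) \<in> QSP_B D c \<Longrightarrow> \<exists>n::int. \<chi> (cls D (KK h)) = qq powi n"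
begin

abbreviation inB where "inB x \<equiv> cls D x \<in> QSP_B D c"
abbreviation Ch where "Ch x \<equiv> \<chi> (cls D x)"

lemma inB_add: "inB x \<Longrightarrow> inB y \<Longrightarrow> inB (x + y)"
  and inB_mult: "inB x \<Longrightarrow> inB y \<Longrightarrow> inB (x * y)"
  and inB_scal: "inB (scal s)"
  unfolding QSP_B_def by (auto intro: subalg_add subalg_mult subalg_scal)

lemma inB_uminus: "inB x \<Longrightarrow> inB (- x)"
  using inB_mult[OF inB_scal[of "-1"]] by (simp add: scal_minus)

lemma Ch_scal: "Ch (scal s) = s"
  using character by (simp add: characters_def)

lemma Ch_add: "inB x \<Longrightarrow> inB y \<Longrightarrow> Ch (x + y) = Ch x + Ch y"
  and Ch_mult: "inB x \<Longrightarrow> inB y \<Longrightarrow> Ch (x * y) = Ch x * Ch y"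
  using character ring_hom_add[of \<chi> "UU D\<lparr>carrier := QSP_B D c\<rparr>" ring_of_type_algebra "cls D x" "cls D y"]
    ring_hom_mult[of \<chi> "UU D\<lparr>carrier := QSP_B D c\<rparr>" ring_of_type_algebra "cls D x" "cls D y"]
  by (simp_all add: characters_def cls_add cls_mult ring_of_type_algebra_def)

lemma Ch_uminus: "inB x \<Longrightarrow> Ch (- x) = - Ch x"
  using Ch_mult[OF inB_scal[of "-1"], of x] Ch_scal[of "-1"] by (simp add: scal_minus)

lemma Ch_diff: "inB x \<Longrightarrow> inB y \<Longrightarrow> Ch (x - y) = Ch x - Ch y"
  using Ch_add[of x "- y"] Ch_uminus[of y] inB_uminus[of y] by simp

lemma Ch_rel: "x - y \<in> rel_ideal D \<Longrightarrow> Ch x = Ch y"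
  using cls_eq_iff[of D x y] by simp

lemma inB_KK: "h \<in> Y_theta D \<Longrightarrow> inB (KK h)"
  unfolding QSP_B_def by (rule subalg_incl) blast

lemma inB_BB: "j \<notin> bl \<Longrightarrow> inB (BB D c j)"
  unfolding QSP_B_def by (rule subalg_incl) (auto simp: B_gen_eq)

lemma inB_black: "j \<in> bl \<Longrightarrow> inB (EE j)" "j \<in> bl \<Longrightarrow> inB (FF j)"
  using black_gens_C[of D c i0] QSP_C_subset_B[of D c i0] by auto

lemma Ch_KK_nonzero: "inB (KK h) \<Longrightarrow> Ch (KK h) \<noteq> 0"
  using weight[of h] by auto

text \<open>The values of a character commute, and its value on K_h is nonzero; so an element that
  commutes with K_h only up to a nontrivial power of q must be killed.\<close>

lemma Ch_eq_0:
  assumes "inB x" "inB (KK h)" "KK h * x - scal (qq powi n) * x * KK h \<in> rel_ideal D" "n \<noteq> 0"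
  shows "Ch x = 0"
proof -
  have "Ch (KK h) * Ch x = qq powi n * Ch x * Ch (KK h)"
    using Ch_rel[OF assms(3)] assms(1,2) by (simp add: Ch_mult inB_mult inB_scal Ch_scal)
  then have "Ch x * (qq powi n - 1) = 0"
    using Ch_KK_nonzero[OF assms(2)] by (simp add: algebra_simps)
  then show ?thesis using qq_powi_eq_1[of n] assms(4) by simp
qed

text \<open>The logarithm of \<open>\<chi>(K_h)\<close> to the base q, well determined because q is
  not a root of unity. It is additive on Y^Theta with integer values, so it vanishes at h as soon as
  it vanishes at a nonzero multiple of h.\<close>

definition \<nu> :: "'y \<Rightarrow> int" where "\<nu> h = (SOME n. Ch (KK h) = qq powi n)"

lemma Ch_KK: "h \<in> Y_theta D \<Longrightarrow> Ch (KK h) = qq powi \<nu> h"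
  using someI_ex[OF weight[OF inB_KK[of h]]] by (simp add: \<nu>_def)

lemma \<nu>_eqI: "h \<in> Y_theta D \<Longrightarrow> Ch (KK h) = qq powi n \<Longrightarrow> \<nu> h = n"
  by (simp add: Ch_KK qq_powi_inj)

lemma \<nu>_zero: "\<nu> 0 = 0"
proof (rule \<nu>_eqI[OF Y_theta_zero])
  show "Ch (KK 0) = qq powi 0" using Ch_rel[OF relations(1)] Ch_scal[of 1] by simp
qed

lemma \<nu>_add: "h \<in> Y_theta D \<Longrightarrow> h' \<in> Y_theta D \<Longrightarrow> \<nu> (h + h') = \<nu> h + \<nu> h'"
proof (rule \<nu>_eqI)
  assume h: "h \<in> Y_theta D" "h' \<in> Y_theta D"
  then show "h + h' \<in> Y_theta D" by (rule Y_theta_add)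
  show "Ch (KK (h + h')) = qq powi (\<nu> h + \<nu> h')"
    using Ch_rel[OF relations(2)[of h h' D]] h by (simp add: Ch_mult inB_KK Ch_KK power_int_add)
qed

lemma \<nu>_minus: "h \<in> Y_theta D \<Longrightarrow> \<nu> (- h) = - \<nu> h"
  using \<nu>_add[of h "- h"] Y_theta_minus[of h] \<nu>_zero by simp

lemma \<nu>_zscale: "h \<in> Y_theta D \<Longrightarrow> \<nu> (n *\<^sub>Z h) = n * \<nu> h"
proof (induction n rule: int_induct[where k = 0])
  case (step1 i)
  then show ?case using \<nu>_add[of "i *\<^sub>Z h" h] Y_theta_zscale[of h i] by (simp add: zscale_add_left algebra_simps)
next
  case (step2 i)
  then show ?case using \<nu>_add[of "i *\<^sub>Z h" "- h"] Y_theta_zscale[of h i] Y_theta_minus[of h] \<nu>_minus[of h]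
    by (simp add: zscale_diff_left algebra_simps)
qed (simp add: \<nu>_zero)

lemma \<nu>_sum:
  assumes "\<And>j. j \<in> S \<Longrightarrow> t j \<in> Y_theta D \<and> \<nu> (t j) = 0"
  shows "\<nu> (sum t S) = 0"
proof -
  have "sum t S \<in> Y_theta D \<and> \<nu> (sum t S) = 0"
    using assms by (induction S rule: infinite_finite_induct) (auto simp: Y_theta_zero Y_theta_add \<nu>_zero \<nu>_add)
  then show ?thesis by blast
qed

text \<open>K of the coroot itself kills E_j and F_j by \<open>Ch_eq_0\<close>; then their
  commutator gives K_h and its inverse the same value, so the exponent equals its negative.\<close>

lemma Ch_black:
  assumes "j \<in> bl"
  shows "Ch (EE j) = 0" "Ch (FF j) = 0" "\<nu> (\<eta> j) = 0"
proof -
  let ?h = "half_norm j *\<^sub>Z \<eta> j"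
  note B = inB_black[OF assms]
  have \<eta>: "\<eta> j \<in> Y_theta D" using assms by (rule Y_theta_coroot_black)
  then have h: "?h \<in> Y_theta D" "- ?h \<in> Y_theta D" by (auto intro: Y_theta_zscale Y_theta_minus)
  have d: "pair ?h (\<alpha> j) \<noteq> 0" using half_norm_pos[of j] by (simp add: pair_coroot_alpha)
  show E: "Ch (EE j) = 0" by (rule Ch_eq_0[OF B(1) inB_KK[OF h(1)] relations(3) d])
  show "Ch (FF j) = 0" by (rule Ch_eq_0[OF B(2) inB_KK[OF h(1)] relations(4)]) (use d in simp)
  let ?s = "inverse (qi D j - inverse (qi D j))"
  have "(EE j * FF j - FF j * EE j) - scal ?s * (KK ?h - KK (- ?h)) \<in> rel_ideal D"
    using relations(5)[of j j D] by (simp add: Kw_alpha)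
  from Ch_rel[OF this] have "?s * (Ch (KK ?h) - Ch (KK (- ?h))) = 0"
    using B inB_KK[OF h(1)] inB_KK[OF h(2)] E
    by (simp add: Ch_diff Ch_mult Ch_scal inB_mult inB_scal inB_uminus inB_add[of _ "- _", simplified])
  then have "Ch (KK ?h) = Ch (KK (- ?h))" using qi_diff_nonzero[of j] by simp
  then have "\<nu> ?h = - \<nu> ?h" using h by (simp add: Ch_KK qq_powi_inj \<nu>_minus)
  then show "\<nu> (\<eta> j) = 0" using \<nu>_zscale[OF \<eta>, of "half_norm j"] half_norm_pos[of j] by simp
qed

lemma tau_i0: "\<tau> i0 \<noteq> i0"
proof -
  have "p ! 0 \<noteq> p ! (length p - 1)" using len by (subst p_inj) auto
  then show ?thesis using p_0 p_last by simp
qed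

text \<open>\<open>Ch_eq_0\<close> needs some h in Y^Theta not orthogonal to \<alpha>_j: the coroot
  of a black neighbour, or the difference of the coroots of j and \<tau>(j) if there is
  none.\<close>

lemma Ch_BB:
  assumes j: "j \<notin> bl"
  shows "Ch (BB D c j) = 0"
proof -
  obtain h where h: "h \<in> Y_theta D" "pair h (\<alpha> j) \<noteq> 0"
  proof (cases "\<exists>k\<in>bl. a k j \<noteq> 0")
    case True
    then obtain k where k: "k \<in> bl" "a k j \<noteq> 0" by blast
    then have "pair (\<eta> k) (\<alpha> j) \<noteq> 0" by (simp add: pair_coroot_alpha)
    with Y_theta_coroot_black[OF k(1)] show ?thesis by (rule that)
  next
    case False
    \<comment> \<open>By \<open>white_cases\<close> a \<tau>-fixed white node other than i0 and
      \<tau>(i0) has a black neighbour; i0 and \<tau>(i0) are distinct as the ends of a path with at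
      least two nodes.\<close>
    then have tj: "\<tau> j \<noteq> j" using white_cases[OF j] tau_i0 tau_tau by metis
    have "\<eta> j - \<eta> (\<tau> j) \<in> Y_theta D"
      by (rule Y_theta_coroot_diff) (use False cartan_zero_sym in blast)
    moreover have "pair (\<eta> j - \<eta> (\<tau> j)) (\<alpha> j) \<noteq> 0"
      using cartan_nonpos[of "\<tau> j" j] tj by (simp add: pair_diff_left pair_coroot_alpha)
    ultimately show ?thesis by (rule that)
  qed
  show ?thesis
    by (rule Ch_eq_0[OF inB_BB[OF j] inB_KK[OF h(1)] BB_commute[OF h(1)]]) (use h(2) in simp)
qed

text \<open>Here B_j = F_j + c_j E_{\<tau>(j)} K, and both parameters agree because the form of
  \<alpha>_j and \<Theta>(\<alpha>_j) is 0. The commutator of B_j and B_{\<tau>(j)} reduces to a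
  nonzero multiple of K_{h'-h} - K_{h-h'}, where h and h' belong to \<alpha>_j and its image. A
  character kills commutators, so \<nu> (h - h') equals its negative.\<close>

lemma \<nu>_coroot_diff:
  assumes j: "j \<notin> bl" "\<tau> j \<noteq> j" and nb: "\<And>k. k \<in> bl \<Longrightarrow> a k j = 0" and orth: "a j (\<tau> j) = 0"
  shows "\<eta> j - \<eta> (\<tau> j) \<in> Y_theta D" "\<nu> (\<eta> j - \<eta> (\<tau> j)) = 0"
proof -
  let ?T = "\<tau> j" and ?d = "half_norm j"
  have nb': "a k ?T = 0" if "k \<in> bl" for k using nb[of "\<tau> k"] that cartan_tau_left[of k j] by simp
  have orth': "a ?T j = 0" using orth cartan_zero_sym by blast
  show \<eta>: "\<eta> j - \<eta> ?T \<in> Y_theta D"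
    by (rule Y_theta_coroot_diff) (use nb cartan_zero_sym in blast)
  have dT: "half_norm ?T = ?d" by (rule half_norm_tau)
  have qT: "qi D ?T = qi D j" by (simp add: qi_eq dT)
  have w: "actX D (w_black D) (\<alpha> ?T) = \<alpha> ?T"
    by (rule actX_fixes[OF w_black_in_lists]) (simp add: pair_coroot_alpha nb')
  have "form D (\<alpha> j) (thetaX D (\<alpha> j)) = 0"
    by (simp add: thetaX_def w additive.minus[OF additive_form] form_alpha orth)
  then have cT: "c ?T = c j" by (rule c_tau[OF j(1)])
  have br: "braid_word D (w_black D) (EE l) = EE l" if "l \<notin> bl" "\<And>k. k \<in> bl \<Longrightarrow> a k l = 0" for l
    by (rule braid_word_EE_fixed) (use w_black_in_lists that in \<open>auto simp: in_lists_conv_set\<close>)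
  define C :: "('i, 'y) free" where "C = scal (c j)"
  define s :: "('i, 'y) free" where "s = scal (inverse (qi D j - inverse (qi D j)))"
  \<comment> \<open>The factor in moving K_{-h} past E_j: the pairing of h = h_{\<alpha>_j} with
    \<alpha>_j is the squared norm, twice \<open>half_norm j\<close>.\<close>
  define q :: "('i, 'y) free" where "q = scal (qq powi (- (2 * ?d)))"
  let ?h = "?d *\<^sub>Z \<eta> j" and ?h' = "?d *\<^sub>Z \<eta> ?T"
  let ?K = "KK (- ?h)" and ?K' = "KK (- ?h')" and ?M = "KK ?h" and ?M' = "KK ?h'"
  let ?L = "KK (?h' - ?h)" and ?L' = "KK (?h - ?h')"
  have BBj: "BB D c j = FF j + C * EE ?T * ?K"
    using br[of ?T] nb' j(1) by (simp add: BB_def Kw_alpha C_def)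
  have BBT: "BB D c ?T = FF ?T + C * EE j * ?K'"
    using br[of j] nb j(1) by (simp add: BB_def Kw_alpha C_def cT dT)
  have r1: "FF j * FF ?T - FF ?T * FF j \<in> rel_ideal D" "EE ?T * EE j - EE j * EE ?T \<in> rel_ideal D"
    using orthogonal_commute[OF j(2)[symmetric] orth] orthogonal_commute[OF j(2) orth'] by blast+
  have r2: "?K * FF ?T - FF ?T * ?K \<in> rel_ideal D" "?K' * FF j - FF j * ?K' \<in> rel_ideal D"
    using relations(4)[of "- ?h" ?T D] relations(4)[of "- ?h'" j D]
    by (simp_all add: pair_coroot_alpha orth orth')
  have r3: "EE j * FF j - FF j * EE j - s * (?M - ?K) \<in> rel_ideal D"
    "EE ?T * FF ?T - FF ?T * EE ?T - s * (?M' - ?K') \<in> rel_ideal D"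
    using relations(5)[of j j D] relations(5)[of ?T ?T D]
    by (simp_all add: Kw_alpha s_def dT qT)
  have r4: "?K * EE j - q * EE j * ?K \<in> rel_ideal D" "?K' * EE ?T - q * EE ?T * ?K' \<in> rel_ideal D"
    using relations(3)[of "- ?h" j D] relations(3)[of "- ?h'" ?T D]
    by (simp_all add: pair_coroot_alpha q_def mult.commute)
  have r5: "EE ?T * q - q * EE ?T = 0" "EE j * q - q * EE j = 0"
    by (simp_all add: q_def scal_commute)
  have r6: "?K' * ?K - ?K * ?K' \<in> rel_ideal D"
    using homog_commute[OF homog_KK, of "- ?h'" "- ?h"] by simp
  have r7: "?M * ?K' - ?L' \<in> rel_ideal D" "?M' * ?K - ?L \<in> rel_ideal D"
    using relations(2)[of ?h "- ?h'" D] relations(2)[of ?h' "- ?h" D] by simp_all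
  have C: "x * C = C * x" for x unfolding C_def by (rule scal_commute)
  have m2: "C * EE ?T * (?K * FF ?T - FF ?T * ?K) \<in> rel_ideal D"
    and m3: "C * EE j * (?K' * FF j - FF j * ?K') \<in> rel_ideal D"
    and m4: "C * (EE j * FF j - FF j * EE j - s * (?M - ?K)) * ?K' \<in> rel_ideal D"
    and m5: "C * (EE ?T * FF ?T - FF ?T * EE ?T - s * (?M' - ?K')) * ?K \<in> rel_ideal D"
    and m7: "C * s * (?M * ?K' - ?L') \<in> rel_ideal D"
    and m8: "C * s * (?M' * ?K - ?L) \<in> rel_ideal D"
    and m9: "C * s * (?K' * ?K - ?K * ?K') \<in> rel_ideal D"
    by (rule rel_ideal_lmult rel_ideal_rmult r2 r3 r6 r7)+
  have z: "(EE ?T * q - q * EE ?T) * EE j * ?K * ?K' \<in> rel_ideal D"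
    "(EE j * q - q * EE j) * EE ?T * ?K' * ?K \<in> rel_ideal D"
    unfolding r5 mult_zero_left by (rule rel_ideal_zero)+
  \<comment> \<open>Assembles the bracket with prefactor C * C in
    \<open>commutator_identity\<close>.\<close>
  note m6 = rel_ideal_lmult[OF rel_ideal_diff[OF rel_ideal_add[OF rel_ideal_diff[OF rel_ideal_add[OF
    rel_ideal_diff[OF rel_ideal_rmult[OF rel_ideal_lmult[OF r4(1)]] rel_ideal_rmult[OF rel_ideal_lmult[OF r4(2)]]]
    z(1)] z(2)] rel_ideal_rmult[OF rel_ideal_rmult[OF rel_ideal_lmult[OF r1(2)]]]] rel_ideal_lmult[OF r6]], of "C * C"]
  have "BB D c j * BB D c ?T - BB D c ?T * BB D c j - C * s * (?L - ?L') \<in> rel_ideal D"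
    unfolding BBj BBT
    unfolding commutator_identity[OF C, of "FF j" "EE ?T" ?K "FF ?T" "EE j" ?K' s ?L ?L' ?M ?M' q]
    by (rule rel_ideal_diff[OF rel_ideal_add[OF rel_ideal_diff[OF rel_ideal_add[OF rel_ideal_add[OF
          rel_ideal_diff[OF rel_ideal_diff[OF rel_ideal_add[OF r1(1) m2] m3] m4] m5] m6] m7] m8] m9])
  then have "Ch (BB D c j * BB D c ?T - BB D c ?T * BB D c j) = Ch (C * s * (?L - ?L'))"
    by (rule Ch_rel)
  moreover have L: "?h' - ?h \<in> Y_theta D" "?h - ?h' \<in> Y_theta D"
    using Y_theta_zscale[OF \<eta>, of ?d] Y_theta_minus[OF Y_theta_zscale[OF \<eta>, of ?d]]
    by (simp_all add: zscale_diff_right)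
  moreover have B: "inB (BB D c j)" "inB (BB D c ?T)" using inB_BB j(1) by simp_all
  moreover have diff: "inB (x - y)" if "inB x" "inB y" for x y
    using inB_add[OF that(1) inB_uminus[OF that(2)]] by simp
  ultimately have "c j * inverse (qi D j - inverse (qi D j)) * (Ch ?L - Ch ?L') = 0"
    using Ch_BB[OF j(1)] Ch_BB[of ?T] j(1)
    by (simp add: Ch_diff Ch_mult inB_mult C_def s_def inB_scal Ch_scal inB_KK)
  then have "Ch ?L = Ch ?L'" using c_nonzero[OF j(1)] qi_diff_nonzero[of j] by simp
  then have "\<nu> (?h' - ?h) = \<nu> (?h - ?h')" using L by (simp add: Ch_KK qq_powi_inj)
  moreover have "\<nu> (?h' - ?h) = - \<nu> (?h - ?h')" using \<nu>_minus[OF L(2)] by simp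
  ultimately have "\<nu> (?d *\<^sub>Z (\<eta> j - \<eta> ?T)) = 0" by (simp add: zscale_diff_right)
  then show "\<nu> (\<eta> j - \<eta> ?T) = 0" using \<nu>_zscale[OF \<eta>, of ?d] half_norm_pos[of j] by simp
qed

text \<open>Write m h in coroots with coordinates z. On white nodes z is antisymmetric under \<tau>,
  so 2 m h is a sum of multiples of black coroots and of differences of coroots exchanged by \<tau>;
  the factor 2 appears because j and \<tau>(j) both contribute. The condition on the fundamental
  weight makes the coordinates at i0 and \<tau>(i0) vanish.\<close>

lemma Ch_KK_fund_weight:
  assumes h: "h \<in> Y_theta D" and fw: "fund_weight D i0 h = 0"
  shows "Ch (KK h) = 1"
proof -
  obtain m z where m: "m \<noteq> 0" "m *\<^sub>Z h = (\<Sum>j\<in>UNIV. z j *\<^sub>Z \<eta> j)" by (rule coroots_span)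
  have z_i0: "z i0 = 0" using fund_weight_coordinate[OF m, of i0] fw m(1) by simp
  have z_tau: "z (\<tau> j) = - z j" if "j \<notin> bl" for j by (rule Y_theta_coordinates[OF h m(2) that])
  define w where "w j = (if j \<in> bl then 0 else z j)" for j
  have w_tau: "w (\<tau> j) = - w j" for j using z_tau[of j] by (simp add: w_def)
  \<comment> \<open>The summand is 2 z_j times the coroot for black j and z_j times the difference
    of coroots for white j.\<close>
  define t where "t j = (2 * z j - 2 * w j) *\<^sub>Z \<eta> j + w j *\<^sub>Z (\<eta> j - \<eta> (\<tau> j))" for j
  have t: "t j \<in> Y_theta D \<and> \<nu> (t j) = 0" for j
  proof (cases "j \<in> bl")
    case True
    then show ?thesis
      using Y_theta_coroot_black[OF True] Ch_black(3)[OF True]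
      by (simp add: t_def w_def Y_theta_zscale \<nu>_zscale)
  next
    case False
    show ?thesis
    proof (cases "z j = 0")
      case True
      then show ?thesis using False by (simp add: t_def w_def Y_theta_zero \<nu>_zero)
    next
      case zj: False
      \<comment> \<open>Antisymmetry of z also excludes \<tau>-fixed white nodes, so only the A_1 x
        A_1 alternative of \<open>white_cases\<close> remains.\<close>
      then have "j \<noteq> i0" "j \<noteq> \<tau> i0" using z_i0 z_tau[OF white_i0] by auto
      moreover have "\<tau> j \<noteq> j" using z_tau[OF False] zj by auto
      ultimately have "\<forall>k\<in>bl. a k j = 0" "a j (\<tau> j) = 0" "\<tau> j \<noteq> j" using white_cases[OF False] by blast+
      then have "\<eta> j - \<eta> (\<tau> j) \<in> Y_theta D" "\<nu> (\<eta> j - \<eta> (\<tau> j)) = 0"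
        using \<nu>_coroot_diff[OF False] by blast+
      then show ?thesis using False by (simp add: t_def w_def Y_theta_zscale \<nu>_zscale)
    qed
  qed
  have bij: "bij \<tau>" by (rule involuntory_imp_bij) simp
  have "(\<Sum>j\<in>UNIV. w j *\<^sub>Z \<eta> (\<tau> j)) = (\<Sum>j\<in>UNIV. w (\<tau> j) *\<^sub>Z \<eta> (\<tau> (\<tau> j)))"
    by (rule sum.reindex_bij_betw[OF bij, symmetric])
  also have "\<dots> = - (\<Sum>j\<in>UNIV. w j *\<^sub>Z \<eta> j)" by (simp add: w_tau sum_negf)
  finally have wt: "(\<Sum>j\<in>UNIV. w j *\<^sub>Z \<eta> (\<tau> j)) = - (\<Sum>j\<in>UNIV. w j *\<^sub>Z \<eta> j)" .
  have two: "2 *\<^sub>Z (x::'y) = x + x" for x using zscale_add_left[of 1 1 x] by simp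
  have tj: "t j = 2 *\<^sub>Z (z j *\<^sub>Z \<eta> j) - w j *\<^sub>Z \<eta> j - w j *\<^sub>Z \<eta> (\<tau> j)" for j
    using two[of "w j *\<^sub>Z \<eta> j"]
    by (simp add: t_def zscale_diff_left zscale_diff_right flip: zscale_zscale)
  have "sum t UNIV = 2 *\<^sub>Z (m *\<^sub>Z h)"
    by (simp add: tj sum_subtractf wt m(2) zscale_sum_right)
  then have "\<nu> ((2 * m) *\<^sub>Z h) = 0" using \<nu>_sum[of UNIV t] t by (simp add: zscale_zscale)
  then have "\<nu> h = 0" using \<nu>_zscale[OF h, of "2 * m"] m(1) by simp
  then show ?thesis using Ch_KK[OF h] by simp
qed

theorem character_on_C:
  assumes "b \<in> QSP_C D c i0"
  shows "\<chi> b = counit b"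
proof -
  have black: "\<chi> b = counit b" if "b \<in> black_gens D" for b
  proof -
    from that obtain j where j: "j \<in> bl"
      "b \<in> {cls D (EE j), cls D (FF j), cls D (Kw D (\<alpha> j)), cls D (Kw D (- \<alpha> j))}" by blast
    have \<eta>: "\<eta> j \<in> Y_theta D" using j(1) by (rule Y_theta_coroot_black)
    have h: "Ch (KK (half_norm j *\<^sub>Z \<eta> j)) = 1" "Ch (KK (- (half_norm j *\<^sub>Z \<eta> j))) = 1"
      using Ch_KK[OF Y_theta_zscale[OF \<eta>, of "half_norm j"]] Ch_KK[OF Y_theta_minus[OF Y_theta_zscale[OF \<eta>, of "half_norm j"]]]
        \<nu>_minus[OF Y_theta_zscale[OF \<eta>, of "half_norm j"]] \<nu>_zscale[OF \<eta>, of "half_norm j"] Ch_black(3)[OF j(1)] by simp_all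
    show ?thesis using j(2) Ch_black(1,2)[OF j(1)] h by (auto simp: counit_cls) (simp_all add: Kw_alpha)
  qed
  have U: "b \<in> QSP_B D c \<and> \<chi> b = counit b" if "b \<in> U_black D" for b
  proof -
    have sub: "black_gens D \<subseteq> carrier (UU D)" by auto
    show ?thesis using that[unfolded U_black_def] sub
    proof (induction rule: subalg_induct)
      case (gen x)
      then show ?case using black[OF gen] black_gens_C[of D c i0] QSP_C_subset_B[of D c i0] by blast
    qed (auto simp: inB_add inB_mult inB_scal Ch_add Ch_mult Ch_scal counit_cls)
  qed
  from assms[unfolded QSP_C_def] B_gens_subset have "b \<in> QSP_B D c \<and> \<chi> b = counit b"
  proof (induction rule: subalg_induct)
    case (gen x)
    then consider "x \<in> U_black D" | h where "x = cls D (KK h)" "h \<in> Y_theta D" "fund_weight D i0 h = 0"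
      | j where "x = cls D (BB D c j)" "j \<notin> bl"
      by (auto simp: B_gen_eq)
    then show ?case
    proof cases
      case 1
      then show ?thesis by (rule U)
    next
      case 2
      then show ?thesis using inB_KK Ch_KK_fund_weight by (simp add: counit_cls)
    next
      case 3
      then show ?thesis using inB_BB Ch_BB by (simp add: counit_cls)
    qed
  qed (auto simp: inB_add inB_mult inB_scal Ch_add Ch_mult Ch_scal counit_cls)
  then show ?thesis by blast
qed

end

section \<open>Matrix coefficients\<close>

text \<open>A weight module written in its weight basis, so that every K_h is diagonal and weight
  components can be cut out entry by entry.\<close>

definition weight_rep ::
  "('i, 'x::ab_group_add, 'y::ab_group_add) satake_datum \<Rightarrow> nat \<Rightarrow>
   (('i, 'y) free set \<Rightarrow> kk mat) \<Rightarrow> (nat \<Rightarrow> 'x) \<Rightarrow> bool" where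
  "weight_rep D d \<sigma> wt \<longleftrightarrow>
     (\<forall>t. \<sigma> (cls D t) \<in> carrier_mat d d) \<and>
     (\<forall>s t. \<sigma> (cls D (s + t)) = \<sigma> (cls D s) + \<sigma> (cls D t)) \<and>
     (\<forall>s t. \<sigma> (cls D (s * t)) = \<sigma> (cls D s) * \<sigma> (cls D t)) \<and>
     (\<forall>s. \<sigma> (cls D (scal s)) = s \<cdot>\<^sub>m 1\<^sub>m d) \<and>
     (\<forall>h. \<sigma> (cls D (KK h)) = mat d d (\<lambda>(i, j). if i = j then qq powi pairing D h (wt j) else 0))"

lemma sum_delta_delta:
  fixes x :: "nat \<Rightarrow> kk"
  assumes "j < d"
  shows "(\<Sum>k = 0..<d. (if i = k then x k else 0) * (if k = j then 1 else 0)) = (if i = j then x j else 0)"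
    "(\<Sum>k = 0..<d. (if j = k then x k else 0) * (if k = j then 1 else 0)) = x j"
proof -
  have "(\<Sum>k = 0..<d. (if i = k then x k else 0) * (if k = j then 1 else 0))
      = (\<Sum>k = 0..<d. if k = j then (if i = k then x k else 0) else 0)" for i
    by (rule sum.cong) auto
  then show "(\<Sum>k = 0..<d. (if i = k then x k else 0) * (if k = j then 1 else 0)) = (if i = j then x j else 0)"
    "(\<Sum>k = 0..<d. (if j = k then x k else 0) * (if k = j then 1 else 0)) = x j"
    using assms by simp_all
qed

text \<open>The vectors are functions rather than elements of \<open>carrier_vec\<close>, so that
  passing to a weight component is a pointwise \<open>if\<close>.\<close>

definition bil :: "nat \<Rightarrow> kk mat \<Rightarrow> (nat \<Rightarrow> kk) \<Rightarrow> (nat \<Rightarrow> kk) \<Rightarrow> kk" where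
  "bil d A z u = (\<Sum>i<d. \<Sum>j<d. z i * A $$ (i, j) * u j)"

lemma bil_eq: "A \<in> carrier_mat d d \<Longrightarrow> vec d z \<bullet> (A *\<^sub>v vec d u) = bil d A z u"
  by (auto simp: bil_def scalar_prod_def atLeast0LessThan sum_distrib_left mult.assoc intro!: sum.cong)

lemma weight_rep_coeff:
  assumes \<sigma>: "weight_rep D d \<sigma> wt"
  shows "(\<lambda>x. if x \<in> carrier (UU D) then bil d (\<sigma> x) z u else 0) \<in> matrix_coeffs D"
proof -
  note rep = \<sigma>[unfolded weight_rep_def]
  have "\<sigma> \<in> Ring.ring_hom (UU D) (ring_mat TYPE(kk) d ())"
  proof (rule ring_hom_memI)
    fix x y assume "x \<in> carrier (UU D)" "y \<in> carrier (UU D)"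
    then obtain s t where "x = cls D s" "y = cls D t" by (auto simp: carrier_UU)
    then show "\<sigma> (x \<otimes>\<^bsub>UU D\<^esub> y) = \<sigma> x \<otimes>\<^bsub>ring_mat TYPE(kk) d ()\<^esub> \<sigma> y"
      "\<sigma> (x \<oplus>\<^bsub>UU D\<^esub> y) = \<sigma> x \<oplus>\<^bsub>ring_mat TYPE(kk) d ()\<^esub> \<sigma> y"
      "\<sigma> x \<in> carrier (ring_mat TYPE(kk) d ())"
      using rep by (simp_all add: ring_mat_def flip: cls_add cls_mult)
  next
    have "\<sigma> (cls D (scal 1)) = 1 \<cdot>\<^sub>m 1\<^sub>m d" using rep by blast
    then show "\<sigma> \<one>\<^bsub>UU D\<^esub> = \<one>\<^bsub>ring_mat TYPE(kk) d ()\<^esub>" 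
      by (simp add: cls_one ring_mat_def) (auto intro!: eq_matI)
  qed
  moreover have "\<exists>P (wt :: nat \<Rightarrow> 'b). P \<in> carrier_mat d d \<and> invertible_mat P \<and>
        (\<forall>j < d. \<forall>h. \<sigma> (cls D (KK h)) *\<^sub>v col P j = qq powi pairing D h (wt j) \<cdot>\<^sub>v col P j)"
  proof (intro exI[of _ "1\<^sub>m d"] exI[of _ wt] conjI allI impI)
    show "invertible_mat (1\<^sub>m d :: kk mat)"
      unfolding invertible_mat_def inverts_mat_def by (auto intro: exI[of _ "1\<^sub>m d"])
    fix j h assume j: "j < d"
    have "\<sigma> (cls D (KK h)) = mat d d (\<lambda>(i, j). if i = j then qq powi pairing D h (wt j) else 0)"
      using rep by blast
    then show "\<sigma> (cls D (KK h)) *\<^sub>v col (1\<^sub>m d) j = qq powi pairing D h (wt j) \<cdot>\<^sub>v col (1\<^sub>m d) j"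
      using j by (intro eq_vecI) (auto simp: unit_vec_def scalar_prod_def sum_delta_delta)
  qed simp
  ultimately have "weight_module D d \<sigma>"
    unfolding weight_module_def using rep by blast
  moreover have "bil d (\<sigma> x) z u = vec d z \<bullet> (\<sigma> x *\<^sub>v vec d u)" if "x \<in> carrier (UU D)" for x
  proof -
    from that obtain t where "x = cls D t" by (auto simp: carrier_UU)
    then show ?thesis using rep by (intro bil_eq[symmetric]) simp
  qed
  ultimately show ?thesis
    unfolding matrix_coeffs_def
    by (intro CollectI exI[of _ d] exI[of _ \<sigma>] exI[of _ "vec d u"] exI[of _ "vec d z"]) auto
qed

text \<open>Conjugation by the matrix P of weight vectors makes all K_h diagonal; the covector is
  transformed by the transpose of P and the vector by its inverse, which leaves the coefficient
  unchanged.\<close>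

lemma matrix_coeff_bil:
  assumes "f \<in> matrix_coeffs D"
  obtains d \<sigma> wt z u where "weight_rep D d \<sigma> wt"
    "f = (\<lambda>x. if x \<in> carrier (UU D) then bil d (\<sigma> x) z u else 0)"
proof -
  from assms obtain d \<rho> v w where "weight_module D d \<rho>" and v: "v \<in> carrier_vec d" "w \<in> carrier_vec d"
    and f: "f = (\<lambda>x. if x \<in> carrier (UU D) then w \<bullet> (\<rho> x *\<^sub>v v) else 0)"
    unfolding matrix_coeffs_def by blast
  then obtain P wt where hom: "\<rho> \<in> Ring.ring_hom (UU D) (ring_mat TYPE(kk) d ())"
    and sc: "\<And>s. \<rho> (cls D (scal s)) = s \<cdot>\<^sub>m 1\<^sub>m d"
    and P: "P \<in> carrier_mat d d" "invertible_mat P"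
    and wt: "\<And>j h. j < d \<Longrightarrow> \<rho> (cls D (KK h)) *\<^sub>v col P j = qq powi pairing D h (wt j) \<cdot>\<^sub>v col P j"
    unfolding weight_module_def by blast
  from P(2) obtain Q where 1: "P * Q = 1\<^sub>m (dim_row P)" and 2: "Q * P = 1\<^sub>m (dim_row Q)"
    unfolding invertible_mat_def inverts_mat_def by blast
  have dP: "dim_row P = d" "dim_col P = d" using P(1) by simp_all
  have dQ: "dim_row Q = d" "dim_col Q = d"
    using arg_cong[OF 1, of dim_col] arg_cong[OF 2, of dim_col] dP by simp_all
  note Q = carrier_matI[OF dQ] 1[unfolded dP(1)] 2[unfolded dQ(1)]
  have \<rho>: "\<rho> (cls D t) \<in> carrier_mat d d" for t
    using ring_hom_closed[OF hom, of "cls D t"] by (simp add: ring_mat_def)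
  have PQ: "P * (Q * A) = A" if "A \<in> carrier_mat d d" for A
    unfolding assoc_mult_mat[OF P(1) Q(1) that, symmetric] Q(2) using that by (rule left_mult_one_mat)
  define \<sigma> where "\<sigma> x = Q * \<rho> x * P" for x
  have rep: "weight_rep D d \<sigma> wt"
    unfolding weight_rep_def
  proof (intro conjI allI)
    show "\<sigma> (cls D t) \<in> carrier_mat d d" for t
      unfolding \<sigma>_def using P(1) Q(1) \<rho> by (metis mult_carrier_mat)
    show "\<sigma> (cls D (s + t)) = \<sigma> (cls D s) + \<sigma> (cls D t)" for s t
      using ring_hom_add[OF hom, of "cls D s" "cls D t"]
        mult_add_distrib_mat[OF Q(1) \<rho>[of s] \<rho>[of t]]
        add_mult_distrib_mat[OF mult_carrier_mat[OF Q(1) \<rho>[of s]] mult_carrier_mat[OF Q(1) \<rho>[of t]] P(1)]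
      by (simp add: \<sigma>_def cls_add ring_mat_def)
    show "\<sigma> (cls D (s * t)) = \<sigma> (cls D s) * \<sigma> (cls D t)" for s t
    proof -
      let ?A = "\<rho> (cls D s)" and ?B = "\<rho> (cls D t)"
      have BP: "?B * P \<in> carrier_mat d d" and QA: "Q * ?A \<in> carrier_mat d d"
        by (rule mult_carrier_mat[OF \<rho> P(1)], rule mult_carrier_mat[OF Q(1) \<rho>])
      have "\<sigma> (cls D s) * \<sigma> (cls D t) = Q * ?A * P * (Q * (?B * P))"
        by (simp only: \<sigma>_def assoc_mult_mat[OF Q(1) \<rho>[of t] P(1)])
      also have "\<dots> = Q * ?A * (P * (Q * (?B * P)))"
        by (rule assoc_mult_mat[OF QA P(1) mult_carrier_mat[OF Q(1) BP]])
      also have "\<dots> = Q * ?A * ?B * P"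
        by (simp only: PQ[OF BP] assoc_mult_mat[OF QA \<rho>[of t] P(1)])
      also have "\<dots> = Q * (?A * ?B) * P" by (simp only: assoc_mult_mat[OF Q(1) \<rho>[of s] \<rho>[of t]])
      finally show ?thesis
        using ring_hom_mult[OF hom, of "cls D s" "cls D t"] by (simp add: \<sigma>_def cls_mult ring_mat_def)
    qed
    show "\<sigma> (cls D (scal s)) = s \<cdot>\<^sub>m 1\<^sub>m d" for s
      using P(1) Q by (simp add: \<sigma>_def sc mult_smult_distrib[of _ d d _ d] mult_smult_assoc_mat[of _ d d _ d])
    fix h
    let ?\<Delta> = "mat d d (\<lambda>(i, j). if i = j then qq powi pairing D h (wt j) else 0)"
    have "\<rho> (cls D (KK h)) * P = P * ?\<Delta>"
    proof (rule mat_col_eqI)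
      fix j assume "j < dim_col (P * ?\<Delta>)"
      then have j: "j < d" by simp
      have "col (\<rho> (cls D (KK h)) * P) j = \<rho> (cls D (KK h)) *\<^sub>v col P j"
        by (rule col_mult2[OF \<rho> P(1) j])
      also have "\<dots> = qq powi pairing D h (wt j) \<cdot>\<^sub>v col P j" by (rule wt[OF j])
      also have "\<dots> = col (P * ?\<Delta>) j"
        using P(1) j by (intro eq_vecI) (auto simp: scalar_prod_def if_distrib sum.delta mult.commute cong: if_cong)
      finally show "col (\<rho> (cls D (KK h)) * P) j = col (P * ?\<Delta>) j" .
    qed (use P(1) \<rho>[of "KK h"] in auto)
    then have "\<sigma> (cls D (KK h)) = Q * (P * ?\<Delta>)"
      unfolding \<sigma>_def using assoc_mult_mat[OF Q(1) \<rho>[of "KK h"] P(1)] by simp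
    also have "\<dots> = Q * P * ?\<Delta>" by (rule assoc_mult_mat[symmetric, of _ d d _ d _ d]) (use P(1) Q(1) in auto)
    also have "\<dots> = ?\<Delta>" unfolding Q(3) by (rule left_mult_one_mat[of _ d d]) simp
    finally show "\<sigma> (cls D (KK h)) = ?\<Delta>" .
  qed
  define z where "z = transpose_mat P *\<^sub>v w"
  define u where "u = Q *\<^sub>v v"
  have zu: "z \<in> carrier_vec d" "u \<in> carrier_vec d" using P(1) Q(1) v by (auto simp: z_def u_def)
  have "w \<bullet> (\<rho> x *\<^sub>v v) = bil d (\<sigma> x) (($) z) (($) u)" if "x \<in> carrier (UU D)" for x
  proof -
    from that obtain t where t: "x = cls D t" by (auto simp: carrier_UU)
    have \<sigma>t: "\<sigma> x \<in> carrier_mat d d" using rep unfolding t weight_rep_def by blast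
    have v': "P *\<^sub>v u = v"
      unfolding u_def assoc_mult_mat_vec[OF P(1) Q(1) v(1), symmetric] Q(2) using v(1) by (rule one_mult_mat_vec)
    have "\<rho> x *\<^sub>v v = P *\<^sub>v (\<sigma> x *\<^sub>v u)"
    proof -
      have "P * \<sigma> x = \<rho> x * P"
        unfolding \<sigma>_def t using P(1) Q \<rho>[of t] PQ[of "\<rho> (cls D t) * P"] by (simp add: assoc_mult_mat[of _ d d _ d _ d])
      then have "P *\<^sub>v (\<sigma> x *\<^sub>v u) = \<rho> x *\<^sub>v (P *\<^sub>v u)"
        using assoc_mult_mat_vec[OF P(1) \<sigma>t zu(2)] assoc_mult_mat_vec[OF \<rho>[of t] P(1) zu(2)] t by simp
      then show ?thesis by (simp add: v')
    qed
    then have "w \<bullet> (\<rho> x *\<^sub>v v) = z \<bullet> (\<sigma> x *\<^sub>v u)"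
      unfolding z_def using transpose_vec_mult_scalar[OF P(1) _ v(2), of "\<sigma> x *\<^sub>v u"] \<sigma>t zu by simp
    also have "\<dots> = vec d (($) z) \<bullet> (\<sigma> x *\<^sub>v vec d (($) u))" 
    proof -
      have "vec d (($) z) = z" "vec d (($) u) = u" using zu by (auto intro!: eq_vecI)
      then show ?thesis by simp
    qed
    also have "\<dots> = bil d (\<sigma> x) (($) z) (($) u)" by (rule bil_eq[OF \<sigma>t])
    finally show ?thesis .
  qed
  then have "f = (\<lambda>x. if x \<in> carrier (UU D) then bil d (\<sigma> x) (($) z) (($) u) else 0)"
    unfolding f by (intro ext) simp
  with rep show thesis by (rule that)
qed

lemma matrix_coeffs_zero: "(\<lambda>_. 0) \<in> matrix_coeffs D"
proof -
  have "weight_rep D 0 (\<lambda>_. 0\<^sub>m 0 0) (\<lambda>_. 0)"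
    unfolding weight_rep_def by (auto intro!: eq_matI)
  from weight_rep_coeff[OF this, of "\<lambda>_. 0" "\<lambda>_. 0"] show ?thesis by (simp add: bil_def cong: if_cong)
qed

lemma sum_split_add: "(\<Sum>i<m + (n::nat). f i) = (\<Sum>i<m. f i) + (\<Sum>i<n. f (m + i) :: kk)"
  by (induction n) (simp_all add: add.assoc)

text \<open>The sum is a coefficient of the direct sum of the two modules, realized by block
  diagonal matrices.\<close>

lemma matrix_coeffs_add:
  assumes "f \<in> matrix_coeffs D" "g \<in> matrix_coeffs D"
  shows "(\<lambda>x. f x + g x) \<in> matrix_coeffs D"
proof -
  obtain d1 \<sigma>1 wt1 z1 u1 where 1: "weight_rep D d1 \<sigma>1 wt1"
    "f = (\<lambda>x. if x \<in> carrier (UU D) then bil d1 (\<sigma>1 x) z1 u1 else 0)"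
    using matrix_coeff_bil[OF assms(1)] .
  obtain d2 \<sigma>2 wt2 z2 u2 where 2: "weight_rep D d2 \<sigma>2 wt2"
    "g = (\<lambda>x. if x \<in> carrier (UU D) then bil d2 (\<sigma>2 x) z2 u2 else 0)"
    using matrix_coeff_bil[OF assms(2)] .
  note r1 = 1(1)[unfolded weight_rep_def] and r2 = 2(1)[unfolded weight_rep_def]
  have c: "\<sigma>1 (cls D t) \<in> carrier_mat d1 d1" "\<sigma>2 (cls D t) \<in> carrier_mat d2 d2" for t
    using r1 r2 by blast+
  define \<sigma> where "\<sigma> x = four_block_mat (\<sigma>1 x) (0\<^sub>m d1 d2) (0\<^sub>m d2 d1) (\<sigma>2 x)" for x
  define wt where "wt j = (if j < d1 then wt1 j else wt2 (j - d1))" for j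
  define z where "z j = (if j < d1 then z1 j else z2 (j - d1))" for j
  define u where "u j = (if j < d1 then u1 j else u2 (j - d1))" for j
  have "weight_rep D (d1 + d2) \<sigma> wt"
    unfolding weight_rep_def
  proof (intro conjI allI)
    show "\<sigma> (cls D t) \<in> carrier_mat (d1 + d2) (d1 + d2)" for t
      using c[of t] by (simp add: \<sigma>_def)
    show "\<sigma> (cls D (s + t)) = \<sigma> (cls D s) + \<sigma> (cls D t)" for s t
    proof -
      have "\<sigma> (cls D s) + \<sigma> (cls D t) = four_block_mat (\<sigma>1 (cls D s) + \<sigma>1 (cls D t))
          (0\<^sub>m d1 d2 + 0\<^sub>m d1 d2) (0\<^sub>m d2 d1 + 0\<^sub>m d2 d1) (\<sigma>2 (cls D s) + \<sigma>2 (cls D t))"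
        unfolding \<sigma>_def by (rule add_four_block_mat[OF c(1) _ _ c(2) c(1) _ _ c(2)]) simp_all
      then show ?thesis using r1 r2 by (simp add: \<sigma>_def)
    qed
    show "\<sigma> (cls D (s * t)) = \<sigma> (cls D s) * \<sigma> (cls D t)" for s t
    proof -
      have "\<sigma> (cls D s) * \<sigma> (cls D t) = four_block_mat
          (\<sigma>1 (cls D s) * \<sigma>1 (cls D t) + 0\<^sub>m d1 d2 * 0\<^sub>m d2 d1) (\<sigma>1 (cls D s) * 0\<^sub>m d1 d2 + 0\<^sub>m d1 d2 * \<sigma>2 (cls D t))
          (0\<^sub>m d2 d1 * \<sigma>1 (cls D t) + \<sigma>2 (cls D s) * 0\<^sub>m d2 d1) (0\<^sub>m d2 d1 * 0\<^sub>m d1 d2 + \<sigma>2 (cls D s) * \<sigma>2 (cls D t))"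
        unfolding \<sigma>_def by (rule mult_four_block_mat[OF c(1) _ _ c(2) c(1) _ _ c(2)]) simp_all
      also have "\<dots> = four_block_mat (\<sigma>1 (cls D s) * \<sigma>1 (cls D t)) (0\<^sub>m d1 d2) (0\<^sub>m d2 d1) (\<sigma>2 (cls D s) * \<sigma>2 (cls D t))"
        using c[of s] c[of t] by (intro cong_four_block_mat) (auto simp: right_add_zero_mat[of _ d1 d1] left_add_zero_mat[of _ d2 d2])
      finally show ?thesis using r1 r2 by (simp add: \<sigma>_def)
    qed
    show "\<sigma> (cls D (scal s)) = s \<cdot>\<^sub>m 1\<^sub>m (d1 + d2)" for s
      using r1 r2 by (auto simp: \<sigma>_def intro!: eq_matI)
    show "\<sigma> (cls D (KK h)) = mat (d1 + d2) (d1 + d2) (\<lambda>(i, j). if i = j then qq powi pairing D h (wt j) else 0)" for h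
      using r1 r2 by (auto simp: \<sigma>_def wt_def intro!: eq_matI)
  qed
  from weight_rep_coeff[OF this, of z u]
  have "(\<lambda>x. if x \<in> carrier (UU D) then bil (d1 + d2) (\<sigma> x) z u else 0) \<in> matrix_coeffs D" .
  also have "(\<lambda>x. if x \<in> carrier (UU D) then bil (d1 + d2) (\<sigma> x) z u else 0) = (\<lambda>x. f x + g x)"
  proof
    fix x
    show "(if x \<in> carrier (UU D) then bil (d1 + d2) (\<sigma> x) z u else 0) = f x + g x"
    proof (cases "x \<in> carrier (UU D)")
      case True
      then obtain t where t: "x = cls D t" by (auto simp: carrier_UU)
      have d: "dim_row (\<sigma>1 x) = d1" "dim_col (\<sigma>1 x) = d1" "dim_row (\<sigma>2 x) = d2" "dim_col (\<sigma>2 x) = d2"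
        unfolding t by (rule carrier_matD[OF c(1)] carrier_matD[OF c(2)])+
      have "bil (d1 + d2) (\<sigma> x) z u = bil d1 (\<sigma>1 x) z1 u1 + bil d2 (\<sigma>2 x) z2 u2"
        unfolding bil_def sum_split_add
        by (simp add: \<sigma>_def z_def u_def d)
      then show ?thesis using True 1(2) 2(2) by simp
    qed (simp add: 1(2) 2(2))
  qed
  finally show ?thesis .
qed

lemma matrix_coeffs_sum: "(\<And>p. p \<in> S \<Longrightarrow> g p \<in> matrix_coeffs D) \<Longrightarrow> (\<lambda>x. \<Sum>p\<in>S. g p x) \<in> matrix_coeffs D"
  by (induction S rule: infinite_finite_induct) (simp_all add: matrix_coeffs_zero matrix_coeffs_add)

lemma weight_rep_KK:
  assumes \<sigma>: "weight_rep D d \<sigma> wt" and ij: "i < d" "j < d"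
  shows "\<sigma> (cls D (t * KK h)) $$ (i, j) = \<sigma> (cls D t) $$ (i, j) * qq powi pairing D h (wt j)"
    and "\<sigma> (cls D (KK h * t)) $$ (i, j) = qq powi pairing D h (wt i) * \<sigma> (cls D t) $$ (i, j)"
proof -
  note rep = \<sigma>[unfolded weight_rep_def]
  have c: "\<sigma> (cls D t) \<in> carrier_mat d d" using rep by blast
  have K: "\<sigma> (cls D (KK h)) = mat d d (\<lambda>(i, j). if i = j then qq powi pairing D h (wt j) else 0)"
    using rep by blast
  have m: "\<sigma> (cls D (t * KK h)) = \<sigma> (cls D t) * \<sigma> (cls D (KK h))"
    "\<sigma> (cls D (KK h * t)) = \<sigma> (cls D (KK h)) * \<sigma> (cls D t)" using rep by blast+
  show "\<sigma> (cls D (t * KK h)) $$ (i, j) = \<sigma> (cls D t) $$ (i, j) * qq powi pairing D h (wt j)"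
    unfolding m K using c ij
    by (auto simp: scalar_prod_def if_distrib sum.delta cong: if_cong)
  show "\<sigma> (cls D (KK h * t)) $$ (i, j) = qq powi pairing D h (wt i) * \<sigma> (cls D t) $$ (i, j)"
    unfolding m K using c ij
    by (auto simp: scalar_prod_def if_distrib if_distribR sum.delta cong: if_cong)
qed

lemma matrix_coeff_outside: "f \<in> matrix_coeffs D \<Longrightarrow> x \<notin> carrier (UU D) \<Longrightarrow> f x = 0"
  unfolding matrix_coeffs_def by auto

lemma matrix_coeff_add:
  assumes "f \<in> matrix_coeffs D"
  shows "f (cls D (s + t)) = f (cls D s) + f (cls D t)"
proof -
  obtain d \<sigma> wt z u where 1: "weight_rep D d \<sigma> wt"
    "f = (\<lambda>x. if x \<in> carrier (UU D) then bil d (\<sigma> x) z u else 0)"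
    using matrix_coeff_bil[OF assms] .
  note rep = 1(1)[unfolded weight_rep_def]
  have c: "\<sigma> (cls D t) \<in> carrier_mat d d" "\<sigma> (cls D (s + t)) = \<sigma> (cls D s) + \<sigma> (cls D t)" using rep by blast+
  show ?thesis using c
    by (simp add: 1(2) bil_def c(2) algebra_simps sum.distrib)
qed

lemma matrix_coeff_scal:
  assumes "f \<in> matrix_coeffs D"
  shows "f (cls D (scal s * t)) = s * f (cls D t)"
proof -
  obtain d \<sigma> wt z u where 1: "weight_rep D d \<sigma> wt"
    "f = (\<lambda>x. if x \<in> carrier (UU D) then bil d (\<sigma> x) z u else 0)"
    using matrix_coeff_bil[OF assms] .
  note rep = 1(1)[unfolded weight_rep_def]
  have c: "\<sigma> (cls D t) \<in> carrier_mat d d" using rep by blast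
  have "\<sigma> (cls D (scal s * t)) = s \<cdot>\<^sub>m 1\<^sub>m d * \<sigma> (cls D t)" using rep by simp
  also have "\<dots> = s \<cdot>\<^sub>m \<sigma> (cls D t)" using c by (simp add: mult_smult_assoc_mat[of _ d d _ d])
  finally show ?thesis using c by (simp add: 1(2) bil_def sum_distrib_left ac_simps)
qed

text \<open>Dedekind's argument: subtracting m0(h) times the relation at h' from the relation at h +
  h' removes m0, and induction applies. It is stated relative to a set H because Y^Theta is a subset
  of the type of Y.\<close>

lemma dedekind_independence:
  fixes M :: "('h::comm_monoid_add \<Rightarrow> kk) set"
  assumes "finite M" and H: "0 \<in> H" "\<And>h h'. h \<in> H \<Longrightarrow> h' \<in> H \<Longrightarrow> h + h' \<in> H"
    and hom: "\<And>m. m \<in> M \<Longrightarrow> m 0 = 1"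
      "\<And>m h h'. m \<in> M \<Longrightarrow> h \<in> H \<Longrightarrow> h' \<in> H \<Longrightarrow> m (h + h') = m h * m h'"
    and distinct: "\<And>m m'. m \<in> M \<Longrightarrow> m' \<in> M \<Longrightarrow> (\<And>h. h \<in> H \<Longrightarrow> m h = m' h) \<Longrightarrow> m = m'"
    and zero: "\<And>h. h \<in> H \<Longrightarrow> (\<Sum>m\<in>M. C m * m h) = 0"
    and "m \<in> M"
  shows "C m = 0"
  using assms(1) hom distinct zero \<open>m \<in> M\<close>
proof (induction M arbitrary: C m rule: finite_induct)
  case (insert m0 M)
  have C0: "C m = 0" if m: "m \<in> M" for m
  proof -
    have *: "C m * (m h - m0 h) = 0" if h: "h \<in> H" for h
    proof (rule insert.IH[of "\<lambda>m. C m * (m h - m0 h)"])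
      fix h' assume h': "h' \<in> H"
      have "(\<Sum>m\<in>insert m0 M. C m * m (h + h')) = (\<Sum>m\<in>insert m0 M. C m * (m h * m h'))"
        using insert.prems(2) h h' by (intro sum.cong) auto
      then have "(\<Sum>m\<in>M. C m * (m h - m0 h) * m h')
          = (\<Sum>m\<in>insert m0 M. C m * m (h + h')) - m0 h * (\<Sum>m\<in>insert m0 M. C m * m h')"
        using insert.hyps by (simp add: sum_distrib_left sum_subtractf algebra_simps)
      then show "(\<Sum>m\<in>M. C m * (m h - m0 h) * m h') = 0"
        using insert.prems(4) H(2) h h' by simp
    qed (use insert.prems m in \<open>simp_all\<close>)
    show ?thesis
    proof (rule ccontr)
      assume "C m \<noteq> 0"
      then have "m h = m0 h" if "h \<in> H" for h using *[OF that] by simp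
      then have "m = m0" using insert.prems(3)[of m m0] m by blast
      then show False using m insert.hyps by blast
    qed
  qed
  moreover have "C m0 = 0"
    using insert.prems(4)[OF H(1)] insert.prems(1)[of m0] C0 insert.hyps by simp
  ultimately show ?case using insert.prems(5) by blast
qed simp

section \<open>Spherical functions\<close>

text \<open>One predicate for both sides, so that the arguments for B acting on the right and for B'
  acting on the left are given once.\<close>

definition eig ::
  "('i, 'x::ab_group_add, 'y::ab_group_add) satake_datum \<Rightarrow> bool \<Rightarrow> (('i, 'y) free set \<Rightarrow> kk) \<Rightarrow>
   ('i, 'y) free set \<Rightarrow> kk \<Rightarrow> bool" where
  "eig D sd g y s \<longleftrightarrow>
     (\<forall>x. g (if sd then cls D x \<otimes>\<^bsub>UU D\<^esub> y else y \<otimes>\<^bsub>UU D\<^esub> cls D x) = s * g (cls D x))"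

lemma eig_cls:
  "eig D sd g (cls D t) s \<longleftrightarrow> (\<forall>x. g (cls D (if sd then x * t else t * x)) = s * g (cls D x))"
  unfolding eig_def by (cases sd) (simp_all add: cls_mult)

lemma eig_scal: "g \<in> matrix_coeffs D \<Longrightarrow> eig D sd g (cls D (scal s)) s"
  by (simp add: eig_cls scal_commute matrix_coeff_scal)

lemma eig_add:
  assumes "g \<in> matrix_coeffs D" "eig D sd g (cls D t) r" "eig D sd g (cls D t') r'"
  shows "eig D sd g (cls D (t + t')) (r + r')"
  using assms(2,3) unfolding eig_cls
  by (cases sd) (simp_all add: distrib_left distrib_right matrix_coeff_add[OF assms(1)])

lemma eig_mult:
  assumes "eig D sd g (cls D t) r" "eig D sd g (cls D t') r'"
  shows "eig D sd g (cls D (t * t')) (r * r')"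
  using assms unfolding eig_cls
  by (cases sd) (simp_all add: mult.assoc[symmetric], simp_all add: mult.assoc)

lemma eig_counit_subalg:
  assumes g: "g \<in> matrix_coeffs D" and S: "S \<subseteq> carrier (UU D)"
    and gen: "\<And>y. y \<in> S \<Longrightarrow> eig D sd g y (counit y)" and y: "y \<in> subalg D S"
  shows "eig D sd g y (counit y)"
  using y S
proof (induction rule: subalg_induct)
  case (scal s)
  then show ?case using eig_scal[OF g] by (simp add: counit_cls)
next
  case (gen y)
  then show ?case by (rule assms(3))
next
  case (add x y)
  then show ?case using eig_add[OF g] by (simp add: counit_cls)
next
  case (mult x y)
  then show ?case using eig_mult by (simp add: counit_cls)
qed

lemma eig_exists_subalg:
  assumes g: "g \<in> matrix_coeffs D" and S: "S \<subseteq> carrier (UU D)"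
    and gen: "\<And>y. y \<in> S \<Longrightarrow> \<exists>s. eig D sd g y s" and y: "y \<in> subalg D S"
  shows "\<exists>s. eig D sd g y s"
  using y S
proof (induction rule: subalg_induct)
  case (scal s)
  then show ?case using eig_scal[OF g] by blast
next
  case (gen y)
  then show ?case by (rule assms(3))
next
  case (add x y)
  then show ?case using eig_add[OF g] by blast
next
  case (mult x y)
  then show ?case using eig_mult by blast
qed

lemma eig_unique: "eig D sd g y s \<Longrightarrow> eig D sd g y s' \<Longrightarrow> g (cls D x) \<noteq> 0 \<Longrightarrow> s = s'"
  unfolding eig_def by (metis mult_right_cancel)

text \<open>Eigenvalues on a nonzero function are unique, hence additive and multiplicative. The
  order of multiplication, which differs between the two sides, is lost because the values lie in a
  field.\<close>

lemma eig_character: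
  assumes g: "g \<in> matrix_coeffs D" and nz: "g (cls D x0) \<noteq> 0"
    and gen: "\<And>y. y \<in> U_black D \<union> (\<lambda>h. cls D (KK h)) ` Y_theta D \<union> B_gen D c ` white D \<Longrightarrow>
      \<exists>s. eig D sd g y s"
  shows "\<exists>\<chi>. \<chi> \<in> characters D (QSP_B D c) \<and> (\<forall>y\<in>QSP_B D c. eig D sd g y (\<chi> y))"
proof -
  let ?B = "QSP_B D c"
  define \<chi> where "\<chi> y = (SOME s. eig D sd g y s)" for y
  have \<chi>: "eig D sd g y (\<chi> y)" if "y \<in> ?B" for y
    unfolding \<chi>_def
    by (rule someI_ex[OF eig_exists_subalg[OF g B_gens_subset gen that[unfolded QSP_B_def]]])
  have \<chi>_eqI: "\<chi> y = s" if "y \<in> ?B" "eig D sd g y s" for y s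
    by (rule eig_unique[OF \<chi>[OF that(1)] that(2) nz])
  have sc: "\<chi> (cls D (scal s)) = s" for s
    by (rule \<chi>_eqI[OF _ eig_scal[OF g]]) (simp add: QSP_B_def subalg_scal)
  have "\<chi> \<in> Ring.ring_hom (UU D \<lparr>carrier := ?B\<rparr>) ring_of_type_algebra"
  proof (rule ring_hom_memI)
    fix x y assume "x \<in> carrier (UU D \<lparr>carrier := ?B\<rparr>)" "y \<in> carrier (UU D \<lparr>carrier := ?B\<rparr>)"
    then have B: "x \<in> ?B" "y \<in> ?B" by simp_all
    then have "x \<in> range (cls D)" "y \<in> range (cls D)"
      using QSP_B_subset[of D c] unfolding carrier_UU by blast+
    then obtain s t where st: "x = cls D s" "y = cls D t" by blast
    have "\<chi> (cls D (s * t)) = \<chi> x * \<chi> y" "\<chi> (cls D (s + t)) = \<chi> x + \<chi> y"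
      using B eig_mult[OF \<chi>[OF B(1), unfolded st] \<chi>[OF B(2), unfolded st]]
        eig_add[OF g \<chi>[OF B(1), unfolded st] \<chi>[OF B(2), unfolded st]] unfolding st
      by (auto intro!: \<chi>_eqI simp: QSP_B_def subalg_mult subalg_add)
    then show "\<chi> (x \<otimes>\<^bsub>UU D \<lparr>carrier := ?B\<rparr>\<^esub> y) = \<chi> x \<otimes>\<^bsub>ring_of_type_algebra\<^esub> \<chi> y"
      "\<chi> (x \<oplus>\<^bsub>UU D \<lparr>carrier := ?B\<rparr>\<^esub> y) = \<chi> x \<oplus>\<^bsub>ring_of_type_algebra\<^esub> \<chi> y"
      by (simp_all add: st cls_mult cls_add ring_of_type_algebra_def)
  next
    show "\<chi> \<one>\<^bsub>UU D \<lparr>carrier := ?B\<rparr>\<^esub> = \<one>\<^bsub>ring_of_type_algebra\<^esub>"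
      using sc[of 1] by (simp add: cls_one ring_of_type_algebra_def)
  qed (simp add: ring_of_type_algebra_def)
  then have "\<chi> \<in> characters D ?B" using sc by (simp add: characters_def)
  with \<chi> show ?thesis by blast
qed

text \<open>The eigenvalue is a root of a polynomial annihilating \<open>K\<^sub>h\<close> on the module.\<close>

lemma eig_KK_power:
  assumes g: "g \<in> matrix_coeffs D" and nz: "g (cls D x0) \<noteq> 0" and e: "eig D sd g (cls D (KK h)) e"
  shows "\<exists>n::int. e = qq powi n"
proof -
  obtain d \<sigma> wt z u where \<sigma>: "weight_rep D d \<sigma> wt"
    and geq: "g = (\<lambda>x. if x \<in> carrier (UU D) then bil d (\<sigma> x) z u else 0)"
    using matrix_coeff_bil[OF g] .
  define w where "w i j = qq powi pairing D h (wt (if sd then j else i))" for i j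
  \<comment> \<open>x0 multiplied t times by K_h on the chosen side: the value of g gains e^t, while
    each matrix entry gains the t-th power of a weight value. Combining these with the coefficients
    of P compares the two.\<close>
  define T where "T t = ((\<lambda>x. if sd then x * KK h else KK h * x) ^^ t) x0" for t
  have entry: "\<sigma> (cls D (T t)) $$ (i, j) = \<sigma> (cls D x0) $$ (i, j) * w i j ^ t" if "i < d" "j < d" for i j t
    by (induction t) (auto simp: T_def w_def weight_rep_KK[OF \<sigma> that])
  have gT: "g (cls D (T t)) = e ^ t * g (cls D x0)" for t
    using e unfolding eig_cls by (induction t) (simp_all add: T_def mult.assoc)
  define P where "P = (\<Prod>k<d. [: - (qq powi pairing D h (wt k)), 1 :])"
  have root: "poly P (w i j) = 0" if "i < d" "j < d" for i j
    using that by (auto simp: P_def poly_prod w_def)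
  have "poly P e * g (cls D x0) = (\<Sum>t\<le>Polynomial.degree P. Polynomial.coeff P t * g (cls D (T t)))"
    by (simp add: poly_altdef sum_distrib_right gT mult.assoc)
  also have "\<dots> = (\<Sum>t\<le>Polynomial.degree P. \<Sum>i<d. \<Sum>j<d.
      z i * \<sigma> (cls D x0) $$ (i, j) * u j * (Polynomial.coeff P t * w i j ^ t))"
    by (simp add: geq bil_def entry sum_distrib_left ac_simps)
  also have "\<dots> = (\<Sum>i<d. \<Sum>t\<le>Polynomial.degree P. \<Sum>j<d.
      z i * \<sigma> (cls D x0) $$ (i, j) * u j * (Polynomial.coeff P t * w i j ^ t))"
    by (rule sum.swap)
  also have "\<dots> = (\<Sum>i<d. \<Sum>j<d. \<Sum>t\<le>Polynomial.degree P.
      z i * \<sigma> (cls D x0) $$ (i, j) * u j * (Polynomial.coeff P t * w i j ^ t))"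
    by (intro sum.cong refl sum.swap)
  also have "\<dots> = (\<Sum>i<d. \<Sum>j<d. z i * \<sigma> (cls D x0) $$ (i, j) * u j * poly P (w i j))"
    by (simp only: poly_altdef sum_distrib_left)
  also have "\<dots> = 0" by (simp add: root)
  finally have "poly P e = 0" using nz by simp
  then show ?thesis by (auto simp: P_def poly_prod)
qed

section \<open>Weight components of a zonal function under Y^Theta\<close>

context satake_pair
begin

text \<open>As \<open>q\<^sup>n \<noteq> 1\<close> only if \<open>\<epsilon>(t) = 0\<close>, invariance under \<open>t\<close> passes to translates by \<open>K\<^sub>h\<close>.\<close>

definition theta_homog :: "('i, 'y) free \<Rightarrow> bool" where
  "theta_homog t \<longleftrightarrow> (\<forall>h\<in>Y_theta D. \<exists>n.
     KK h * t - scal (qq powi n) * t * KK h \<in> rel_ideal D \<and> (n = 0 \<or> counit_free t = 0))"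

lemma theta_homog_gens:
  "theta_homog (EE j)" "theta_homog (FF j)" "theta_homog (KK h)" "theta_homog (BB D c j)"
proof -
  show "theta_homog (EE j)" unfolding theta_homog_def using relations(3) by fastforce
  show "theta_homog (FF j)" unfolding theta_homog_def using relations(4) by fastforce
  show "theta_homog (KK h)" unfolding theta_homog_def
    using homog_commute[OF homog_KK[of D h]] by (metis pair_zero_right)
  show "theta_homog (BB D c j)" unfolding theta_homog_def using BB_commute by fastforce
qed

text \<open>Moving t across K_h to its own side costs a factor q^n. Either n = 0, or the counit of t
  is 0 and both sides vanish.\<close>

lemma eig_counit_conj:
  assumes f: "f \<in> matrix_coeffs D" and t: "theta_homog t" and e: "eig D sd f (cls D t) (counit_free t)"
    and h: "h \<in> Y_theta D" "h' \<in> Y_theta D"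
  shows "f (cls D (KK h' * (if sd then x * t else t * x) * KK h)) = counit_free t * f (cls D (KK h' * x * KK h))"
proof (cases sd)
  case True
  obtain n where n: "KK h * t - scal (qq powi n) * t * KK h \<in> rel_ideal D" "n = 0 \<or> counit_free t = 0"
    using t h(1) unfolding theta_homog_def by blast
  have "cls D (KK h' * x * (KK h * t)) = cls D (KK h' * x * (scal (qq powi n) * t * KK h))"
    using n(1) by (intro cls_lmult) (simp add: cls_eq_iff)
  also have "KK h' * x * (scal (qq powi n) * t * KK h) = scal (qq powi n) * (KK h' * (x * t) * KK h)"
    by (simp only: mult.assoc[symmetric] scal_commute)
  finally have "f (cls D (KK h' * x * KK h * t)) = qq powi n * f (cls D (KK h' * (x * t) * KK h))"
    by (simp add: matrix_coeff_scal[OF f] mult.assoc)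
  then have "counit_free t * f (cls D (KK h' * x * KK h)) = qq powi n * f (cls D (KK h' * (x * t) * KK h))"
    using e True by (simp add: eig_cls)
  then show ?thesis using n(2) True by auto
next
  case False
  obtain n where n: "KK h' * t - scal (qq powi n) * t * KK h' \<in> rel_ideal D" "n = 0 \<or> counit_free t = 0"
    using t h(2) unfolding theta_homog_def by blast
  have "cls D (KK h' * t * (x * KK h)) = cls D (scal (qq powi n) * t * KK h' * (x * KK h))"
    using n(1) by (intro cls_rmult) (simp add: cls_eq_iff)
  then have "f (cls D (KK h' * (t * x) * KK h)) = qq powi n * f (cls D (t * (KK h' * x * KK h)))"
    by (simp add: matrix_coeff_scal[OF f] mult.assoc)
  also have "\<dots> = qq powi n * (counit_free t * f (cls D (KK h' * x * KK h)))"
    using e False by (simp add: eig_cls)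
  also have "\<dots> = counit_free t * f (cls D (KK h' * x * KK h))" using n(2) by auto
  finally show ?thesis using False by simp
qed

text \<open>Weights are restricted to \<open>Y\<^sup>\<Theta>\<close>, so that distinct ones are separated by \<open>Y\<^sup>\<Theta>\<close>.\<close>

definition theta_decomposition ::
  "(('i, 'y) free set \<Rightarrow> kk) \<Rightarrow> ('y \<Rightarrow> kk) set \<Rightarrow>
   (('y \<Rightarrow> kk) \<Rightarrow> ('y \<Rightarrow> kk) \<Rightarrow> ('i, 'y) free set \<Rightarrow> kk) \<Rightarrow> bool" where
  "theta_decomposition f M G \<longleftrightarrow> finite M \<and> (\<forall>m\<in>M. m 0 = 1) \<and>
    (\<forall>m\<in>M. \<forall>h\<in>Y_theta D. \<forall>h'\<in>Y_theta D. m (h + h') = m h * m h') \<and>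
    (\<forall>m\<in>M. \<forall>m'\<in>M. (\<forall>h\<in>Y_theta D. m h = m' h) \<longrightarrow> m = m') \<and>
    (\<forall>k l. G k l \<in> matrix_coeffs D) \<and>
    (\<forall>x. f x = (\<Sum>k\<in>M. \<Sum>l\<in>M. G k l x)) \<and>
    (\<forall>k l. \<forall>h\<in>Y_theta D. eig D True (G k l) (cls D (KK h)) (l h)) \<and>
    (\<forall>k l. \<forall>h\<in>Y_theta D. eig D False (G k l) (cls D (KK h)) (k h))"

lemma theta_decompositionD:
  assumes "theta_decomposition f M G"
  shows "finite M" "\<And>m. m \<in> M \<Longrightarrow> m 0 = 1"
    "\<And>m h h'. m \<in> M \<Longrightarrow> h \<in> Y_theta D \<Longrightarrow> h' \<in> Y_theta D \<Longrightarrow> m (h + h') = m h * m h'"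
    "\<And>m m'. m \<in> M \<Longrightarrow> m' \<in> M \<Longrightarrow> (\<And>h. h \<in> Y_theta D \<Longrightarrow> m h = m' h) \<Longrightarrow> m = m'"
    "\<And>k l. G k l \<in> matrix_coeffs D"
    "\<And>x. f x = (\<Sum>k\<in>M. \<Sum>l\<in>M. G k l x)"
    "\<And>k l h. h \<in> Y_theta D \<Longrightarrow> eig D True (G k l) (cls D (KK h)) (l h)"
    "\<And>k l h. h \<in> Y_theta D \<Longrightarrow> eig D False (G k l) (cls D (KK h)) (k h)"
  using assms unfolding theta_decomposition_def by blast+

lemma theta_decomposition_exists:
  assumes f: "f \<in> matrix_coeffs D"
  obtains M G where "theta_decomposition f M G"
proof -
  obtain d \<sigma> wt z u where \<sigma>: "weight_rep D d \<sigma> wt"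
    and feq: "f = (\<lambda>x. if x \<in> carrier (UU D) then bil d (\<sigma> x) z u else 0)"
    using matrix_coeff_bil[OF f] .
  \<comment> \<open>The default 0 outside Y^Theta makes two restricted weights equal as functions as
    soon as they agree on Y^Theta.\<close>
  define \<kappa> where "\<kappa> j h = (if h \<in> Y_theta D then qq powi pair h (wt j) else 0)" for j h
  define M where "M = \<kappa> ` {..<d}"
  define G where "G a b x = (if x \<in> carrier (UU D) then bil d (\<sigma> x)
      (\<lambda>i. if \<kappa> i = a then z i else 0) (\<lambda>j. if \<kappa> j = b then u j else 0) else 0)" for a b x
  have "theta_decomposition f M G"
    unfolding theta_decomposition_def
  proof (intro conjI allI ballI impI)
    show fin: "finite M" by (simp add: M_def)
    show "m 0 = 1" if "m \<in> M" for m using that Y_theta_zero by (auto simp: M_def \<kappa>_def)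
    show "m (h + h') = m h * m h'" if "m \<in> M" "h \<in> Y_theta D" "h' \<in> Y_theta D" for m h h'
      using that Y_theta_add by (auto simp: M_def \<kappa>_def pair_add_left power_int_add)
    show "m = m'" if "m \<in> M" "m' \<in> M" "\<forall>h\<in>Y_theta D. m h = m' h" for m m'
    proof
      fix h
      show "m h = m' h" using that by (cases "h \<in> Y_theta D") (auto simp: M_def \<kappa>_def)
    qed
    show "G a b \<in> matrix_coeffs D" for a b
      unfolding G_def by (rule weight_rep_coeff[OF \<sigma>])
    show "f x = (\<Sum>a\<in>M. \<Sum>b\<in>M. G a b x)" for x
    proof (cases "x \<in> carrier (UU D)")
      case True
      have *: "(\<Sum>a\<in>M. \<Sum>b\<in>M. (if \<kappa> i = a then z i else 0) * \<sigma> x $$ (i, j) * (if \<kappa> j = b then u j else 0))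
          = z i * \<sigma> x $$ (i, j) * u j" if "i < d" "j < d" for i j
      proof -
        have "\<kappa> i \<in> M" "\<kappa> j \<in> M" using that by (auto simp: M_def)
        then have "(\<Sum>b\<in>M. (if \<kappa> j = b then u j else 0)) = u j" "(\<Sum>a\<in>M. (if \<kappa> i = a then z i else 0)) = z i"
          using fin by simp_all
        then show ?thesis by (simp flip: sum_distrib_left sum_distrib_right)
      qed
      have "(\<Sum>a\<in>M. \<Sum>b\<in>M. G a b x) = (\<Sum>a\<in>M. \<Sum>b\<in>M. \<Sum>i<d. \<Sum>j<d.
          (if \<kappa> i = a then z i else 0) * \<sigma> x $$ (i, j) * (if \<kappa> j = b then u j else 0))"
        using True by (simp add: G_def bil_def)
      also have "\<dots> = (\<Sum>a\<in>M. \<Sum>i<d. \<Sum>b\<in>M. \<Sum>j<d.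
          (if \<kappa> i = a then z i else 0) * \<sigma> x $$ (i, j) * (if \<kappa> j = b then u j else 0))"
        by (intro sum.cong refl sum.swap)
      also have "\<dots> = (\<Sum>i<d. \<Sum>a\<in>M. \<Sum>b\<in>M. \<Sum>j<d.
          (if \<kappa> i = a then z i else 0) * \<sigma> x $$ (i, j) * (if \<kappa> j = b then u j else 0))"
        by (rule sum.swap)
      also have "\<dots> = (\<Sum>i<d. \<Sum>a\<in>M. \<Sum>j<d. \<Sum>b\<in>M.
          (if \<kappa> i = a then z i else 0) * \<sigma> x $$ (i, j) * (if \<kappa> j = b then u j else 0))"
        by (intro sum.cong refl sum.swap)
      also have "\<dots> = (\<Sum>i<d. \<Sum>j<d. \<Sum>a\<in>M. \<Sum>b\<in>M.
          (if \<kappa> i = a then z i else 0) * \<sigma> x $$ (i, j) * (if \<kappa> j = b then u j else 0))"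
        by (intro sum.cong refl sum.swap)
      also have "\<dots> = (\<Sum>i<d. \<Sum>j<d. z i * \<sigma> x $$ (i, j) * u j)"
        by (intro sum.cong refl *) auto
      finally show ?thesis using True by (simp add: feq bil_def)
    qed (simp add: feq G_def)
    show "eig D True (G a b) (cls D (KK h)) (b h)" if "h \<in> Y_theta D" for a b h
      using that
      by (auto simp: eig_cls G_def bil_def sum_distrib_left \<kappa>_def weight_rep_KK[OF \<sigma>] intro!: sum.cong)
    show "eig D False (G a b) (cls D (KK h)) (a h)" if "h \<in> Y_theta D" for a b h
      using that
      by (auto simp: eig_cls G_def bil_def sum_distrib_left \<kappa>_def weight_rep_KK[OF \<sigma>] intro!: sum.cong)
  qed
  then show thesis by (rule that)
qed

text \<open>Let \<open>C a b\<close> be the defect of invariance of the component with weights a, b.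
  Evaluating f at K_{h'} x K_h shows that the defects, weighted by a(h') and b(h), sum to 0 for all
  h and h'. Independence of characters, applied first in h' and then in h, makes each defect
  vanish.\<close>

lemma component_invariant:
  assumes f: "f \<in> matrix_coeffs D" and dec: "theta_decomposition f M G"
    and t: "theta_homog t" and e: "eig D sd f (cls D t) (counit_free t)"
    and mem: "m1 \<in> M" "m2 \<in> M"
  shows "eig D sd (G m1 m2) (cls D t) (counit_free t)"
  unfolding eig_cls
proof
  fix x
  note fin = theta_decompositionD(1)[OF dec] and M0 = theta_decompositionD(2)[OF dec]
    and Mhom = theta_decompositionD(3)[OF dec] and Mdist = theta_decompositionD(4)[OF dec]
    and sum = theta_decompositionD(6)[OF dec] and right = theta_decompositionD(7)[OF dec]
    and left = theta_decompositionD(8)[OF dec]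
  let ?xt = "if sd then x * t else t * x"
  define C where "C a b = G a b (cls D ?xt) - counit_free t * G a b (cls D x)" for a b
  have conj: "f (cls D (KK h' * y * KK h)) = (\<Sum>a\<in>M. \<Sum>b\<in>M. a h' * (b h * G a b (cls D y)))"
    if "h \<in> Y_theta D" "h' \<in> Y_theta D" for h h' y
    using right[OF that(1)] left[OF that(2)] unfolding sum eig_cls by (simp add: ac_simps)
  have zero: "(\<Sum>a\<in>M. (\<Sum>b\<in>M. C a b * b h) * a h') = 0" if h: "h \<in> Y_theta D" "h' \<in> Y_theta D" for h h'
  proof -
    have "(\<Sum>a\<in>M. (\<Sum>b\<in>M. C a b * b h) * a h')
        = f (cls D (KK h' * ?xt * KK h)) - counit_free t * f (cls D (KK h' * x * KK h))"
      unfolding conj[OF h] C_def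
      by (simp add: sum_distrib_left sum_distrib_right sum_subtractf algebra_simps)
    then show ?thesis using eig_counit_conj[OF f t e h] by simp
  qed
  have inner: "(\<Sum>b\<in>M. C m1 b * b h) = 0" if h: "h \<in> Y_theta D" for h
  proof (rule dedekind_independence[where M = M and H = "Y_theta D" and C = "\<lambda>a. \<Sum>b\<in>M. C a b * b h" and m = m1])
    show "(\<Sum>a\<in>M. (\<Sum>b\<in>M. C a b * b h) * a h') = 0" if "h' \<in> Y_theta D" for h' by (rule zero[OF h that])
    show "m (h + h') = m h * m h'" if "m \<in> M" "h \<in> Y_theta D" "h' \<in> Y_theta D" for m h h' by (rule Mhom[OF that])
    show "m = m'" if "m \<in> M" "m' \<in> M" "\<And>h. h \<in> Y_theta D \<Longrightarrow> m h = m' h" for m m' by (rule Mdist[OF that])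
  qed (simp_all add: fin M0 mem Y_theta_zero Y_theta_add)
  have "C m1 m2 = 0"
  proof (rule dedekind_independence[where M = M and H = "Y_theta D" and C = "C m1" and m = m2])
    show "(\<Sum>b\<in>M. C m1 b * b h) = 0" if "h \<in> Y_theta D" for h by (rule inner[OF that])
    show "m (h + h') = m h * m h'" if "m \<in> M" "h \<in> Y_theta D" "h' \<in> Y_theta D" for m h h' by (rule Mhom[OF that])
    show "m = m'" if "m \<in> M" "m' \<in> M" "\<And>h. h \<in> Y_theta D \<Longrightarrow> m h = m' h" for m m' by (rule Mdist[OF that])
  qed (simp_all add: fin M0 mem Y_theta_zero Y_theta_add)
  then show "G m1 m2 (cls D ?xt) = counit_free t * G m1 m2 (cls D x)" by (simp add: C_def)
qed

lemma C_gens_theta_homog: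
  assumes "y \<in> black_gens D \<union> B_gen D c ` white D"
  obtains t where "y = cls D t" "theta_homog t"
  using assms theta_homog_gens by (auto simp: B_gen_eq Kw_def)

lemma black_gens_in_C: "black_gens D \<union> B_gen D c ` white D \<subseteq> QSP_C D c i"
  using black_gens_C[of D c i] unfolding QSP_C_def by (auto intro!: subalg_incl)

text \<open>A component has eigenvalue \<epsilon> for the black generators and the B_j, and its own
  weight for the K_h, which covers all generators of B and B'. Components that vanish determine no
  character and are discarded before pairs of characters are chosen.\<close>

lemma spherical_decomposition:
  assumes f: "f \<in> matrix_coeffs D"
    and inv: "\<And>c' x b. c' \<in> QSP_C D d i \<Longrightarrow> x \<in> carrier (UU D) \<Longrightarrow> b \<in> QSP_C D c i \<Longrightarrow>
      f (c' \<otimes>\<^bsub>UU D\<^esub> x \<otimes>\<^bsub>UU D\<^esub> b) = counit c' * f x * counit b"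
  shows "f \<in> character_spherical_sum D (QSP_B D d) (QSP_B D c)"
proof -
  have one_C: "cls D 1 \<in> QSP_C D e i" for e unfolding QSP_C_def by (rule subalg_one)
  have mem_cls: "\<exists>s. y = cls D s" if "y \<in> QSP_C D e i" for y e
    using QSP_C_subset_B[of D e i] QSP_B_subset[of D e] that by (auto simp: carrier_UU)
  have right: "eig D True f y (counit y)" if y: "y \<in> QSP_C D c i" for y
  proof -
    from mem_cls[OF y] obtain s where s: "y = cls D s" ..
    show ?thesis unfolding s eig_cls
    proof
      fix x
      show "f (cls D (if True then x * s else s * x)) = counit (cls D s) * f (cls D x)"
        using inv[OF one_C cls_closed y, of x] by (simp add: s counit_cls mult.commute flip: cls_mult)
    qed
  qed
  have left: "eig D False f y (counit y)" if y: "y \<in> QSP_C D d i" for y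
  proof -
    from mem_cls[OF y] obtain s where s: "y = cls D s" ..
    show ?thesis unfolding s eig_cls
    proof
      fix x
      show "f (cls D (if False then x * s else s * x)) = counit (cls D s) * f (cls D x)"
        using inv[OF y cls_closed one_C, of x] by (simp add: s counit_cls flip: cls_mult)
    qed
  qed
  obtain M G where dec: "theta_decomposition f M G" using theta_decomposition_exists[OF f] .
  note fin = theta_decompositionD(1)[OF dec] and Mdist = theta_decompositionD(4)[OF dec]
    and G = theta_decompositionD(5)[OF dec] and sum = theta_decompositionD(6)[OF dec]
    and KR = theta_decompositionD(7)[OF dec] and KL = theta_decompositionD(8)[OF dec]
  note comp = component_invariant[OF f dec]
  have gens: "\<exists>s. eig D sd (G a b) y s"
    if ab: "a \<in> M" "b \<in> M" and ef: "\<And>y. y \<in> QSP_C D e i \<Longrightarrow> eig D sd f y (counit y)"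
      and y: "y \<in> U_black D \<union> (\<lambda>h. cls D (KK h)) ` Y_theta D \<union> B_gen D e ` white D" for a b sd e y
  proof -
    have inv: "eig D sd (G a b) y (counit y)" if y': "y \<in> black_gens D \<union> B_gen D e ` white D" for y
    proof -
      obtain t where t: "y = cls D t" "theta_homog t" using C_gens_theta_homog[OF y'] .
      have "y \<in> QSP_C D e i" using black_gens_in_C[of e i] y' by blast
      from ef[OF this] have "eig D sd f (cls D t) (counit_free t)" by (simp add: t(1) counit_cls)
      from comp[OF t(2) this ab] show ?thesis by (simp add: t(1) counit_cls)
    qed
    from y consider "y \<in> U_black D" | h where "h \<in> Y_theta D" "y = cls D (KK h)"
      | "y \<in> B_gen D e ` white D" by blast
    then show ?thesis
    proof cases
      case 1
      have "black_gens D \<subseteq> carrier (UU D)" by auto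
      then have "eig D sd (G a b) y (counit y)"
        by (rule eig_counit_subalg[OF G _ _ 1[unfolded U_black_def]]) (use inv in blast)
      then show ?thesis ..
    next
      case 2
      then show ?thesis using KR[OF 2(1), of a b] KL[OF 2(1), of a b] by (cases sd) auto
    next
      case 3
      then show ?thesis using inv by blast
    qed
  qed
  define T where "T = {(a, b) \<in> M \<times> M. \<exists>x. G a b (cls D x) \<noteq> 0}"
  have finT: "finite T" unfolding T_def by (rule finite_subset[of _ "M \<times> M"]) (use fin in auto)
  have "\<exists>\<chi>' \<chi>. \<chi>' \<in> characters D (QSP_B D d) \<and> (\<forall>y\<in>QSP_B D d. eig D False (G (fst p) (snd p)) y (\<chi>' y)) \<and>
      \<chi> \<in> characters D (QSP_B D c) \<and> (\<forall>y\<in>QSP_B D c. eig D True (G (fst p) (snd p)) y (\<chi> y))" if p: "p \<in> T" for p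
  proof -
    obtain x where ab: "fst p \<in> M" "snd p \<in> M" and nz: "G (fst p) (snd p) (cls D x) \<noteq> 0"
      using p unfolding T_def by auto
    note L = eig_character[OF G nz gens[where e = d and sd = False, OF ab left]]
      and R = eig_character[OF G nz gens[where e = c and sd = True, OF ab right]]
    from L obtain \<chi>' where L: "\<chi>' \<in> characters D (QSP_B D d) \<and>
        (\<forall>y\<in>QSP_B D d. eig D False (G (fst p) (snd p)) y (\<chi>' y))" ..
    from R obtain \<chi> where "\<chi> \<in> characters D (QSP_B D c) \<and>
        (\<forall>y\<in>QSP_B D c. eig D True (G (fst p) (snd p)) y (\<chi> y))" ..
    with L show ?thesis by blast
  qed
  then have "\<forall>p\<in>T. \<exists>q. fst q \<in> characters D (QSP_B D d) \<and> (\<forall>y\<in>QSP_B D d. eig D False (G (fst p) (snd p)) y (fst q y)) \<and>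
      snd q \<in> characters D (QSP_B D c) \<and> (\<forall>y\<in>QSP_B D c. eig D True (G (fst p) (snd p)) y (snd q y))"
    by (metis fst_conv snd_conv)
  from bchoice[OF this] obtain \<Phi> where \<Phi>: "\<And>p. p \<in> T \<Longrightarrow>
      fst (\<Phi> p) \<in> characters D (QSP_B D d) \<and> (\<forall>y\<in>QSP_B D d. eig D False (G (fst p) (snd p)) y (fst (\<Phi> p) y)) \<and>
      snd (\<Phi> p) \<in> characters D (QSP_B D c) \<and> (\<forall>y\<in>QSP_B D c. eig D True (G (fst p) (snd p)) y (snd (\<Phi> p) y))"
    by blast
  have KB: "cls D (KK h) \<in> QSP_B D e" if "h \<in> Y_theta D" for h e
    unfolding QSP_B_def by (rule subalg_incl) (use that in blast)
  have \<Phi>K: "fst (\<Phi> p) (cls D (KK h)) = fst p h" "snd (\<Phi> p) (cls D (KK h)) = snd p h"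
    if p: "p \<in> T" and h: "h \<in> Y_theta D" for p h
  proof -
    obtain x where nz: "G (fst p) (snd p) (cls D x) \<noteq> 0" using p unfolding T_def by auto
    show "fst (\<Phi> p) (cls D (KK h)) = fst p h"
      using \<Phi>[OF p] KB[OF h] by (intro eig_unique[OF _ KL[OF h] nz]) blast
    show "snd (\<Phi> p) (cls D (KK h)) = snd p h"
      using \<Phi>[OF p] KB[OF h] by (intro eig_unique[OF _ KR[OF h] nz]) blast
  qed
  \<comment> \<open>\<open>character_spherical_sum\<close> allows one summand per pair of
    characters. Distinct components get distinct pairs, since the values of the characters at K_h
    give back the restricted weights.\<close>
  have inj: "inj_on \<Phi> T"
  proof (rule inj_onI)
    fix p q assume p: "p \<in> T" and q: "q \<in> T" and eq: "\<Phi> p = \<Phi> q"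
    have M: "fst p \<in> M" "snd p \<in> M" "fst q \<in> M" "snd q \<in> M" using p q unfolding T_def by auto
    have "fst p = fst q" using \<Phi>K(1)[OF p] \<Phi>K(1)[OF q] eq by (intro Mdist M) metis
    moreover have "snd p = snd q" using \<Phi>K(2)[OF p] \<Phi>K(2)[OF q] eq by (intro Mdist M) metis
    ultimately show "p = q" by (rule prod_eqI)
  qed
  define g where "g r = (\<lambda>p. G (fst p) (snd p)) (inv_into T \<Phi> r)" for r
  have g\<Phi>: "g (\<Phi> p) = G (fst p) (snd p)" if "p \<in> T" for p
    using inv_into_f_f[OF inj that] by (simp add: g_def)
  have off: "G a b x = 0" if "(a, b) \<in> M \<times> M - T" for a b x
  proof (cases "x \<in> carrier (UU D)")
    case True
    then show ?thesis using that by (auto simp: T_def carrier_UU)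
  next
    case False
    with G show ?thesis by (rule matrix_coeff_outside)
  qed
  have "f x = (\<Sum>r\<in>\<Phi> ` T. g r x)" for x
  proof -
    have "f x = (\<Sum>p\<in>M \<times> M. G (fst p) (snd p) x)"
      by (simp add: sum sum.cartesian_product case_prod_beta)
    also have "\<dots> = (\<Sum>p\<in>T. G (fst p) (snd p) x)"
    proof (rule sum.mono_neutral_right)
      show "\<forall>p\<in>M \<times> M - T. G (fst p) (snd p) x = 0"
      proof
        fix p assume "p \<in> M \<times> M - T"
        then have "(fst p, snd p) \<in> M \<times> M - T" by simp
        then show "G (fst p) (snd p) x = 0" by (rule off)
      qed
    qed (use fin in \<open>auto simp: T_def\<close>)
    also have "\<dots> = (\<Sum>p\<in>T. g (\<Phi> p) x)" by (rule sum.cong) (simp_all add: g\<Phi>)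
    also have "\<dots> = (\<Sum>r\<in>\<Phi> ` T. g r x)" by (simp add: sum.reindex[OF inj])
    finally show ?thesis .
  qed
  moreover have "g r \<in> spherical D (QSP_B D d) (QSP_B D c) (fst r) (snd r)" if r: "r \<in> \<Phi> ` T" for r
  proof -
    obtain p where p: "p \<in> T" "r = \<Phi> p" using r by blast
    have "g r (b' \<otimes>\<^bsub>UU D\<^esub> x \<otimes>\<^bsub>UU D\<^esub> b) = fst r b' * g r x * snd r b"
      if b': "b' \<in> QSP_B D d" and x: "x \<in> carrier (UU D)" and b: "b \<in> QSP_B D c" for b' x b
    proof -
      have "b' \<in> range (cls D)" "x \<in> range (cls D)" "b \<in> range (cls D)"
        using b' x b QSP_B_subset[of D d] QSP_B_subset[of D c] unfolding carrier_UU by blast+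
      then obtain s t y where sty: "b' = cls D s" "b = cls D t" "x = cls D y" by blast
      have L: "eig D False (g r) (cls D s) (fst r b')" and R: "eig D True (g r) (cls D t) (snd r b)"
        using \<Phi>[OF p(1)] b' b by (simp_all add: p(2) g\<Phi>[OF p(1)] sty)
      have "g r (cls D (s * y * t)) = snd r b * g r (cls D (s * y))"
        using R by (simp add: eig_cls)
      also have "g r (cls D (s * y)) = fst r b' * g r (cls D y)"
        using L by (simp add: eig_cls)
      finally show ?thesis by (simp add: sty mult.commute flip: cls_mult)
    qed
    then show ?thesis using G by (simp add: spherical_def p(2) g\<Phi>[OF p(1)])
  qed
  moreover have "\<Phi> ` T \<subseteq> characters D (QSP_B D d) \<times> characters D (QSP_B D c)"
  proof (rule image_subsetI)
    fix p assume "p \<in> T"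
    from \<Phi>[OF this] show "\<Phi> p \<in> characters D (QSP_B D d) \<times> characters D (QSP_B D c)"
      unfolding mem_Times_iff by blast
  qed
  ultimately show ?thesis
    unfolding character_spherical_sum_def using finT
    by (intro CollectI exI[of _ "\<Phi> ` T"] exI[of _ g]) auto
qed

end

section \<open>Character spherical functions are zonal\<close>

context aiv_pair
begin

text \<open>If g vanishes on U there is nothing to show, and nothing is known about the characters.
  Otherwise a nonzero value of g makes both of them powers of q on the K_h, and
  \<open>character_on_C\<close> applies on either side.\<close>

lemma spherical_invariant:
  assumes c: "admissible_params D bar c" and d: "admissible_params D bar' d"
    and g: "g \<in> spherical D (QSP_B D d) (QSP_B D c) \<chi>' \<chi>"
    and ch: "\<chi>' \<in> characters D (QSP_B D d)" "\<chi> \<in> characters D (QSP_B D c)"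
    and mem: "c' \<in> QSP_C D d i0" "x \<in> carrier (UU D)" "b \<in> QSP_C D c i0"
  shows "g (c' \<otimes>\<^bsub>UU D\<^esub> x \<otimes>\<^bsub>UU D\<^esub> b) = counit c' * g x * counit b"
proof -
  have mc: "g \<in> matrix_coeffs D"
    and sph: "\<And>b' x b. b' \<in> QSP_B D d \<Longrightarrow> x \<in> carrier (UU D) \<Longrightarrow> b \<in> QSP_B D c \<Longrightarrow>
      g (b' \<otimes>\<^bsub>UU D\<^esub> x \<otimes>\<^bsub>UU D\<^esub> b) = \<chi>' b' * g x * \<chi> b"
    using g by (simp_all add: spherical_def)
  have B: "c' \<in> QSP_B D d" "b \<in> QSP_B D c" using mem QSP_C_subset_B[of D d i0] QSP_C_subset_B[of D c i0] by blast+
  have ring: "ring (UU D)" by (rule ring_UU)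
  have one_B: "cls D 1 \<in> QSP_B D e" for e unfolding QSP_B_def by (rule subalg_one)
  have \<chi>1: "\<chi>' (cls D 1) = 1" "\<chi> (cls D 1) = 1"
    using ch by (simp_all add: characters_def flip: scal_1)
  show ?thesis
  proof (cases "\<exists>y. g (cls D y) \<noteq> 0")
    case False
    then have "g z = 0" if "z \<in> carrier (UU D)" for z using that by (auto simp: carrier_UU)
    moreover have "c' \<otimes>\<^bsub>UU D\<^esub> x \<otimes>\<^bsub>UU D\<^esub> b \<in> carrier (UU D)"
      using mem B QSP_B_subset ring by (intro monoid.m_closed[OF ring.axioms(2)]) blast+
    ultimately show ?thesis using mem(2) by simp
  next
    case True
    then obtain y where nz: "g (cls D y) \<noteq> 0" ..
    have eR: "eig D True g (cls D (KK h)) (\<chi> (cls D (KK h)))" if "cls D (KK h) \<in> QSP_B D c" for h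
      using sph[OF one_B cls_closed that] by (simp add: eig_cls \<chi>1 mult.commute flip: cls_mult)
    have eL: "eig D False g (cls D (KK h)) (\<chi>' (cls D (KK h)))" if "cls D (KK h) \<in> QSP_B D d" for h
      using sph[OF that cls_closed one_B] by (simp add: eig_cls \<chi>1 flip: cls_mult)
    interpret R: weight_character D i0 p c \<chi>
    proof
      show "c j \<noteq> 0" if "j \<notin> bl" for j using c that by (auto simp: admissible_params_def)
      show "c (\<tau> j) = c j" if "j \<notin> bl" "form D (\<alpha> j) (thetaX D (\<alpha> j)) = 0" for j
        using c that by (auto simp: admissible_params_def)
      show "\<chi> \<in> characters D (QSP_B D c)" by (rule ch)
      show "\<exists>n::int. \<chi> (cls D (KK h)) = qq powi n" if "cls D (KK h) \<in> QSP_B D c" for h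
        by (rule eig_KK_power[OF mc nz eR[OF that]])
    qed
    interpret L: weight_character D i0 p d \<chi>'
    proof
      show "d j \<noteq> 0" if "j \<notin> bl" for j using d that by (auto simp: admissible_params_def)
      show "d (\<tau> j) = d j" if "j \<notin> bl" "form D (\<alpha> j) (thetaX D (\<alpha> j)) = 0" for j
        using d that by (auto simp: admissible_params_def)
      show "\<chi>' \<in> characters D (QSP_B D d)" by (rule ch)
      show "\<exists>n::int. \<chi>' (cls D (KK h)) = qq powi n" if "cls D (KK h) \<in> QSP_B D d" for h
        by (rule eig_KK_power[OF mc nz eL[OF that]])
    qed
    show ?thesis
      using sph[OF B(1) mem(2) B(2)] R.character_on_C[OF mem(3)] L.character_on_C[OF mem(1)] by simp
  qed
qed

end

theorem proposition8p16:
  fixes D :: "('i::finite, 'x::ab_group_add, 'y::ab_group_add) satake_datum"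
    and bar :: "kk \<Rightarrow> kk" and c d :: "'i \<Rightarrow> kk" and i :: 'i
  assumes "root_datum D" and "satake_diagram D" and "irreducible_diagram D"
    and "i \<in> white D" and "type_AIV D i"
    and "bar_automorphism bar"
    and "admissible_params D bar c" and "admissible_params D bar d"
  shows "{f \<in> matrix_coeffs D.
            \<forall>c'\<in>QSP_C D d i. \<forall>x\<in>carrier (UU D). \<forall>b\<in>QSP_C D c i.
              f (c' \<otimes>\<^bsub>UU D\<^esub> x \<otimes>\<^bsub>UU D\<^esub> b) = counit c' * f x * counit b}
         = character_spherical_sum D (QSP_B D d) (QSP_B D c)"
proof -
  from assms(5) obtain p where p: "distinct p" "set p = rank_one_subdiagram D i" "length p \<ge> 2"
    "\<And>m n. m < length p \<Longrightarrow> n < length p \<Longrightarrow>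
           cartan D (p ! m) (p ! n) = (if m = n then 2 else if m = Suc n \<or> n = Suc m then -1 else 0)"
    "hd p = i" "last p = tau D i" "\<And>m. 0 < m \<Longrightarrow> m < length p - 1 \<Longrightarrow> p ! m \<in> black D"
    unfolding type_AIV_def by blast
  interpret aiv_pair D i p
    by unfold_locales (use assms p in \<open>simp_all\<close>)
  show ?thesis
  proof (intro equalityI subsetI)
    fix f
    assume "f \<in> {f \<in> matrix_coeffs D.
            \<forall>c'\<in>QSP_C D d i. \<forall>x\<in>carrier (UU D). \<forall>b\<in>QSP_C D c i.
              f (c' \<otimes>\<^bsub>UU D\<^esub> x \<otimes>\<^bsub>UU D\<^esub> b) = counit c' * f x * counit b}"
    then show "f \<in> character_spherical_sum D (QSP_B D d) (QSP_B D c)"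
      by (intro spherical_decomposition[of f d i c]) auto
  next
    fix f assume "f \<in> character_spherical_sum D (QSP_B D d) (QSP_B D c)"
    then obtain P g where f: "f = (\<lambda>x. \<Sum>q\<in>P. g q x)"
      and P: "finite P" "P \<subseteq> characters D (QSP_B D d) \<times> characters D (QSP_B D c)"
      and g: "\<And>q. q \<in> P \<Longrightarrow> g q \<in> spherical D (QSP_B D d) (QSP_B D c) (fst q) (snd q)"
      unfolding character_spherical_sum_def by blast
    have "f \<in> matrix_coeffs D"
      unfolding f by (rule matrix_coeffs_sum) (use g in \<open>auto simp: spherical_def\<close>)
    moreover have "f (c' \<otimes>\<^bsub>UU D\<^esub> x \<otimes>\<^bsub>UU D\<^esub> b) = counit c' * f x * counit b"
      if mem: "c' \<in> QSP_C D d i" "x \<in> carrier (UU D)" "b \<in> QSP_C D c i" for c' x b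
    proof -
      have "g q (c' \<otimes>\<^bsub>UU D\<^esub> x \<otimes>\<^bsub>UU D\<^esub> b) = counit c' * g q x * counit b" if q: "q \<in> P" for q
        using spherical_invariant[OF assms(7,8) g[OF q] _ _ mem] P(2) q by (auto simp: mem_Times_iff)
      then show ?thesis by (simp add: f sum_distrib_left sum_distrib_right)
    qed
    ultimately show "f \<in> {f \<in> matrix_coeffs D.
            \<forall>c'\<in>QSP_C D d i. \<forall>x\<in>carrier (UU D). \<forall>b\<in>QSP_C D c i.
              f (c' \<otimes>\<^bsub>UU D\<^esub> x \<otimes>\<^bsub>UU D\<^esub> b) = counit c' * f x * counit b}" by blast
  qed
qed

end
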